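(* Let $p$ be a prime and let $G$ be a finite $p$-group such that $G_3\cong C_p$, $\Phi(G')G_3\cong C_p^2$, $G/\Phi(G')G_3\cong M_p(n,m,1)$ where $n\ge m$, and the type of the abelian group $C_G(G')/\Phi(G')G_3$ is $(p^n,p^{m-1},p)$. Then $G$ is isomorphic to one of the following groups, and the listed groups (different types, or the same type with different parameter values) are pairwise non-isomorphic: (K1) $\langle a,b,c\mid a^8=b^4=c^4=1,[a,b]=c,[c,a]=1,[c,b]=c^2a^4\rangle$; (K2) $\langle a,b,c\mid a^8=b^8=1,c^2=b^4,[a,b]=c,[c,a]=1,[c,b]=a^4b^4\rangle$; (K3) $\langle a,b,c,d\mid a^8=b^4=d^2=1,c^2=a^4,[a,b]=c,[c,a]=1,[c,b]=d,[d,a]=[d,b]=1\rangle$; (K4) $\langle a,b,c\mid a^8=b^8=1,c^2=a^4,[a,b]=c,[c,a]=1,[c,b]=b^4\rangle$; (K5) $\langle a,b,c,d\mid a^8=d^2=1,b^4=c^2=a^4,[a,b]=c,[c,a]=1,[c,b]=d,[d,a]=[d,b]=1\rangle$; (K6) $\langle a,b,c\mid a^8=b^8=1,c^2=a^4,[a,b]=c,[c,a]=1,[c,b]=a^4b^4\rangle$; (K7) $\langle a,b,c\mid a^8=b^4=c^4=1,[a,b]=c,[c,a]=1,[c,b]=a^4\rangle$; (K8) $\langle a,b,c\mid a^8=b^8=1,c^2=b^4,[a,b]=c,[c,a]=1,[c,b]=a^4\rangle$; (K9) $\langle a,b,c,d\mid a^4=b^4=c^4=d^2=1,[a,b]=c,[c,b]=d,[c,a]=[d,a]=[d,b]=1\rangle$;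 (K10) $\langle a,b,c\mid a^4=b^8=c^4=1,[a,b]=c,[c,a]=1,[c,b]=b^4\rangle$; In (L1)--(L9): $n\ge m\ge2$, and $n\ge3$ if $p=2$. (L1) $\langle a,b,c\mid a^{p^{n+1}}=b^{p^{m+1}}=1,[a,b]=c,c^p=a^{p^n}b^{sp^m},[c,a]=1,[b,c]=b^{p^m}\rangle$, where $s\in F_p$; (L2) $\langle a,b,c\mid a^{p^{n+1}}=b^{p^m}=c^{p^2}=1,[a,b]=c,[c,a]=1,[c,b]=c^{tp}a^{-tp^n}\rangle$, where $t\in F_p^*$; (L3) $\langle a,b,c,d\mid a^{p^{n+1}}=b^{p^m}=d^p=1,c^p=a^{p^n},[a,b]=c,[c,a]=1,[c,b]=d,[d,a]=[d,b]=1\rangle$; (L4) $\langle a,b,c\mid a^{p^{n+1}}=b^{p^{m+1}}=1,[a,b]=c,c^p=b^{p^m},[c,a]=1,[b,c]=a^{\nu p^n}\rangle$, where $\nu=1$ or a fixed quadratic non-residue modulo $p$; (L5) $\langle a,b,c\mid a^{p^{n+1}}=b^{p^m}=c^{p^2}=1,[a,b]=c,[c,a]=1,[b,c]=a^{\nu p^n}\rangle$, where $\nu=1$ or a fixed quadratic non-residue modulo $p$; (L6) $\langle a,b,c\mid a^{p^n}=b^{p^{m+1}}=c^{p^2}=1,[a,b]=c,[c,a]=1,[c,b]=c^pb^{-p^m},[b^{p^m},a]=1\rangle$; (L7) $\langle a,b,c,d\mid a^{p^n}=b^{p^{m+1}}=d^p=1,c^p=b^{p^m},[a,b]=c,[c,a]=1,[c,b]=d,[d,a]=[d,b]=1\rangle$;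 (L8) $\langle a,b,c\mid a^{p^n}=b^{p^{m+1}}=c^{p^2}=1,[a,b]=c,[c,a]=1,[b,c]=b^{p^m}\rangle$; (L9) $\langle a,b,c,d\mid a^{p^n}=b^{p^m}=c^{p^2}=d^p=1,[a,b]=c,[c,a]=1,[c,b]=d,[d,a]=[d,b]=1\rangle$.
   Context: All groups are finite $p$-groups; $G_3=[G',G]$, $\Phi(H)$ is the Frattini subgroup of $H$, $[x,y]=x^{-1}y^{-1}xy$. For $n\ge m\ge 1$ (with $n>1$ if $p=2$, a standing assumption), $M_p(n,m,1)=\langle a,b,c\mid a^{p^n}=b^{p^m}=c^p=1,\ [a,b]=c,\ [c,a]=[c,b]=1\rangle$. An abelian group has type $(p^{e_1},p^{e_2},p^{e_3})$ if it is isomorphic to $C_{p^{e_1}}\times C_{p^{e_2}}\times C_{p^{e_3}}$. $F_p$ is the field with $p$ elements, $F_p^*=F_p\setminus\{0\}$; parameters in exponents are represented by integers in $\{0,\dots,p-1\}$. Where $\nu$ occurs, one quadratic non-residue modulo $p$ is fixed; for $p=2$ only $\nu=1$ occurs. The groups of type (K) are 2-groups. *)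

theory Defs
  imports "HOL-Algebra.Algebra" "HOL-Number_Theory.Number_Theory"
begin

section \<open>Group presentations\<close>

datatype (gens: 'g) gword =
  Gen 'g | GOne | GInv "'g gword" | GMul "'g gword" "'g gword"

text \<open>Only the syntactic classes are instantiated, so that words can be written with
  \<open>1\<close>, \<open>*\<close>, \<open>^\<close> and \<open>inverse\<close>; no group law holds on the words themselves.\<close>

instantiation gword :: (type) "{power, inverse}"
begin
definition one_gword :: "'a gword" where "1 = GOne"
definition times_gword :: "'a gword \<Rightarrow> 'a gword \<Rightarrow> 'a gword" where "u * v = GMul u v"
definition inverse_gword :: "'a gword \<Rightarrow> 'a gword" where "inverse u = GInv u"
definition divide_gword :: "'a gword \<Rightarrow> 'a gword \<Rightarrow> 'a gword" where "u div v = GMul u (GInv v)"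
instance ..
end

definition comm :: "'g gword \<Rightarrow> 'g gword \<Rightarrow> 'g gword" where
  "comm u v = inverse u * inverse v * u * v"

text \<open>Equality of words over the generators \<open>S\<close> in the group with defining relations \<open>R\<close>:
  the least congruence that contains \<open>R\<close> and satisfies the group axioms.\<close>

inductive pres_eq :: "'g set \<Rightarrow> ('g gword \<times> 'g gword) set \<Rightarrow> 'g gword \<Rightarrow> 'g gword \<Rightarrow> bool"
  for S :: "'g set" and R :: "('g gword \<times> 'g gword) set" where
  relator: "\<lbrakk>(u, v) \<in> R; gens u \<subseteq> S; gens v \<subseteq> S\<rbrakk> \<Longrightarrow> pres_eq S R u v"
| refl: "gens u \<subseteq> S \<Longrightarrow> pres_eq S R u u"
| sym: "pres_eq S R u v \<Longrightarrow> pres_eq S R v u"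
| trans: "\<lbrakk>pres_eq S R u v; pres_eq S R v w\<rbrakk> \<Longrightarrow> pres_eq S R u w"
| mult: "\<lbrakk>pres_eq S R u u'; pres_eq S R v v'\<rbrakk> \<Longrightarrow> pres_eq S R (u * v) (u' * v')"
| inv: "pres_eq S R u u' \<Longrightarrow> pres_eq S R (inverse u) (inverse u')"
| assoc: "\<lbrakk>gens u \<subseteq> S; gens v \<subseteq> S; gens w \<subseteq> S\<rbrakk> \<Longrightarrow> pres_eq S R (u * v * w) (u * (v * w))"
| l_one: "gens u \<subseteq> S \<Longrightarrow> pres_eq S R (1 * u) u"
| l_inv: "gens u \<subseteq> S \<Longrightarrow> pres_eq S R (inverse u * u) 1"

definition word_class :: "'g set \<Rightarrow> ('g gword \<times> 'g gword) set \<Rightarrow> 'g gword \<Rightarrow> 'g gword set" where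
  "word_class S R u = {v. pres_eq S R u v}"

definition presented_group ::
    "'g set \<Rightarrow> ('g gword \<times> 'g gword) set \<Rightarrow> 'g gword set monoid" where
  "presented_group S R =
     \<lparr>carrier = word_class S R ` {u. gens u \<subseteq> S},
      monoid.mult = (\<lambda>U V. \<Union>u\<in>U. \<Union>v\<in>V. word_class S R (u * v)),
      one = word_class S R 1\<rparr>"

lemma gens_simps [simp]:
  "gens (1 :: 'g gword) = {}" "gens (u * v) = gens u \<union> gens v" "gens (inverse u) = gens u"
  by (simp_all add: one_gword_def times_gword_def inverse_gword_def)

lemma pres_eq_gens: "pres_eq S R u v \<Longrightarrow> gens u \<subseteq> S \<and> gens v \<subseteq> S"
  by (induction rule: pres_eq.induct) auto

lemma word_class_eq_iff:
  assumes "gens u \<subseteq> S"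
  shows "word_class S R u = word_class S R v \<longleftrightarrow> pres_eq S R u v"
proof
  assume "word_class S R u = word_class S R v"
  moreover have "u \<in> word_class S R u"
    using assms by (simp add: word_class_def pres_eq.refl)
  ultimately have "pres_eq S R v u"
    by (simp add: word_class_def)
  then show "pres_eq S R u v"
    by (rule pres_eq.sym)
next
  assume "pres_eq S R u v"
  then have "pres_eq S R u w \<longleftrightarrow> pres_eq S R v w" for w
    using pres_eq.sym pres_eq.trans by metis
  then show "word_class S R u = word_class S R v"
    by (simp add: word_class_def)
qed

lemma word_class_eqI: "pres_eq S R u v \<Longrightarrow> word_class S R u = word_class S R v"
  using word_class_eq_iff[of u S R v] pres_eq_gens[of S R u v] by simp

lemma mult_presented_group:
  assumes "gens u \<subseteq> S" "gens v \<subseteq> S"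
  shows "word_class S R u \<otimes>\<^bsub>presented_group S R\<^esub> word_class S R v = word_class S R (u * v)"
proof -
  have "word_class S R (u' * v') = word_class S R (u * v)"
    if "u' \<in> word_class S R u" "v' \<in> word_class S R v" for u' v'
  proof -
    have "pres_eq S R (u * v) (u' * v')"
      using that by (simp add: word_class_def pres_eq.mult)
    then show ?thesis
      by (rule word_class_eqI[symmetric])
  qed
  moreover have "u \<in> word_class S R u" "v \<in> word_class S R v"
    using assms by (auto simp: word_class_def intro: pres_eq.refl)
  ultimately have "(\<Union>u'\<in>word_class S R u. \<Union>v'\<in>word_class S R v. word_class S R (u' * v'))
      = word_class S R (u * v)"
    by blast
  then show ?thesis
    by (simp add: presented_group_def)
qed

lemma carrier_presented_group:
  "carrier (presented_group S R) = word_class S R ` {u. gens u \<subseteq> S}"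
  by (simp add: presented_group_def)

lemma one_presented_group: "\<one>\<^bsub>presented_group S R\<^esub> = word_class S R 1"
  by (simp add: presented_group_def)

lemma group_presented_group: "group (presented_group S R)"
proof (rule groupI)
  show "\<one>\<^bsub>presented_group S R\<^esub> \<in> carrier (presented_group S R)"
    by (simp add: carrier_presented_group one_presented_group)
next
  fix U V assume "U \<in> carrier (presented_group S R)" "V \<in> carrier (presented_group S R)"
  then show "U \<otimes>\<^bsub>presented_group S R\<^esub> V \<in> carrier (presented_group S R)"
    by (auto simp: carrier_presented_group mult_presented_group)
next
  fix U V W
  assume "U \<in> carrier (presented_group S R)" "V \<in> carrier (presented_group S R)"
    "W \<in> carrier (presented_group S R)"
  then show "U \<otimes>\<^bsub>presented_group S R\<^esub> V \<otimes>\<^bsub>presented_group S R\<^esub> W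
    = U \<otimes>\<^bsub>presented_group S R\<^esub> (V \<otimes>\<^bsub>presented_group S R\<^esub> W)"
    by (auto simp: carrier_presented_group mult_presented_group
        word_class_eqI[OF pres_eq.assoc])
next
  fix U assume "U \<in> carrier (presented_group S R)"
  then show "\<one>\<^bsub>presented_group S R\<^esub> \<otimes>\<^bsub>presented_group S R\<^esub> U = U"
    by (auto simp: carrier_presented_group one_presented_group mult_presented_group
        word_class_eqI[OF pres_eq.l_one])
next
  fix U assume "U \<in> carrier (presented_group S R)"
  then obtain u where u: "gens u \<subseteq> S" "U = word_class S R u"
    by (auto simp: carrier_presented_group)
  then have "word_class S R (inverse u) \<otimes>\<^bsub>presented_group S R\<^esub> U = \<one>\<^bsub>presented_group S R\<^esub>"
    by (simp add: one_presented_group mult_presented_group word_class_eqI pres_eq.l_inv)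
  moreover have "word_class S R (inverse u) \<in> carrier (presented_group S R)"
    using u by (simp add: carrier_presented_group)
  ultimately show "\<exists>V\<in>carrier (presented_group S R).
      V \<otimes>\<^bsub>presented_group S R\<^esub> U = \<one>\<^bsub>presented_group S R\<^esub>"
    by blast
qed

primrec word_eval :: "('a, 'b) monoid_scheme \<Rightarrow> ('g \<Rightarrow> 'a) \<Rightarrow> 'g gword \<Rightarrow> 'a" where
  "word_eval G f (Gen x) = f x"
| "word_eval G f GOne = \<one>\<^bsub>G\<^esub>"
| "word_eval G f (GInv u) = inv\<^bsub>G\<^esub> (word_eval G f u)"
| "word_eval G f (GMul u v) = word_eval G f u \<otimes>\<^bsub>G\<^esub> word_eval G f v"

lemma (in group) word_eval_closed:
  "\<lbrakk>f \<in> S \<rightarrow> carrier G; gens u \<subseteq> S\<rbrakk> \<Longrightarrow> word_eval G f u \<in> carrier G"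
  by (induction u) auto

text \<open>The universal property (von Dyck's theorem).\<close>

lemma (in group) presented_group_hom:
  assumes f: "f \<in> S \<rightarrow> carrier G"
    and R: "\<And>u v. \<lbrakk>(u, v) \<in> R; gens u \<subseteq> S; gens v \<subseteq> S\<rbrakk>
              \<Longrightarrow> word_eval G f u = word_eval G f v"
  shows "\<exists>h \<in> hom (presented_group S R) G. \<forall>u. gens u \<subseteq> S
           \<longrightarrow> h (word_class S R u) = word_eval G f u"
proof -
  note [simp] = one_gword_def times_gword_def inverse_gword_def
  have ev: "word_eval G f u = word_eval G f v" if "pres_eq S R u v" for u v
    using that
  proof (induction rule: pres_eq.induct)
    case (assoc u v w)
    then show ?case by (simp add: word_eval_closed[OF f] m_assoc)
  qed (simp_all add: R word_eval_closed[OF f])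
  define h where "h U = word_eval G f (SOME u. u \<in> U)" for U
  have h: "h (word_class S R u) = word_eval G f u" if "gens u \<subseteq> S" for u
  proof -
    have "u \<in> word_class S R u"
      using that by (simp add: word_class_def pres_eq.refl)
    then have "(SOME v. v \<in> word_class S R u) \<in> word_class S R u"
      by (rule someI)
    then show ?thesis
      unfolding h_def word_class_def using ev by (metis mem_Collect_eq)
  qed
  have "h \<in> hom (presented_group S R) G"
  proof (rule homI)
    fix U assume "U \<in> carrier (presented_group S R)"
    then show "h U \<in> carrier G"
      by (auto simp: carrier_presented_group h word_eval_closed[OF f])
  next
    fix U V assume "U \<in> carrier (presented_group S R)" "V \<in> carrier (presented_group S R)"
    then obtain u v where *: "gens u \<subseteq> S" "gens v \<subseteq> S"
      "U = word_class S R u" "V = word_class S R v"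
      by (auto simp: carrier_presented_group)
    then have "h (U \<otimes>\<^bsub>presented_group S R\<^esub> V) = word_eval G f (u * v)"
      by (simp only: mult_presented_group h gens_simps Un_least)
    then show "h (U \<otimes>\<^bsub>presented_group S R\<^esub> V) = h U \<otimes> h V"
      using * by (simp add: h)
  qed
  with h show ?thesis by blast
qed

section \<open>Subgroups\<close>

definition commutator_subgroup ::
    "('a, 'b) monoid_scheme \<Rightarrow> 'a set \<Rightarrow> 'a set \<Rightarrow> 'a set" where
  "commutator_subgroup G H K =
     generate G {inv\<^bsub>G\<^esub> x \<otimes>\<^bsub>G\<^esub> inv\<^bsub>G\<^esub> y \<otimes>\<^bsub>G\<^esub> x \<otimes>\<^bsub>G\<^esub> y | x y. x \<in> H \<and> y \<in> K}"

text \<open>The library's \<^const>\<open>derived\<close> is generated by the commutators in the other convention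
  \<open>x y x\<^sup>-\<^sup>1 y\<^sup>-\<^sup>1\<close>; over the whole group these are the same elements.\<close>

abbreviation derived_subgroup :: "('a, 'b) monoid_scheme \<Rightarrow> 'a set" where
  "derived_subgroup G \<equiv> derived G (carrier G)"

definition G3 :: "('a, 'b) monoid_scheme \<Rightarrow> 'a set" where
  "G3 G = commutator_subgroup G (derived_subgroup G) (carrier G)"

definition maximal_subgroup :: "'a set \<Rightarrow> ('a, 'b) monoid_scheme \<Rightarrow> bool" where
  "maximal_subgroup M G \<longleftrightarrow> subgroup M G \<and> M \<noteq> carrier G \<and>
     (\<forall>L. subgroup L G \<and> M \<subseteq> L \<longrightarrow> L = M \<or> L = carrier G)"

text \<open>Intersecting with the carrier makes a group without maximal subgroups its own
  Frattini subgroup.\<close>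

definition frattini :: "('a, 'b) monoid_scheme \<Rightarrow> 'a set" where
  "frattini G = carrier G \<inter> \<Inter>{M. maximal_subgroup M G}"

definition PhiG3 :: "('a, 'b) monoid_scheme \<Rightarrow> 'a set" where
  "PhiG3 G = frattini (G\<lparr>carrier := derived_subgroup G\<rparr>) <#>\<^bsub>G\<^esub> G3 G"

definition centralizer :: "('a, 'b) monoid_scheme \<Rightarrow> 'a set \<Rightarrow> 'a set" where
  "centralizer G H = {g \<in> carrier G. \<forall>h\<in>H. g \<otimes>\<^bsub>G\<^esub> h = h \<otimes>\<^bsub>G\<^esub> g}"

definition has_abelian_type3 :: "('a, 'b) monoid_scheme \<Rightarrow> nat \<Rightarrow> nat \<Rightarrow> nat \<Rightarrow> bool" where
  "has_abelian_type3 G i j k \<longleftrightarrow>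
     G \<cong> integer_mod_group i \<times>\<times> (integer_mod_group j \<times>\<times> integer_mod_group k)"

section \<open>The groups of the classification\<close>

datatype letter = La | Lb | Lc | Ld

abbreviation \<aa> :: "letter gword" where "\<aa> \<equiv> Gen La"
abbreviation \<bb> :: "letter gword" where "\<bb> \<equiv> Gen Lb"
abbreviation \<cc> :: "letter gword" where "\<cc> \<equiv> Gen Lc"
abbreviation \<dd> :: "letter gword" where "\<dd> \<equiv> Gen Ld"

abbreviation rel_eq :: "'g gword \<Rightarrow> 'g gword \<Rightarrow> 'g gword \<times> 'g gword" (infix \<open>\<doteq>\<close> 50) where
  "u \<doteq> v \<equiv> (u, v)"

abbreviation pres_abc :: "(letter gword \<times> letter gword) set \<Rightarrow> letter gword set monoid" where
  "pres_abc R \<equiv> presented_group {La, Lb, Lc} R"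

abbreviation pres_abcd :: "(letter gword \<times> letter gword) set \<Rightarrow> letter gword set monoid" where
  "pres_abcd R \<equiv> presented_group {La, Lb, Lc, Ld} R"

definition M_p1 :: "nat \<Rightarrow> nat \<Rightarrow> nat \<Rightarrow> letter gword set monoid" where
  "M_p1 p n m = pres_abc
     {\<aa> ^ (p ^ n) \<doteq> 1, \<bb> ^ (p ^ m) \<doteq> 1, \<cc> ^ p \<doteq> 1,
      comm \<aa> \<bb> \<doteq> \<cc>, comm \<cc> \<aa> \<doteq> 1, comm \<cc> \<bb> \<doteq> 1}"

text \<open>The arguments of the types \<open>L\<close> are \<open>n\<close>, \<open>m\<close> and, where there is a third one, the
  parameter \<open>s\<close>, \<open>t\<close> or \<open>\<nu>\<close>.\<close>

datatype label =
    K1 | K2 | K3 | K4 | K5 | K6 | K7 | K8 | K9 | K10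
  | L1 nat nat nat | L2 nat nat nat | L3 nat nat | L4 nat nat nat | L5 nat nat nat
  | L6 nat nat | L7 nat nat | L8 nat nat | L9 nat nat

primrec listed_group :: "nat \<Rightarrow> label \<Rightarrow> letter gword set monoid" where
  "listed_group p K1 = pres_abc
     {\<aa> ^ 8 \<doteq> 1, \<bb> ^ 4 \<doteq> 1, \<cc> ^ 4 \<doteq> 1,
      comm \<aa> \<bb> \<doteq> \<cc>, comm \<cc> \<aa> \<doteq> 1, comm \<cc> \<bb> \<doteq> \<cc> ^ 2 * \<aa> ^ 4}"
| "listed_group p K2 = pres_abc
     {\<aa> ^ 8 \<doteq> 1, \<bb> ^ 8 \<doteq> 1, \<cc> ^ 2 \<doteq> \<bb> ^ 4,
      comm \<aa> \<bb> \<doteq> \<cc>, comm \<cc> \<aa> \<doteq> 1, comm \<cc> \<bb> \<doteq> \<aa> ^ 4 * \<bb> ^ 4}"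
| "listed_group p K3 = pres_abcd
     {\<aa> ^ 8 \<doteq> 1, \<bb> ^ 4 \<doteq> 1, \<dd> ^ 2 \<doteq> 1, \<cc> ^ 2 \<doteq> \<aa> ^ 4,
      comm \<aa> \<bb> \<doteq> \<cc>, comm \<cc> \<aa> \<doteq> 1, comm \<cc> \<bb> \<doteq> \<dd>, comm \<dd> \<aa> \<doteq> 1, comm \<dd> \<bb> \<doteq> 1}"
| "listed_group p K4 = pres_abc
     {\<aa> ^ 8 \<doteq> 1, \<bb> ^ 8 \<doteq> 1, \<cc> ^ 2 \<doteq> \<aa> ^ 4,
      comm \<aa> \<bb> \<doteq> \<cc>, comm \<cc> \<aa> \<doteq> 1, comm \<cc> \<bb> \<doteq> \<bb> ^ 4}"
| "listed_group p K5 = pres_abcd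
     {\<aa> ^ 8 \<doteq> 1, \<dd> ^ 2 \<doteq> 1, \<bb> ^ 4 \<doteq> \<cc> ^ 2, \<cc> ^ 2 \<doteq> \<aa> ^ 4,
      comm \<aa> \<bb> \<doteq> \<cc>, comm \<cc> \<aa> \<doteq> 1, comm \<cc> \<bb> \<doteq> \<dd>, comm \<dd> \<aa> \<doteq> 1, comm \<dd> \<bb> \<doteq> 1}"
| "listed_group p K6 = pres_abc
     {\<aa> ^ 8 \<doteq> 1, \<bb> ^ 8 \<doteq> 1, \<cc> ^ 2 \<doteq> \<aa> ^ 4,
      comm \<aa> \<bb> \<doteq> \<cc>, comm \<cc> \<aa> \<doteq> 1, comm \<cc> \<bb> \<doteq> \<aa> ^ 4 * \<bb> ^ 4}"
| "listed_group p K7 = pres_abc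
     {\<aa> ^ 8 \<doteq> 1, \<bb> ^ 4 \<doteq> 1, \<cc> ^ 4 \<doteq> 1,
      comm \<aa> \<bb> \<doteq> \<cc>, comm \<cc> \<aa> \<doteq> 1, comm \<cc> \<bb> \<doteq> \<aa> ^ 4}"
| "listed_group p K8 = pres_abc
     {\<aa> ^ 8 \<doteq> 1, \<bb> ^ 8 \<doteq> 1, \<cc> ^ 2 \<doteq> \<bb> ^ 4,
      comm \<aa> \<bb> \<doteq> \<cc>, comm \<cc> \<aa> \<doteq> 1, comm \<cc> \<bb> \<doteq> \<aa> ^ 4}"
| "listed_group p K9 = pres_abcd
     {\<aa> ^ 4 \<doteq> 1, \<bb> ^ 4 \<doteq> 1, \<cc> ^ 4 \<doteq> 1, \<dd> ^ 2 \<doteq> 1,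
      comm \<aa> \<bb> \<doteq> \<cc>, comm \<cc> \<bb> \<doteq> \<dd>, comm \<cc> \<aa> \<doteq> 1, comm \<dd> \<aa> \<doteq> 1, comm \<dd> \<bb> \<doteq> 1}"
| "listed_group p K10 = pres_abc
     {\<aa> ^ 4 \<doteq> 1, \<bb> ^ 8 \<doteq> 1, \<cc> ^ 4 \<doteq> 1,
      comm \<aa> \<bb> \<doteq> \<cc>, comm \<cc> \<aa> \<doteq> 1, comm \<cc> \<bb> \<doteq> \<bb> ^ 4}"
| "listed_group p (L1 n m s) = pres_abc
     {\<aa> ^ (p ^ (n + 1)) \<doteq> 1, \<bb> ^ (p ^ (m + 1)) \<doteq> 1,
      comm \<aa> \<bb> \<doteq> \<cc>, \<cc> ^ p \<doteq> \<aa> ^ (p ^ n) * \<bb> ^ (s * p ^ m),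
      comm \<cc> \<aa> \<doteq> 1, comm \<bb> \<cc> \<doteq> \<bb> ^ (p ^ m)}"
| "listed_group p (L2 n m t) = pres_abc
     {\<aa> ^ (p ^ (n + 1)) \<doteq> 1, \<bb> ^ (p ^ m) \<doteq> 1, \<cc> ^ (p ^ 2) \<doteq> 1,
      comm \<aa> \<bb> \<doteq> \<cc>, comm \<cc> \<aa> \<doteq> 1,
      comm \<cc> \<bb> \<doteq> \<cc> ^ (t * p) * inverse (\<aa> ^ (t * p ^ n))}"
| "listed_group p (L3 n m) = pres_abcd
     {\<aa> ^ (p ^ (n + 1)) \<doteq> 1, \<bb> ^ (p ^ m) \<doteq> 1, \<dd> ^ p \<doteq> 1, \<cc> ^ p \<doteq> \<aa> ^ (p ^ n),
      comm \<aa> \<bb> \<doteq> \<cc>, comm \<cc> \<aa> \<doteq> 1, comm \<cc> \<bb> \<doteq> \<dd>, comm \<dd> \<aa> \<doteq> 1, comm \<dd> \<bb> \<doteq> 1}"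
| "listed_group p (L4 n m \<nu>) = pres_abc
     {\<aa> ^ (p ^ (n + 1)) \<doteq> 1, \<bb> ^ (p ^ (m + 1)) \<doteq> 1,
      comm \<aa> \<bb> \<doteq> \<cc>, \<cc> ^ p \<doteq> \<bb> ^ (p ^ m),
      comm \<cc> \<aa> \<doteq> 1, comm \<bb> \<cc> \<doteq> \<aa> ^ (\<nu> * p ^ n)}"
| "listed_group p (L5 n m \<nu>) = pres_abc
     {\<aa> ^ (p ^ (n + 1)) \<doteq> 1, \<bb> ^ (p ^ m) \<doteq> 1, \<cc> ^ (p ^ 2) \<doteq> 1,
      comm \<aa> \<bb> \<doteq> \<cc>, comm \<cc> \<aa> \<doteq> 1, comm \<bb> \<cc> \<doteq> \<aa> ^ (\<nu> * p ^ n)}"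
| "listed_group p (L6 n m) = pres_abc
     {\<aa> ^ (p ^ n) \<doteq> 1, \<bb> ^ (p ^ (m + 1)) \<doteq> 1, \<cc> ^ (p ^ 2) \<doteq> 1,
      comm \<aa> \<bb> \<doteq> \<cc>, comm \<cc> \<aa> \<doteq> 1,
      comm \<cc> \<bb> \<doteq> \<cc> ^ p * inverse (\<bb> ^ (p ^ m)), comm (\<bb> ^ (p ^ m)) \<aa> \<doteq> 1}"
| "listed_group p (L7 n m) = pres_abcd
     {\<aa> ^ (p ^ n) \<doteq> 1, \<bb> ^ (p ^ (m + 1)) \<doteq> 1, \<dd> ^ p \<doteq> 1, \<cc> ^ p \<doteq> \<bb> ^ (p ^ m),
      comm \<aa> \<bb> \<doteq> \<cc>, comm \<cc> \<aa> \<doteq> 1, comm \<cc> \<bb> \<doteq> \<dd>, comm \<dd> \<aa> \<doteq> 1, comm \<dd> \<bb> \<doteq> 1}"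
| "listed_group p (L8 n m) = pres_abc
     {\<aa> ^ (p ^ n) \<doteq> 1, \<bb> ^ (p ^ (m + 1)) \<doteq> 1, \<cc> ^ (p ^ 2) \<doteq> 1,
      comm \<aa> \<bb> \<doteq> \<cc>, comm \<cc> \<aa> \<doteq> 1, comm \<bb> \<cc> \<doteq> \<bb> ^ (p ^ m)}"
| "listed_group p (L9 n m) = pres_abcd
     {\<aa> ^ (p ^ n) \<doteq> 1, \<bb> ^ (p ^ m) \<doteq> 1, \<cc> ^ (p ^ 2) \<doteq> 1, \<dd> ^ p \<doteq> 1,
      comm \<aa> \<bb> \<doteq> \<cc>, comm \<cc> \<aa> \<doteq> 1, comm \<cc> \<bb> \<doteq> \<dd>, comm \<dd> \<aa> \<doteq> 1, comm \<dd> \<bb> \<doteq> 1}"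

definition K_labels :: "nat \<Rightarrow> label set" where
  "K_labels p = (if p = 2 then {K1, K2, K3, K4, K5, K6, K7, K8, K9, K10} else {})"

text \<open>\<open>\<nu>\<^sub>0\<close> is the fixed quadratic non-residue; it plays no role for \<open>p = 2\<close>.\<close>

definition nu_values :: "nat \<Rightarrow> nat \<Rightarrow> nat set" where
  "nu_values p \<nu>\<^sub>0 = (if p = 2 then {1} else {1, \<nu>\<^sub>0})"

definition L_labels :: "nat \<Rightarrow> nat \<Rightarrow> nat \<Rightarrow> nat \<Rightarrow> label set" where
  "L_labels p \<nu>\<^sub>0 n m =
     (if m \<le> n \<and> 2 \<le> m \<and> (p = 2 \<longrightarrow> 3 \<le> n)
      then L1 n m ` {0..<p} \<union> L2 n m ` {1..<p} \<union> {L3 n m}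
           \<union> L4 n m ` nu_values p \<nu>\<^sub>0 \<union> L5 n m ` nu_values p \<nu>\<^sub>0
           \<union> {L6 n m, L7 n m, L8 n m, L9 n m}
      else {})"

definition labels :: "nat \<Rightarrow> nat \<Rightarrow> nat \<Rightarrow> nat \<Rightarrow> label set" where
  "labels p \<nu>\<^sub>0 n m = K_labels p \<union> L_labels p \<nu>\<^sub>0 n m"

end

theory Submission
  imports Defs
begin

text \<open>The hypotheses force \<open>G'\<close> to be generated by \<open>c = [a, b]\<close>, of order \<open>p\<^sup>2\<close>, and \<open>G\<^sub>3\<close>, and
  \<open>N = \<Phi>(G')G\<^sub>3\<close> to be the central subgroup generated by \<open>c\<^sup>p\<close> and by a generator \<open>d\<close> of \<open>G\<^sub>3\<close>. The
  condition on the centralizer of \<open>G'\<close> allows one to choose \<open>a\<close> and \<open>b\<close> with \<open>[c, a] = 1\<close> and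
  \<open>[c, b] = d\<close>. Then \<open>G\<close> is determined by the exponents in \<open>a\<^bsup>p^n\<^esup> = c\<^bsup>p\<alpha>\<^esup> d\<^sup>\<beta>\<close> and
  \<open>b\<^bsup>p^m\<^esup> = c\<^bsup>p\<gamma>\<^esup> d\<^sup>\<delta>\<close>, and the commutator of \<open>a\<close> and \<open>b\<^bsup>p^m\<^esup>\<close> shows that \<open>m \<ge> 2\<close>. So \<open>G\<close> is a quotient of
  a fixed torsion-free nilpotent group of normal forms \<open>b\<^sup>j a\<^sup>i c\<^sup>k d\<^sup>l\<close> by an explicit normal subgroup.
  Two such quotients are isomorphic iff their parameter matrices over \<open>F\<^sub>p\<close> are related by a change of
  generators; the listed groups form a system of representatives of the orbits.\<close>

section \<open>A polycyclic group\<close>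

text \<open>Normal forms in one infinite group multiply by a polynomial law, so that consistency of
  all the presentations is the single statement that an explicit set of exponents is a normal
  subgroup. A listed group is then compared with its quotient by a map from \<open>Gam\<close> onto
  it and, by von Dyck's theorem, a map back. The map from \<open>Gam\<close> is the delicate one. In
  most presentations d is only a name for [c, b]; its centrality and its order have to be deduced
  from the way in which the relations express d by a^(p^n), b^(p^m) and c^p. The case p = n = m = 2
  is exceptional because p^2 divides p^m (p^m - 1) / 2 for all m at least 2 unless p^m = 4. In the
  converse direction N is not central by hypothesis. The subgroup G_3 of order p is central in a
  p-group, c^p is central since [c^p, g] = [c, g]^p = 1, and the Frattini subgroup keeps c^p outside
  G_3, so that both together generate N. Then g -> [c, g] is a homomorphism into G_3, and a is taken
  from its kernel.\<close>

definition tri :: "int \<Rightarrow> int" where "tri j = j * (j - 1) div 2"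

lemma two_tri: "2 * tri j = j * (j - 1)"
  by (simp add: tri_def)

lemma tri_add: "tri (x + y) = tri x + tri y + x * y"
proof -
  have "2 * tri (x + y) = 2 * (tri x + tri y + x * y)"
    by (simp add: two_tri distrib_left) (simp add: algebra_simps)
  then show ?thesis by simp
qed

lemma tri_0 [simp]: "tri 0 = 0" and tri_1 [simp]: "tri 1 = 0"
  by (simp_all add: tri_def)

lemma tri_minus: "tri (- x) = x * x - tri x"
  using tri_add[of x "-x"] by simp

lemma tri_mult: "tri (s * j) = j\<^sup>2 * tri s + s * tri j"
proof -
  have "2 * tri (s * j) = j\<^sup>2 * (2 * tri s) + s * (2 * tri j)"
    unfolding two_tri by (simp add: algebra_simps power2_eq_square)
  then show ?thesis by simp
qed

text \<open>The tuple \<open>(j, i, k, l)\<close> stands for the normal form \<open>b\<^sup>j a\<^sup>i c\<^sup>k d\<^sup>l\<close> in the group with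
  \<open>[a, b] = c\<close>, \<open>[c, a] = 1\<close>, \<open>[c, b] = d\<close> and \<open>d\<close> central, that is, in the semidirect product of
  \<open>\<int>\<^sup>3\<close> (generated by \<open>a\<close>, \<open>c\<close>, \<open>d\<close>) with \<open>\<int>\<close>. The binomial coefficient \<open>tri\<close> comes from
  \<open>b\<^sup>-\<^sup>j a b\<^sup>j = a c\<^sup>j d\<^bsup>j(j-1)/2\<^esup>\<close>.\<close>

definition Gam :: "(int \<times> int \<times> int \<times> int) monoid" where
  "Gam = \<lparr>carrier = UNIV,
     monoid.mult = (\<lambda>(j, i, k, l) (j', i', k', l').
        (j + j', i + i', k + i * j' + k', l + k * j' + i * tri j' + l')),
     one = (0, 0, 0, 0)\<rparr>"

lemma carrier_Gam [simp]: "carrier Gam = UNIV"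
  and one_Gam [simp]: "\<one>\<^bsub>Gam\<^esub> = (0, 0, 0, 0)"
  and mult_Gam [simp]: "(j, i, k, l) \<otimes>\<^bsub>Gam\<^esub> (j', i', k', l')
    = (j + j', i + i', k + i * j' + k', l + k * j' + i * tri j' + l')"
  by (simp_all add: Gam_def)

lemma group_Gam: "group Gam"
proof (rule groupI)
  fix x y z
  show "x \<otimes>\<^bsub>Gam\<^esub> y \<otimes>\<^bsub>Gam\<^esub> z = x \<otimes>\<^bsub>Gam\<^esub> (y \<otimes>\<^bsub>Gam\<^esub> z)"
    by (cases x; cases y; cases z) (simp add: tri_add algebra_simps)
next
  fix x :: "int \<times> int \<times> int \<times> int"
  obtain j i k l where x: "x = (j, i, k, l)"
    by (cases x)
  \<comment> \<open>The left inverse is solved from the multiplication law coordinate by coordinate: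
    the summand i j cancels the power of c that arises when a^(-i) passes b^j.\<close>
  have "(- j, - i, - k + i * j, - l + k * j - i * j\<^sup>2 + i * tri j) \<otimes>\<^bsub>Gam\<^esub> x = \<one>\<^bsub>Gam\<^esub>"
    by (simp add: x power2_eq_square algebra_simps)
  then show "\<exists>y\<in>carrier Gam. y \<otimes>\<^bsub>Gam\<^esub> x = \<one>\<^bsub>Gam\<^esub>"
    by auto
qed auto

lemma inv_Gam: "inv\<^bsub>Gam\<^esub> (j, i, k, l)
  = (- j, - i, - k + i * j, - l + k * j - i * j\<^sup>2 + i * tri j)"
  by (rule group.inv_equality[OF group_Gam]) (simp_all add: power2_eq_square algebra_simps)

text \<open>Conjugation by y respects powers. The hypothesis has the form x y = y z, without
  inverses, because all commutation rules below are kept in this form.\<close>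

lemma (in group) conj_int_pow:
  assumes "x \<otimes> y = y \<otimes> z" "x \<in> carrier G" "y \<in> carrier G" "z \<in> carrier G"
  shows "x [^] (i::int) \<otimes> y = y \<otimes> z [^] i"
proof -
  have nat: "x [^] n \<otimes> y = y \<otimes> z [^] n" for n :: nat
  proof (induction n)
    case (Suc n)
    have "x [^] Suc n \<otimes> y = x [^] n \<otimes> (y \<otimes> z)"
      using assms by (simp add: m_assoc)
    also have "\<dots> = y \<otimes> z [^] Suc n"
      using assms Suc by (simp add: m_assoc[symmetric])
    finally show ?case .
  qed (use assms in simp)
  show ?thesis
  proof (cases i rule: int_cases2)
    case (nonneg n)
    then show ?thesis using nat by (simp add: int_pow_int)
  next
    case (nonpos n)
    have "inv (x [^] n) \<otimes> y = y \<otimes> inv (z [^] n)"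
    proof -
      have "inv (x [^] n) \<otimes> y = inv (x [^] n) \<otimes> (y \<otimes> z [^] n) \<otimes> inv (z [^] n)"
        using assms by (simp add: m_assoc)
      also have "\<dots> = y \<otimes> inv (z [^] n)"
        using assms by (simp add: nat[symmetric] m_assoc[symmetric])
      finally show ?thesis .
    qed
    then show ?thesis using assms nonpos by (simp add: int_pow_neg_int)
  qed
qed

lemma (in group) commute_int_pow:
  assumes "x \<otimes> y = y \<otimes> x" "x \<in> carrier G" "y \<in> carrier G"
  shows "x [^] (i::int) \<otimes> y [^] (j::int) = y [^] j \<otimes> x [^] i"
proof -
  have "x [^] i \<otimes> y = y \<otimes> x [^] i"
    using assms by (intro conj_int_pow)
  then show ?thesis
    using assms conj_int_pow[of y "x [^] i" y j] by simp
qed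

text \<open>Quadruples with the defining relations of \<open>Gam\<close> correspond to homomorphisms
  from \<open>Gam\<close>: \<open>ev\<close> leads from the former to the latter,
  \<open>hom_Gam_quad\<close> back. A commutator relation [x, y] = z is written x y = y (x z), ready
  for rewriting.\<close>

locale gam_quad = group G for G (structure) +
  fixes a b c d
  assumes a_closed [simp, intro]: "a \<in> carrier G" and b_closed [simp, intro]: "b \<in> carrier G"
    and c_closed [simp, intro]: "c \<in> carrier G" and d_closed [simp, intro]: "d \<in> carrier G"
    and ab: "a \<otimes> b = b \<otimes> (a \<otimes> c)" and cb: "c \<otimes> b = b \<otimes> (c \<otimes> d)"
    and ca: "c \<otimes> a = a \<otimes> c" and da: "d \<otimes> a = a \<otimes> d" and db: "d \<otimes> b = b \<otimes> d"
    and dc: "d \<otimes> c = c \<otimes> d"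
begin

fun ev :: "int \<times> int \<times> int \<times> int \<Rightarrow> 'a" where
  "ev (j, i, k, l) = b [^] j \<otimes> a [^] i \<otimes> c [^] k \<otimes> d [^] l"

lemma ev_closed [simp]: "ev x \<in> carrier G"
  by (cases x) simp

lemma ev_v: "ev (j, i, k, l) \<otimes> (a [^] i' \<otimes> c [^] k' \<otimes> d [^] l') = ev (j, i + i', k + k', l + l')"
proof -
  note 1 = commute_int_pow[OF ca c_closed a_closed, of k i']
    and 2 = commute_int_pow[OF da d_closed a_closed, of l i']
    and 3 = commute_int_pow[OF dc d_closed c_closed, of l k']
  have "c [^] k \<otimes> (d [^] l \<otimes> (a [^] i' \<otimes> (c [^] k' \<otimes> d [^] l')))
      = c [^] k \<otimes> ((d [^] l \<otimes> a [^] i') \<otimes> (c [^] k' \<otimes> d [^] l'))"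
    by (simp add: m_assoc)
  also have "\<dots> = (c [^] k \<otimes> a [^] i') \<otimes> ((d [^] l \<otimes> c [^] k') \<otimes> d [^] l')"
    unfolding 2 by (simp add: m_assoc)
  also have "\<dots> = a [^] i' \<otimes> (c [^] k \<otimes> (c [^] k' \<otimes> (d [^] l \<otimes> d [^] l')))"
    unfolding 1 3 by (simp add: m_assoc)
  finally have "c [^] k \<otimes> (d [^] l \<otimes> (a [^] i' \<otimes> (c [^] k' \<otimes> d [^] l')))
      = a [^] i' \<otimes> (c [^] k \<otimes> (c [^] k' \<otimes> (d [^] l \<otimes> d [^] l')))" .
  then show ?thesis
    by (simp add: int_pow_mult m_assoc)
qed

text \<open>The factor b moves to the left past d, c and a: c^k picks up d^k on the way, and a^i
  picks up c^i.\<close>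

lemma ev_b: "ev (j, i, k, l) \<otimes> b = ev (j + 1, i, k + i, l + k)"
proof -
  have 1: "d [^] l \<otimes> b = b \<otimes> d [^] l"
    using commute_int_pow[OF db, of l 1] by simp
  have 2: "c [^] k \<otimes> b = b \<otimes> (c [^] k \<otimes> d [^] k)"
    using conj_int_pow[OF cb, of k] int_pow_mult_distrib[OF dc[symmetric], of k] by simp
  have 3: "a [^] i \<otimes> b = b \<otimes> (a [^] i \<otimes> c [^] i)"
    using conj_int_pow[OF ab, of i] int_pow_mult_distrib[OF ca[symmetric], of i] by simp
  have "ev (j, i, k, l) \<otimes> b = b [^] j \<otimes> (a [^] i \<otimes> (c [^] k \<otimes> (d [^] l \<otimes> b)))"
    by (simp add: m_assoc)
  also have "\<dots> = b [^] j \<otimes> (a [^] i \<otimes> ((c [^] k \<otimes> b) \<otimes> d [^] l))"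
    unfolding 1 by (simp add: m_assoc)
  also have "\<dots> = b [^] j \<otimes> ((a [^] i \<otimes> b) \<otimes> (c [^] k \<otimes> d [^] k \<otimes> d [^] l))"
    unfolding 2 by (simp add: m_assoc)
  also have "\<dots> = b [^] j \<otimes> b \<otimes> (a [^] i \<otimes> (c [^] i \<otimes> c [^] k) \<otimes> (d [^] k \<otimes> d [^] l))"
    unfolding 3 by (simp add: m_assoc)
  also have "\<dots> = ev (j + 1, i, i + k, k + l)"
    by (simp add: int_pow_mult m_assoc)
  finally show ?thesis
    by (simp add: add.commute)
qed

lemma ev_bpow: "ev x \<otimes> b [^] (j::int) = ev (x \<otimes>\<^bsub>Gam\<^esub> (j, 0, 0, 0))"
proof -
  have nat: "ev x \<otimes> b [^] n = ev (x \<otimes>\<^bsub>Gam\<^esub> (int n, 0, 0, 0))" for n :: nat and x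
  proof (induction n)
    case 0
    show ?case by (cases x) simp
  next
    case (Suc n)
    have "ev x \<otimes> b [^] Suc n = ev (x \<otimes>\<^bsub>Gam\<^esub> (int n, 0, 0, 0)) \<otimes> b"
      using Suc by (simp add: m_assoc[symmetric])
    also have "\<dots> = ev (x \<otimes>\<^bsub>Gam\<^esub> (int (Suc n), 0, 0, 0))"
      by (cases x) (simp add: ev_b tri_add algebra_simps del: ev.simps)
    finally show ?case .
  qed
  show ?thesis
  proof (cases j rule: int_cases2)
    case (nonneg n)
    then show ?thesis using nat by (simp add: int_pow_int)
  next
    case (nonpos n)
    \<comment> \<open>Negative powers: the claim for b^n is applied to the product with b^(-n) and
      solved for it.\<close>
    let ?y = "x \<otimes>\<^bsub>Gam\<^esub> (j, 0, 0, 0)"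
    have "?y \<otimes>\<^bsub>Gam\<^esub> (int n, 0, 0, 0) = x"
      using nonpos by (cases x) (simp add: tri_minus algebra_simps)
    then have "ev ?y \<otimes> b [^] n = ev x"
      using nat[of ?y n] by simp
    then show ?thesis
      using nonpos by (simp add: int_pow_neg_int inv_solve_right')
  qed
qed

text \<open>The right factor splits into b^j, treated by \<open>ev_bpow\<close>, and an element of
  the abelian subgroup generated by a, c and d, treated by \<open>ev_v\<close>.\<close>

lemma ev_mult: "ev (x \<otimes>\<^bsub>Gam\<^esub> y) = ev x \<otimes> ev y"
proof -
  obtain j i k l where y: "y = (j, i, k, l)" by (cases y)
  have "ev x \<otimes> ev y = (ev x \<otimes> b [^] j) \<otimes> (a [^] i \<otimes> c [^] k \<otimes> d [^] l)"
    by (simp add: y m_assoc)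
  also have "\<dots> = ev (x \<otimes>\<^bsub>Gam\<^esub> (j, 0, 0, 0)) \<otimes> (a [^] i \<otimes> c [^] k \<otimes> d [^] l)"
    by (simp only: ev_bpow)
  also have "\<dots> = ev (x \<otimes>\<^bsub>Gam\<^esub> y)"
    by (cases x) (simp add: y ev_v del: ev.simps)
  finally show ?thesis by simp
qed

lemma ev_hom: "ev \<in> hom Gam G"
  by (rule homI) (simp_all add: ev_mult)

lemma ev_gens [simp]: "ev (0, 1, 0, 0) = a" "ev (1, 0, 0, 0) = b" "ev (0, 0, 1, 0) = c"
   "ev (0, 0, 0, 1) = d"
  by simp_all

end

text \<open>The elements without b form an abelian subgroup, where powers are taken
  coordinatewise.\<close>

lemma Gam_pow_special:
  "(j, 0, 0, 0) [^]\<^bsub>Gam\<^esub> (N::int) = (N * j, 0, 0, 0)"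
  "(0, i, k, l) [^]\<^bsub>Gam\<^esub> N = (0, N * i, N * k, N * l)"
proof -
  interpret group Gam by (rule group_Gam)
  have nat: "(j, 0, 0, 0) [^]\<^bsub>Gam\<^esub> (n::nat) = (int n * j, 0, 0, 0)"
    "(0, i, k, l) [^]\<^bsub>Gam\<^esub> n = (0, int n * i, int n * k, int n * l)" for n
    by (induction n) (simp_all add: algebra_simps)
  have "(j, 0, 0, 0) [^]\<^bsub>Gam\<^esub> N = (N * j, 0, 0, 0) \<and>
    (0, i, k, l) [^]\<^bsub>Gam\<^esub> N = (0, N * i, N * k, N * l)"
    by (cases N rule: int_cases2) (simp_all add: int_pow_int int_pow_neg_int nat inv_Gam)
  then show "(j, 0, 0, 0) [^]\<^bsub>Gam\<^esub> N = (N * j, 0, 0, 0)"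
    "(0, i, k, l) [^]\<^bsub>Gam\<^esub> N = (0, N * i, N * k, N * l)" by auto
qed

lemma hom_Gam_unfold:
  assumes "h \<in> hom Gam H" "group H"
  shows "h (j, i, k, l) = h (1, 0, 0, 0) [^]\<^bsub>H\<^esub> j \<otimes>\<^bsub>H\<^esub> h (0, 1, 0, 0) [^]\<^bsub>H\<^esub> i
     \<otimes>\<^bsub>H\<^esub> h (0, 0, 1, 0) [^]\<^bsub>H\<^esub> k \<otimes>\<^bsub>H\<^esub> h (0, 0, 0, 1) [^]\<^bsub>H\<^esub> l"
proof -
  interpret group_hom Gam H h
    by (intro group_hom.intro group_hom_axioms.intro group_Gam assms)
  have "h (j, i, k, l) = h ((j, 0, 0, 0) \<otimes>\<^bsub>Gam\<^esub> (0, i, 0, 0) \<otimes>\<^bsub>Gam\<^esub> (0, 0, k, 0) \<otimes>\<^bsub>Gam\<^esub> (0, 0, 0, l))"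
    by simp
  also have "\<dots> = h ((1, 0, 0, 0) [^]\<^bsub>Gam\<^esub> j \<otimes>\<^bsub>Gam\<^esub> (0, 1, 0, 0) [^]\<^bsub>Gam\<^esub> i
      \<otimes>\<^bsub>Gam\<^esub> (0, 0, 1, 0) [^]\<^bsub>Gam\<^esub> k \<otimes>\<^bsub>Gam\<^esub> (0, 0, 0, 1) [^]\<^bsub>Gam\<^esub> l)"
    by (simp add: Gam_pow_special)
  finally show ?thesis
    by (simp add: hom_int_pow del: mult_Gam)
qed

lemma hom_Gam_quad:
  assumes "h \<in> hom Gam H" "group H"
  shows "gam_quad H (h (0, 1, 0, 0)) (h (1, 0, 0, 0)) (h (0, 0, 1, 0)) (h (0, 0, 0, 1))"
proof -
  interpret group_hom Gam H h
    by (intro group_hom.intro group_hom_axioms.intro group_Gam assms)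
  show ?thesis
    by (intro gam_quad.intro gam_quad_axioms.intro assms)
      (simp_all only: hom_mult[symmetric] UNIV_I carrier_Gam mult_Gam hom_closed, simp_all)
qed

section \<open>Quotients of the polycyclic group\<close>

lemma power_choose_3:
  fixes N :: nat
  shows "6 * int (N choose 3) = int N * (int N - 1) * (int N - 2)"
proof (induction N)
  case (Suc N)
  have "2 * int (N choose 2) = int N * (int N - 1)"
    by (induction N) (simp_all add: numeral_2_eq_2 algebra_simps)
  moreover have "int (Suc N choose 3) = int (N choose 2) + int (N choose 3)"
    by (simp add: numeral_3_eq_3 numeral_2_eq_2)
  ultimately have "6 * int (Suc N choose 3) = 3 * (int N * (int N - 1)) + int N * (int N - 1) * (int N - 2)"
    using Suc by simp
  then show ?case
    by (simp add: algebra_simps)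
qed simp

lemma prime_sq_dvd_power: "2 \<le> m \<Longrightarrow> (int p)\<^sup>2 dvd int p ^ m"
  by (rule le_imp_power_dvd)

text \<open>Twice the number is p^m (p^m - 1). Division by 2 costs a factor p only for p = 2, so
  that p^2 is lost for p^m = 4 alone, where the value is 6. This exception separates the types (K)
  from the types (L).\<close>

lemma prime_dvd_tri_power:
  assumes "Factorial_Ring.prime p" "2 \<le> m"
  shows "int p dvd tri (int p ^ m)"
    and "\<not> (p = 2 \<and> m = 2) \<Longrightarrow> (int p)\<^sup>2 dvd tri (int p ^ m)"
proof -
  have *: "2 * tri (int p ^ m) = int p ^ m * (int p ^ m - 1)"
    by (rule two_tri)
  have "(int p)\<^sup>2 dvd tri (int p ^ m)" if "p \<noteq> 2"
  proof -
    have "coprime ((int p)\<^sup>2) 2"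
      using assms that by (simp add: prime_odd_nat prime_gt_1_nat prime_ge_2_nat order.not_eq_order_implies_strict)
    moreover have "(int p)\<^sup>2 dvd 2 * tri (int p ^ m)"
      unfolding * using prime_sq_dvd_power[OF assms(2)] by (rule dvd_mult2)
    ultimately show ?thesis
      using coprime_dvd_mult_right_iff by blast
  qed
  moreover have "(int p)\<^sup>2 dvd tri (int p ^ m)" if "p = 2" "m \<noteq> 2"
  proof -
    have "(2::int) ^ 3 dvd 2 ^ m"
      using assms that by (intro le_imp_power_dvd) simp
    then have "(2::int) ^ 3 dvd 2 * tri (int p ^ m)"
      unfolding * using that by (simp add: dvd_mult2)
    moreover have "8 dvd 2 * x \<Longrightarrow> 4 dvd x" for x :: int
      by presburger
    ultimately have "4 dvd tri (2 ^ m)"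
      using that by simp
    then show ?thesis
      using that by simp
  qed
  ultimately show 2: "\<not> (p = 2 \<and> m = 2) \<Longrightarrow> (int p)\<^sup>2 dvd tri (int p ^ m)"
    by blast
  show "int p dvd tri (int p ^ m)"
  proof (cases "p = 2 \<and> m = 2")
    case True
    then show ?thesis by (simp add: tri_def)
  next
    case False
    then show ?thesis using 2 by (metis dvd_mult_left power2_eq_square)
  qed
qed

text \<open>Six times the coefficient is N (N - 1) (N - 2) with p^2 dividing N. The square makes up
  for the factor 3 of 6 if p = 3; for p = 2 the factor N - 2 is even as well.\<close>

lemma prime_dvd_choose_3:
  assumes p: "Factorial_Ring.prime p" and "2 \<le> m"
  shows "int p dvd int (p ^ m choose 3)"
proof -
  let ?C = "int (p ^ m choose 3)"
  let ?N = "int p ^ m"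
  have *: "6 * ?C = ?N * (?N - 1) * (?N - 2)"
    using power_choose_3[of "p ^ m"] by simp
  have N: "(int p)\<^sup>2 dvd ?N"
    using assms by (intro prime_sq_dvd_power)
  consider "p = 2" | "p = 3" | "p \<noteq> 2" "p \<noteq> 3" by blast
  then show ?thesis
  proof cases
    case 1
    then have "(4::int) dvd ?N"
      using N by simp
    moreover from this have "(2::int) dvd ?N - 2" by presburger
    ultimately have "(4 * 2 :: int) dvd (?N * (?N - 1)) * (?N - 2)"
      by (intro mult_dvd_mono) simp_all
    then have "8 dvd 6 * ?C" using * by simp
    then have "2 dvd ?C" by presburger
    then show ?thesis using 1 by simp
  next
    case 2
    then have "9 dvd 6 * ?C"
      using N * by simp
    then have "3 dvd ?C" by presburger
    then show ?thesis using 2 by simp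
  next
    case 3
    have "\<not> int p dvd 6"
    proof
      assume "int p dvd 6"
      then have "p dvd 2 * 3" by presburger
      then have "p dvd 2 \<or> p dvd 3" using p prime_dvd_multD by blast
      then show False using 3 p primes_dvd_imp_eq[of p 2] primes_dvd_imp_eq[of p 3] by auto
    qed
    moreover have "int p dvd 6 * ?C"
      unfolding * using assms by (intro dvd_mult2) (simp add: dvd_power)
    moreover have "Factorial_Ring.prime (int p)"
      using p by simp
    ultimately show ?thesis
      using prime_dvd_multD[of "int p" 6 ?C] by blast
  qed
qed

text \<open>Multiplying by the N factors one after the other adds i j s to the exponent of c and k j
  s + i \<open>tri\<close> (j s) to that of d, for each s < N. As \<open>tri\<close> (j s) is j^2
  \<open>tri\<close> s + s \<open>tri\<close> j by \<open>tri_mult\<close>, the sums are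
  \<open>tri\<close> N and N choose 3.\<close>

lemma Gam_nat_pow:
  "(j, i, k, l) [^]\<^bsub>Gam\<^esub> N = (int N * j, int N * i, int N * k + i * j * tri (int N),
     int N * l + k * j * tri (int N) + i * (j\<^sup>2 * int (N choose 3) + tri j * tri (int N)))"
proof (induction N)
  case (Suc N)
  have T: "int (N choose 2) = tri (int N)"
    by (induction N) (simp_all add: numeral_2_eq_2 add.commute[of 1] tri_add)
  have 3: "int (Suc N choose 3) = tri (int N) + int (N choose 3)"
    by (simp add: numeral_3_eq_3 T[symmetric] numeral_2_eq_2)
  have 2: "tri (1 + int N) = tri (int N) + int N"
    by (simp add: tri_add)
  have 4: "tri (j * int N) = j\<^sup>2 * tri (int N) + int N * tri j"
    using tri_mult[of "int N" j] by (simp add: mult.commute)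
  have "(j, i, k, l) [^]\<^bsub>Gam\<^esub> Suc N = (j, i, k, l) \<otimes>\<^bsub>Gam\<^esub> (j, i, k, l) [^]\<^bsub>Gam\<^esub> N"
    by (rule monoid.nat_pow_Suc2[OF group.is_monoid[OF group_Gam]]) simp
  then show ?case
    unfolding Suc by (simp add: 2 3 algebra_simps) (simp add: 4 algebra_simps)
qed simp

lemma Gam_int_pow_fst:
  "\<exists>k' l'. (j, i, k, l) [^]\<^bsub>Gam\<^esub> (N::int) = (N * j, N * i, k', l')"
proof (cases N rule: int_cases2)
  case (nonneg n)
  then show ?thesis by (simp add: int_pow_int Gam_nat_pow)
next
  case (nonpos n)
  then show ?thesis
    by (simp add: group.int_pow_neg_int[OF group_Gam] Gam_nat_pow inv_Gam)
qed

text \<open>The normal closure of the relators \<open>d\<^sup>p\<close>, \<open>c\<^bsup>p^2\<^esup>\<close>, \<open>a\<^bsup>p^n\<^esup> = c\<^bsup>p\<alpha>\<^esup> d\<^sup>\<beta>\<close> and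
  \<open>b\<^bsup>p^m\<^esup> = c\<^bsup>p\<gamma>\<^esup> d\<^sup>\<delta>\<close>.\<close>

definition Lam :: "nat \<Rightarrow> nat \<Rightarrow> nat \<Rightarrow> int \<times> int \<times> int \<times> int \<Rightarrow> (int \<times> int \<times> int \<times> int) set" where
  "Lam p n m = (\<lambda>(\<alpha>, \<beta>, \<gamma>, \<delta>). {(j, i, k, l). \<exists>t r. j = int p ^ m * t \<and> i = int p ^ n * r
     \<and> (int p)\<^sup>2 dvd k + int p * (t * \<gamma> + r * \<alpha>) \<and> int p dvd l + t * \<delta> + r * \<beta>})"

lemma Lam_iff: "(j, i, k, l) \<in> Lam p n m (\<alpha>, \<beta>, \<gamma>, \<delta>) \<longleftrightarrow> (\<exists>t r. j = int p ^ m * t \<and> i = int p ^ n * r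
     \<and> (int p)\<^sup>2 dvd k + int p * (t * \<gamma> + r * \<alpha>) \<and> int p dvd l + t * \<delta> + r * \<beta>)"
  by (simp add: Lam_def)

lemma Lam_central_iff:
  assumes "p \<noteq> 0"
  shows "(0, 0, k, l) \<in> Lam p n m q \<longleftrightarrow> (int p)\<^sup>2 dvd k \<and> int p dvd l"
  using assms by (cases q) (auto simp: Lam_iff)

text \<open>The effect on the parameters of a change of generators
  \<open>a' = a\<^sup>i \<dots>\<close>, \<open>b' = a\<^bsup>e p^(n-m)\<^esup> b\<^sup>j \<dots>\<close>. The extra summand \<open>e\<close> reflects that for \<open>p = 2\<close> and
  \<open>n = m = 2\<close> the fourth power of \<open>a b\<close> picks up \<open>c\<^sup>6 = c\<^sup>2\<close>; it is what sets the types
  (K) apart from the types (L).\<close>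

definition param_equiv :: "nat \<Rightarrow> nat \<Rightarrow> int \<times> int \<times> int \<times> int \<Rightarrow> int \<times> int \<times> int \<times> int \<Rightarrow> bool" where
  "param_equiv p n = (\<lambda>(\<alpha>, \<beta>, \<gamma>, \<delta>) (\<alpha>', \<beta>', \<gamma>', \<delta>'). \<exists>i j e. \<not> int p dvd i \<and> \<not> int p dvd j
     \<and> int p dvd \<alpha> - \<alpha>' * j \<and> int p dvd \<beta> - \<beta>' * j\<^sup>2
     \<and> int p dvd j * \<gamma> + e * \<alpha> + (if p = 2 \<and> n = 2 then e else 0) - \<gamma>' * i * j
     \<and> int p dvd j * \<delta> + e * \<beta> - \<delta>' * i * j\<^sup>2)"

text \<open>Isomorphism with the quotient of \<open>Gam\<close> by \<open>Lam\<close>, phrased by a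
  homomorphism onto H with this kernel, so that images of the generators remain at hand for
  comparison.\<close>

definition model :: "('a, 'b) monoid_scheme \<Rightarrow> nat \<Rightarrow> nat \<Rightarrow> nat \<Rightarrow> int \<times> int \<times> int \<times> int \<Rightarrow> bool" where
  "model H p n m q \<longleftrightarrow> (\<exists>\<psi> \<in> hom Gam H. range \<psi> = carrier H \<and> (\<forall>x. \<psi> x = \<one>\<^bsub>H\<^esub> \<longleftrightarrow> x \<in> Lam p n m q))"

lemma model_iso:
  assumes "model G p n m q" "model H p n m q" "group G" "group H"
  shows "G \<cong> H"
proof -
  have *: "Gam Mod {x. x \<in> Lam p n m q} \<cong> H \<and> group (Gam Mod {x. x \<in> Lam p n m q})"
    if H: "model H p n m q" "group H" for H :: "('x, 'y) monoid_scheme"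
  proof -
    obtain \<psi> where \<psi>: "\<psi> \<in> hom Gam H" "range \<psi> = carrier H"
      "\<And>x. \<psi> x = \<one>\<^bsub>H\<^esub> \<longleftrightarrow> x \<in> Lam p n m q"
      using H unfolding model_def by blast
    interpret group_hom Gam H \<psi>
      by (intro group_hom.intro group_hom_axioms.intro group_Gam \<psi> H)
    show ?thesis
      using FactGroup_iso \<psi>(2,3) normal.factorgroup_is_group[OF normal_kernel] by (simp add: kernel_def)
  qed
  show ?thesis
    using *[OF assms(1,3)] *[OF assms(2,4)] by (meson group.iso_sym iso_trans)
qed

lemma model_cong:
  assumes "model G p n m q" "G \<cong> H" "group G" "group H"
  shows "model H p n m q"
proof -
  obtain \<psi> where \<psi>: "\<psi> \<in> hom Gam G" "range \<psi> = carrier G"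
    "\<And>x. \<psi> x = \<one>\<^bsub>G\<^esub> \<longleftrightarrow> x \<in> Lam p n m q"
    using assms unfolding model_def by blast
  obtain f where f: "f \<in> hom G H" "bij_betw f (carrier G) (carrier H)"
    using assms unfolding is_iso_def iso_def by blast
  have "f \<circ> \<psi> \<in> hom Gam H"
    using \<psi> f by (intro hom_compose)
  moreover have "range (f \<circ> \<psi>) = carrier H"
    using \<psi> f by (metis bij_betw_imp_surj_on image_comp)
  moreover have "f u = \<one>\<^bsub>H\<^esub> \<longleftrightarrow> u = \<one>\<^bsub>G\<^esub>" if "u \<in> carrier G" for u
    using that f assms by (metis bij_betw_imp_inj_on group.is_monoid hom_one inj_onD monoid.one_closed)
  then have "f (\<psi> x) = \<one>\<^bsub>H\<^esub> \<longleftrightarrow> x \<in> Lam p n m q" for x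
    using \<psi>(2) \<psi>(3)[of x] by blast
  ultimately show ?thesis
    unfolding model_def by (intro bexI[of _ "f \<circ> \<psi>"]) simp_all
qed

section \<open>Comparison of two systems of generators\<close>

lemma Gam_comm: "(j1, i1, k1, l1) \<otimes>\<^bsub>Gam\<^esub> (j2, i2, k2, l2) = (j2, i2, k2, l2) \<otimes>\<^bsub>Gam\<^esub>
   ((j1, i1, k1, l1) \<otimes>\<^bsub>Gam\<^esub> (0, 0, i1 * j2 - i2 * j1, k1 * j2 - k2 * j1 + i1 * tri j2 - i2 * tri j1))"
  by simp

lemma Gam_l_one: "(0, 0, 0, 0) \<otimes>\<^bsub>Gam\<^esub> x = x" and Gam_r_one: "x \<otimes>\<^bsub>Gam\<^esub> (0, 0, 0, 0) = x"
  by (cases x; simp)+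

text \<open>The new c and d are forced: they are the commutators of the new generators, which
  \<open>Gam_comm\<close> evaluates. The relation [c, a] = 1 holds for the new generators too and
  becomes the last conclusion, a restriction on j1.\<close>

lemma hom_Gam_change:
  assumes \<psi>: "\<psi> \<in> hom Gam H" and \<psi>': "\<psi>' \<in> hom Gam H" and H: "group H"
    and x: "\<psi>' (0, 1, 0, 0) = \<psi> (j1, i1, k1, l1)" and y: "\<psi>' (1, 0, 0, 0) = \<psi> (j2, i2, k2, l2)"
    and \<Delta>: "\<Delta> = i1 * j2 - i2 * j1" and \<eta>: "\<eta> = k1 * j2 - k2 * j1 + i1 * tri j2 - i2 * tri j1"
  shows "\<psi>' (0, 0, 1, 0) = \<psi> (0, 0, \<Delta>, \<eta>)" "\<psi>' (0, 0, 0, 1) = \<psi> (0, 0, 0, \<Delta> * j2)"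
    "\<psi> (0, 0, 0, \<Delta> * j1) = \<one>\<^bsub>H\<^esub>"
proof -
  interpret group_hom Gam H \<psi>
    by (intro group_hom.intro group_hom_axioms.intro group_Gam \<psi> H)
  interpret q: gam_quad H "\<psi>' (0, 1, 0, 0)" "\<psi>' (1, 0, 0, 0)" "\<psi>' (0, 0, 1, 0)" "\<psi>' (0, 0, 0, 1)"
    by (rule hom_Gam_quad[OF \<psi>' H])
  have cl: "\<psi> u \<in> carrier H" for u by simp
  have comm: "\<psi> u \<otimes>\<^bsub>H\<^esub> \<psi> v = \<psi> v \<otimes>\<^bsub>H\<^esub> (\<psi> u \<otimes>\<^bsub>H\<^esub> \<psi> w)"
    if "u \<otimes>\<^bsub>Gam\<^esub> v = v \<otimes>\<^bsub>Gam\<^esub> (u \<otimes>\<^bsub>Gam\<^esub> w)" for u v w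
  proof -
    have "\<psi> u \<otimes>\<^bsub>H\<^esub> \<psi> v = \<psi> (u \<otimes>\<^bsub>Gam\<^esub> v)" "\<psi> v \<otimes>\<^bsub>H\<^esub> (\<psi> u \<otimes>\<^bsub>H\<^esub> \<psi> w) = \<psi> (v \<otimes>\<^bsub>Gam\<^esub> (u \<otimes>\<^bsub>Gam\<^esub> w))"
      by simp_all
    then show ?thesis by (simp only: that)
  qed
  have "\<psi> (j2, i2, k2, l2) \<otimes>\<^bsub>H\<^esub> (\<psi> (j1, i1, k1, l1) \<otimes>\<^bsub>H\<^esub> \<psi>' (0, 0, 1, 0))
      = \<psi> (j2, i2, k2, l2) \<otimes>\<^bsub>H\<^esub> (\<psi> (j1, i1, k1, l1) \<otimes>\<^bsub>H\<^esub> \<psi> (0, 0, \<Delta>, \<eta>))"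
    unfolding \<Delta> \<eta> by (rule HOL.trans[OF q.ab[unfolded x y, symmetric] comm[OF Gam_comm]])
  then show c: "\<psi>' (0, 0, 1, 0) = \<psi> (0, 0, \<Delta>, \<eta>)"
    by (simp del: mult_Gam hom_mult)
  have "\<psi> (j2, i2, k2, l2) \<otimes>\<^bsub>H\<^esub> (\<psi> (0, 0, \<Delta>, \<eta>) \<otimes>\<^bsub>H\<^esub> \<psi>' (0, 0, 0, 1))
      = \<psi> (j2, i2, k2, l2) \<otimes>\<^bsub>H\<^esub> (\<psi> (0, 0, \<Delta>, \<eta>) \<otimes>\<^bsub>H\<^esub> \<psi> (0, 0, 0, \<Delta> * j2))"
    by (rule HOL.trans[OF q.cb[unfolded y c, symmetric] comm]) simp
  then show "\<psi>' (0, 0, 0, 1) = \<psi> (0, 0, 0, \<Delta> * j2)"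
    by (simp del: mult_Gam hom_mult)
  have "\<psi> (j1, i1, k1, l1) \<otimes>\<^bsub>H\<^esub> (\<psi> (0, 0, \<Delta>, \<eta>) \<otimes>\<^bsub>H\<^esub> \<one>\<^bsub>H\<^esub>)
      = \<psi> (j1, i1, k1, l1) \<otimes>\<^bsub>H\<^esub> (\<psi> (0, 0, \<Delta>, \<eta>) \<otimes>\<^bsub>H\<^esub> \<psi> (0, 0, 0, \<Delta> * j1))"
    using HOL.trans[OF q.ca[unfolded x c, symmetric] comm[of "(0, 0, \<Delta>, \<eta>)" "(j1, i1, k1, l1)" "(0, 0, 0, \<Delta> * j1)"]]
    by simp
  then show "\<psi> (0, 0, 0, \<Delta> * j1) = \<one>\<^bsub>H\<^esub>"
    by (simp del: mult_Gam hom_mult)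
qed

lemma hom_Gam_change_apply:
  assumes \<psi>: "\<psi> \<in> hom Gam H" and \<psi>': "\<psi>' \<in> hom Gam H" and H: "group H"
    and x: "\<psi>' (0, 1, 0, 0) = \<psi> x" and y: "\<psi>' (1, 0, 0, 0) = \<psi> y"
    and z: "\<psi>' (0, 0, 1, 0) = \<psi> (0, 0, \<Delta>, \<eta>)" and w: "\<psi>' (0, 0, 0, 1) = \<psi> (0, 0, 0, \<mu>)"
  shows "\<psi>' (j, i, k, l) = \<psi> (y [^]\<^bsub>Gam\<^esub> j \<otimes>\<^bsub>Gam\<^esub> x [^]\<^bsub>Gam\<^esub> i \<otimes>\<^bsub>Gam\<^esub> (0, 0, k * \<Delta>, k * \<eta> + l * \<mu>))"
proof -
  interpret group_hom Gam H \<psi>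
    by (intro group_hom.intro group_hom_axioms.intro group_Gam \<psi> H)
  have "(0, 0, k * \<Delta>, k * \<eta> + l * \<mu>) = (0, 0, \<Delta>, \<eta>) [^]\<^bsub>Gam\<^esub> k \<otimes>\<^bsub>Gam\<^esub> (0, 0, 0, \<mu>) [^]\<^bsub>Gam\<^esub> l"
    by (simp add: Gam_pow_special)
  then show ?thesis
    unfolding hom_Gam_unfold[OF \<psi>' H, of j i k l] x y z w by (simp add: hom_int_pow m_assoc del: mult_Gam)
qed

text \<open>The generators of the second model are written in those of the first, and their p^n'-th
  and p^m'-th powers are compared. The inequalities between the exponents are one-sided; exchanging
  the models gives the reverse ones.\<close>

lemma model_param_equiv:
  assumes H: "group H" and p: "Factorial_Ring.prime p" and nm: "2 \<le> m" "m \<le> n" "2 \<le> m'" "m' \<le> n'"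
    and 1: "model H p n m q" and 2: "model H p n' m' q'"
  shows "n \<le> n' \<and> m \<le> m' \<and> (n = n' \<and> m = m' \<longrightarrow> param_equiv p n q q')"
proof -
  let ?p = "int p"
  have pp: "Factorial_Ring.prime ?p" using p by simp
  have p0: "p \<noteq> 0" using p by auto
  obtain \<psi> where \<psi>: "\<psi> \<in> hom Gam H" and sur: "range \<psi> = carrier H"
    and ker: "\<And>x. \<psi> x = \<one>\<^bsub>H\<^esub> \<longleftrightarrow> x \<in> Lam p n m q"
    using 1 unfolding model_def by blast
  obtain \<psi>' where \<psi>': "\<psi>' \<in> hom Gam H" and sur': "range \<psi>' = carrier H"
    and ker': "\<And>x. \<psi>' x = \<one>\<^bsub>H\<^esub> \<longleftrightarrow> x \<in> Lam p n' m' q'"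
    using 2 unfolding model_def by blast
  obtain \<alpha> \<beta> \<gamma> \<delta> where q: "q = (\<alpha>, \<beta>, \<gamma>, \<delta>)" by (cases q)
  obtain \<alpha>' \<beta>' \<gamma>' \<delta>' where q': "q' = (\<alpha>', \<beta>', \<gamma>', \<delta>')" by (cases q')
  obtain j1 i1 k1 l1 where x: "\<psi>' (0, 1, 0, 0) = \<psi> (j1, i1, k1, l1)"
    using sur sur' by (metis rangeE rangeI prod.collapse)
  obtain j2 i2 k2 l2 where y: "\<psi>' (1, 0, 0, 0) = \<psi> (j2, i2, k2, l2)"
    using sur sur' by (metis rangeE rangeI prod.collapse)
  define \<Delta> where "\<Delta> = i1 * j2 - i2 * j1"
  define \<eta> where "\<eta> = k1 * j2 - k2 * j1 + i1 * tri j2 - i2 * tri j1"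
  note ch = hom_Gam_change[OF \<psi> \<psi>' H x y \<Delta>_def \<eta>_def]
  note ap = hom_Gam_change_apply[OF \<psi> \<psi>' H x y ch(1,2)]
  \<comment> \<open>The new d is non-trivial, so p divides neither \<Delta> nor j2. Since the new a
    commutes with the new c, p divides \<Delta> j1 and hence j1, which leaves i1 prime to p.\<close>
  have "\<psi>' (0, 0, 0, 1) \<noteq> \<one>\<^bsub>H\<^esub>"
    using p by (simp add: ker' Lam_central_iff[OF p0] prime_nat_iff)
  then have "\<not> ?p dvd \<Delta> * j2"
    unfolding ch(2) ker Lam_central_iff[OF p0] by simp
  then have \<Delta>: "\<not> ?p dvd \<Delta>" and j2: "\<not> ?p dvd j2" by auto
  have "?p dvd \<Delta> * j1"
    using ch(3) unfolding ker Lam_central_iff[OF p0] by simp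
  then have j1: "?p dvd j1" using \<Delta> pp prime_dvd_mult_iff by blast
  have i1: "\<not> ?p dvd i1"
    using \<Delta> j1 unfolding \<Delta>_def by (meson dvd_diff dvd_mult dvd_mult2)
  \<comment> \<open>The relation for the p^n'-th power of a in the second model, to be pulled back
    to the first one.\<close>
  have "(0, ?p ^ n', - (?p * \<alpha>'), - \<beta>') \<in> Lam p n' m' q'"
    unfolding q' Lam_iff by (intro exI[of _ 0] exI[of _ 1]) simp
  then have "(j1, i1, k1, l1) [^]\<^bsub>Gam\<^esub> (?p ^ n') \<otimes>\<^bsub>Gam\<^esub>
      (0, 0, - (?p * \<alpha>') * \<Delta>, - (?p * \<alpha>') * \<eta> + (- \<beta>') * (\<Delta> * j2)) \<in> Lam p n m q"
    unfolding ker'[symmetric] ker[symmetric] ap by (simp del: mult_Gam add: Gam_l_one)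
  then have "(j1, i1, k1, l1) [^]\<^bsub>Gam\<^esub> (p ^ n') \<otimes>\<^bsub>Gam\<^esub>
      (0, 0, - (?p * \<alpha>') * \<Delta>, - (?p * \<alpha>') * \<eta> + (- \<beta>') * (\<Delta> * j2)) \<in> Lam p n m q"
    by (metis int_pow_int of_nat_power)
  then obtain t r where tr: "?p ^ n' * j1 = ?p ^ m * t" "?p ^ n' * i1 = ?p ^ n * r"
    and trk: "?p\<^sup>2 dvd ?p ^ n' * k1 + i1 * j1 * tri (?p ^ n') - ?p * \<alpha>' * \<Delta> + ?p * (t * \<gamma> + r * \<alpha>)"
    and trl: "?p dvd (?p ^ n' * l1 + k1 * j1 * tri (?p ^ n') + i1 * (j1\<^sup>2 * int (p ^ n' choose 3)
         + tri j1 * tri (?p ^ n'))) + (- (?p * \<alpha>' * \<eta>) - \<beta>' * (\<Delta> * j2)) + t * \<delta> + r * \<beta>"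
    unfolding Gam_nat_pow q by (auto simp: Lam_iff)
  have "?p ^ n dvd ?p ^ n' * i1" unfolding tr by simp
  moreover have "coprime (?p ^ n) i1"
    using i1 pp by (simp add: prime_imp_coprime)
  ultimately have "?p ^ n dvd ?p ^ n'"
    using coprime_dvd_mult_left_iff by blast
  then have n: "n \<le> n'"
    using p power_dvd_imp_le[of p n n']
    by (simp add: prime_nat_iff flip: of_nat_power)
  have "(?p ^ m', 0, - (?p * \<gamma>'), - \<delta>') \<in> Lam p n' m' q'"
    unfolding q' Lam_iff by (intro exI[of _ 1] exI[of _ 0]) simp
  then have "(j2, i2, k2, l2) [^]\<^bsub>Gam\<^esub> (?p ^ m') \<otimes>\<^bsub>Gam\<^esub>
      (0, 0, - (?p * \<gamma>') * \<Delta>, - (?p * \<gamma>') * \<eta> + (- \<delta>') * (\<Delta> * j2)) \<in> Lam p n m q"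
    unfolding ker'[symmetric] ker[symmetric] ap by (simp del: mult_Gam add: Gam_r_one)
  then have "(j2, i2, k2, l2) [^]\<^bsub>Gam\<^esub> (p ^ m') \<otimes>\<^bsub>Gam\<^esub>
      (0, 0, - (?p * \<gamma>') * \<Delta>, - (?p * \<gamma>') * \<eta> + (- \<delta>') * (\<Delta> * j2)) \<in> Lam p n m q"
    by (metis int_pow_int of_nat_power)
  then obtain t' r' where tr': "?p ^ m' * j2 = ?p ^ m * t'" "?p ^ m' * i2 = ?p ^ n * r'"
    and trk': "?p\<^sup>2 dvd ?p ^ m' * k2 + i2 * j2 * tri (?p ^ m') - ?p * \<gamma>' * \<Delta> + ?p * (t' * \<gamma> + r' * \<alpha>)"
    and trl': "?p dvd (?p ^ m' * l2 + k2 * j2 * tri (?p ^ m') + i2 * (j2\<^sup>2 * int (p ^ m' choose 3)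
         + tri j2 * tri (?p ^ m'))) + (- (?p * \<gamma>' * \<eta>) - \<delta>' * (\<Delta> * j2)) + t' * \<delta> + r' * \<beta>"
    unfolding Gam_nat_pow q by (auto simp: Lam_iff)
  have "?p ^ m dvd ?p ^ m' * j2" unfolding tr' by simp
  moreover have "coprime (?p ^ m) j2"
    using j2 pp by (simp add: prime_imp_coprime)
  ultimately have "?p ^ m dvd ?p ^ m'"
    using coprime_dvd_mult_left_iff by blast
  then have m: "m \<le> m'"
    using p power_dvd_imp_le[of p m m']
    by (simp add: prime_nat_iff flip: of_nat_power)
  have "param_equiv p n q q'" if eq: "n = n'" "m = m'"
  proof -
    have r: "r = i1" and t': "t' = j2" using tr tr' eq p0 by simp_all
    have "?p ^ m * t = ?p ^ m * (?p ^ (n - m) * j1)"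
      using tr(1) eq nm by (simp add: power_add[symmetric] mult.assoc[symmetric])
    then have t: "?p dvd t" using p0 j1 by simp
    have N: "?p\<^sup>2 dvd ?p ^ n" "?p dvd ?p ^ n" "?p\<^sup>2 dvd ?p ^ m" "?p dvd ?p ^ m"
      using nm by (auto intro: prime_sq_dvd_power dvd_power)
    have T: "?p dvd tri (?p ^ n)" "?p dvd tri (?p ^ m)"
      using nm by (auto intro: prime_dvd_tri_power(1)[OF p])
    have C: "?p dvd int (p ^ n choose 3)" "?p dvd int (p ^ m choose 3)"
      using nm prime_dvd_choose_3[OF p, of n] prime_dvd_choose_3[OF p, of m] by auto
    \<comment> \<open>As p divides j1, the determinant \<Delta> may be replaced by i1 j2 in all
      congruences modulo p.\<close>
    have \<Delta>': "?p dvd \<Delta> - i1 * j2" using j1 by (simp add: \<Delta>_def)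
    have canc: "?p dvd u" if "?p * ?p dvd ?p * u" for u using that p0 by simp
    have "?p dvd i1 * \<alpha> - \<alpha>' * \<Delta>"
    proof -
      have "?p\<^sup>2 dvd ?p ^ n * k1"
        using N by simp
      moreover have "?p\<^sup>2 dvd i1 * (j1 * tri (?p ^ n))" "?p\<^sup>2 dvd ?p * (t * \<gamma>)"
        unfolding power2_eq_square by (intro dvd_mult mult_dvd_mono j1 T dvd_refl dvd_mult2 t)+
      ultimately have "?p\<^sup>2 dvd (?p ^ n * k1 + i1 * (j1 * tri (?p ^ n))) + ?p * (t * \<gamma>)"
        by (intro dvd_add)
      from dvd_diff[OF trk this] show ?thesis
        by (intro canc) (simp add: eq r power2_eq_square algebra_simps)
    qed
    moreover have "i1 * \<alpha> - \<alpha>' * \<Delta> + \<alpha>' * (\<Delta> - i1 * j2) = i1 * (\<alpha> - \<alpha>' * j2)"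
      by (simp add: algebra_simps)
    ultimately have 1: "?p dvd \<alpha> - \<alpha>' * j2"
      using \<Delta>' i1 pp by (metis dvd_add dvd_mult prime_dvd_mult_iff)
    have "?p dvd i1 * \<beta> - \<beta>' * (\<Delta> * j2)"
    proof -
      have "?p dvd (?p ^ n * l1 + k1 * j1 * tri (?p ^ n) + i1 * (j1\<^sup>2 * int (p ^ n choose 3)
         + tri j1 * tri (?p ^ n))) - ?p * \<alpha>' * \<eta> + t * \<delta>"
        using N T C t by (intro dvd_add dvd_diff; simp)
      from dvd_diff[OF trl this[unfolded eq]] show ?thesis
        by (simp add: eq r algebra_simps)
    qed
    moreover have "i1 * \<beta> - \<beta>' * (\<Delta> * j2) + \<beta>' * j2 * (\<Delta> - i1 * j2) = i1 * (\<beta> - \<beta>' * j2\<^sup>2)"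
      by (simp add: algebra_simps power2_eq_square)
    ultimately have 2: "?p dvd \<beta> - \<beta>' * j2\<^sup>2"
      using \<Delta>' i1 pp by (metis dvd_add dvd_mult prime_dvd_mult_iff)
    \<comment> \<open>The exponent of a in the new b is a multiple of p^(n-m); the cofactor r' is
      the e of \<open>param_equiv\<close>.\<close>
    have i2: "i2 = ?p ^ (n - m) * r'"
    proof -
      have "?p ^ m * i2 = ?p ^ m * (?p ^ (n - m) * r')"
        using tr'(2) eq nm by (simp add: power_add[symmetric] mult.assoc[symmetric])
      then show ?thesis using p0 by simp
    qed
    \<comment> \<open>What remains modulo p^2 of the power of c from \<open>Gam_nat_pow\<close>:
      \<open>tri\<close> 4 = 6 leaves a summand for p = m = n = 2, while for p = m = 2 < n the
      factor p^(n-m) of i2 absorbs it.\<close>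
    let ?\<kappa> = "if p = 2 \<and> n = 2 then r' else 0"
    have "?p\<^sup>2 dvd i2 * j2 * tri (?p ^ m) - ?p * ?\<kappa>"
    proof (cases "p = 2 \<and> m = 2")
      case True
      then have 6: "tri (?p ^ m) = 6" "tri 4 = 6" by (simp_all add: tri_def)
      show ?thesis
      proof (cases "n = 2")
        case n2: True
        then have "i2 = r'" using i2 True by simp
        obtain g where "j2 = 2 * g + 1" using j2 True by (auto elim: oddE)
        then have "i2 * j2 * tri (?p ^ m) - ?p * ?\<kappa> = 4 * (r' * (3 * g + 1))"
          using n2 True \<open>i2 = r'\<close> by (simp add: 6 algebra_simps)
        then show ?thesis using True by simp
      next
        case False
        then have "2 dvd i2" unfolding i2 using True nm by simp
        then obtain g where "i2 = 2 * g" by blast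
        then show ?thesis using True False by (simp add: 6)
      qed
    next
      case False
      then have "?p\<^sup>2 dvd tri (?p ^ m)"
        using nm p by (intro prime_dvd_tri_power(2)) auto
      moreover have "?\<kappa> = 0" using False nm by auto
      ultimately show ?thesis by simp
    qed
    then have "?p\<^sup>2 dvd ?p ^ m * k2 + (i2 * j2 * tri (?p ^ m) - ?p * ?\<kappa>)"
      using N by (intro dvd_add) simp_all
    from dvd_diff[OF trk' this[unfolded eq]]
    have "?p dvd j2 * \<gamma> + r' * \<alpha> + ?\<kappa> - \<gamma>' * \<Delta>"
      by (intro canc) (simp add: eq t' power2_eq_square algebra_simps)
    moreover have "j2 * \<gamma> + r' * \<alpha> + ?\<kappa> - \<gamma>' * \<Delta> + \<gamma>' * (\<Delta> - i1 * j2) = j2 * \<gamma> + r' * \<alpha> + ?\<kappa> - \<gamma>' * i1 * j2"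
      by (simp add: algebra_simps)
    ultimately have 3: "?p dvd j2 * \<gamma> + r' * \<alpha> + ?\<kappa> - \<gamma>' * i1 * j2"
      using \<Delta>' by (metis dvd_add dvd_mult)
    have "?p dvd j2 * \<delta> + r' * \<beta> - \<delta>' * (\<Delta> * j2)"
    proof -
      have "?p dvd (?p ^ m * l2 + k2 * j2 * tri (?p ^ m) + i2 * (j2\<^sup>2 * int (p ^ m choose 3)
         + tri j2 * tri (?p ^ m))) - ?p * \<gamma>' * \<eta>"
        using N T C by (intro dvd_add dvd_diff; simp)
      from dvd_diff[OF trl' this[unfolded eq]] show ?thesis
        by (simp add: eq t' algebra_simps)
    qed
    moreover have "j2 * \<delta> + r' * \<beta> - \<delta>' * (\<Delta> * j2) + \<delta>' * j2 * (\<Delta> - i1 * j2) = j2 * \<delta> + r' * \<beta> - \<delta>' * i1 * j2\<^sup>2"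
      by (simp add: algebra_simps power2_eq_square)
    ultimately have 4: "?p dvd j2 * \<delta> + r' * \<beta> - \<delta>' * i1 * j2\<^sup>2"
      using \<Delta>' by (metis dvd_add dvd_mult)
    show ?thesis
      unfolding param_equiv_def q q' using i1 j2 1 2 3 4 by blast
  qed
  with n m show ?thesis by blast
qed


text \<open>The power relations reduce a normal form with exponents p^m t and p^n r to powers of c
  and d, with the exponents in the definition of \<open>Lam\<close>. For the kernel to be no larger,
  it suffices to control the exponents of b and a, and then the relations between c and d.\<close>

lemma gam_quad_model:
  fixes H (structure)
  assumes "gam_quad H a b c d"
    and q: "q = (\<alpha>, \<beta>, \<gamma>, \<delta>)"
    and rel: "d [^]\<^bsub>H\<^esub> int p = \<one>\<^bsub>H\<^esub>" "c [^]\<^bsub>H\<^esub> ((int p)\<^sup>2) = \<one>\<^bsub>H\<^esub>"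
      "a [^]\<^bsub>H\<^esub> (int p ^ n) = c [^]\<^bsub>H\<^esub> (int p * \<alpha>) \<otimes>\<^bsub>H\<^esub> d [^]\<^bsub>H\<^esub> \<beta>"
      "b [^]\<^bsub>H\<^esub> (int p ^ m) = c [^]\<^bsub>H\<^esub> (int p * \<gamma>) \<otimes>\<^bsub>H\<^esub> d [^]\<^bsub>H\<^esub> \<delta>"
  shows "x \<in> Lam p n m q \<Longrightarrow> gam_quad.ev H a b c d x = \<one>\<^bsub>H\<^esub>"
    and "\<lbrakk>\<And>j i k l. gam_quad.ev H a b c d (j, i, k, l) = \<one>\<^bsub>H\<^esub> \<Longrightarrow> int p ^ m dvd j \<and> int p ^ n dvd i;
      \<And>k l. gam_quad.ev H a b c d (0, 0, k, l) = \<one>\<^bsub>H\<^esub> \<Longrightarrow> (int p)\<^sup>2 dvd k \<and> int p dvd l;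
      range (gam_quad.ev H a b c d) = carrier H\<rbrakk> \<Longrightarrow> model H p n m q"
proof -
  interpret gam_quad H a b c d by fact
  have *: "ev (int p ^ m * t, int p ^ n * r, k, l)
    = ev (0, 0, k + int p * (t * \<gamma> + r * \<alpha>), l + t * \<delta> + r * \<beta>)" for t r k l
  proof -
    have comm: "(c [^] u \<otimes> d [^] v) [^] w = c [^] (u * w) \<otimes> d [^] (v * w)" for u v w :: int
      by (subst int_pow_mult_distrib[OF commute_int_pow[OF dc[symmetric]]]) (simp_all add: int_pow_pow)
    have "b [^] (int p ^ m * t) = c [^] (int p * \<gamma> * t) \<otimes> d [^] (\<delta> * t)"
      "a [^] (int p ^ n * r) = c [^] (int p * \<alpha> * r) \<otimes> d [^] (\<beta> * r)"
      unfolding comm[symmetric] rel(3,4)[symmetric] by (simp_all add: int_pow_pow)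
    then have "ev (int p ^ m * t, int p ^ n * r, k, l)
        = ev (0, 0, int p * \<gamma> * t, \<delta> * t) \<otimes> ev (0, 0, int p * \<alpha> * r, \<beta> * r) \<otimes> ev (0, 0, k, l)"
      by (simp add: m_assoc)
    also have "\<dots> = ev (0, 0, k + int p * (t * \<gamma> + r * \<alpha>), l + t * \<delta> + r * \<beta>)"
      by (simp add: ev_mult[symmetric] algebra_simps del: ev.simps)
    finally show ?thesis .
  qed
  have 0: "ev (0, 0, k, l) = \<one>" if kl: "(int p)\<^sup>2 dvd k" "int p dvd l" for k l
  proof -
    obtain k' l' where "k = (int p)\<^sup>2 * k'" "l = int p * l'" using kl by (auto elim!: dvdE)
    then show ?thesis
      by (simp add: int_pow_pow[symmetric] rel(1,2))
  qed
  show 1: "ev x = \<one>" if mem: "x \<in> Lam p n m q" for x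
  proof -
    obtain j i k l where x: "x = (j, i, k, l)" by (cases x)
    obtain t r where "j = int p ^ m * t" "i = int p ^ n * r"
      "(int p)\<^sup>2 dvd k + int p * (t * \<gamma> + r * \<alpha>)" "int p dvd l + t * \<delta> + r * \<beta>"
      using mem unfolding x q Lam_iff by blast
    then show ?thesis unfolding x by (simp only: * 0)
  qed
  show "model H p n m q"
    if ind: "\<And>j i k l. ev (j, i, k, l) = \<one> \<Longrightarrow> int p ^ m dvd j \<and> int p ^ n dvd i"
      "\<And>k l. ev (0, 0, k, l) = \<one> \<Longrightarrow> (int p)\<^sup>2 dvd k \<and> int p dvd l" and sur: "range ev = carrier H"
  proof -
    have "x \<in> Lam p n m q" if x1: "ev x = \<one>" for x
    proof -
      obtain j i k l where x: "x = (j, i, k, l)" by (cases x)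
      obtain t r where tr: "j = int p ^ m * t" "i = int p ^ n * r"
        using ind(1) x1 unfolding x by (meson dvdE)
      then show ?thesis
        using x1 ind(2) unfolding x q Lam_iff tr * by blast
    qed
    then show ?thesis
      unfolding model_def using 1 ev_hom sur by blast
  qed
qed

text \<open>Since c = [a, b] and d = [c, b], the image is generated by the images of a and
  b.\<close>

lemma hom_Gam_range_subset:
  assumes \<psi>: "\<psi> \<in> hom Gam H" and H: "group H" and I: "subgroup I H"
    and "\<psi> (0, 1, 0, 0) \<in> I" "\<psi> (1, 0, 0, 0) \<in> I"
  shows "range \<psi> \<subseteq> I"
proof -
  interpret group_hom Gam H \<psi>
    by (intro group_hom.intro group_hom_axioms.intro group_Gam \<psi> H)
  interpret q: gam_quad H "\<psi> (0, 1, 0, 0)" "\<psi> (1, 0, 0, 0)" "\<psi> (0, 0, 1, 0)" "\<psi> (0, 0, 0, 1)"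
    by (rule hom_Gam_quad[OF \<psi> H])
  interpret I: subgroup I H by (rule I)
  have mem: "z \<in> I" if "x \<otimes>\<^bsub>H\<^esub> y = y \<otimes>\<^bsub>H\<^esub> (x \<otimes>\<^bsub>H\<^esub> z)" "x \<in> I" "y \<in> I" "z \<in> carrier H" for x y z
  proof -
    have "z = inv\<^bsub>H\<^esub> x \<otimes>\<^bsub>H\<^esub> (inv\<^bsub>H\<^esub> y \<otimes>\<^bsub>H\<^esub> (x \<otimes>\<^bsub>H\<^esub> y))"
      using that I.subset by (simp add: H.m_assoc[symmetric] subset_iff)
    also have "\<dots> \<in> I" using that(2,3) by simp
    finally show ?thesis .
  qed
  have c: "\<psi> (0, 0, 1, 0) \<in> I" using mem[OF q.ab] assms by simp
  have d: "\<psi> (0, 0, 0, 1) \<in> I" using mem[OF q.cb] c assms by simp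
  have "\<psi> (j, i, k, l) \<in> I" for j i k l
    unfolding hom_Gam_unfold[OF \<psi> H, of j i k l]
    using c d assms H.subgroup_int_pow_closed[OF I] by simp
  then show ?thesis by auto
qed

lemma gam_quad_hom:
  assumes "gam_quad G a b c d" "h \<in> hom G H" "group H"
  shows "gam_quad H (h a) (h b) (h c) (h d)"
    and "gam_quad.ev H (h a) (h b) (h c) (h d) u = h (gam_quad.ev G a b c d u)"
proof -
  interpret G: gam_quad G a b c d by fact
  interpret h: group_hom G H h
    by (intro group_hom.intro group_hom_axioms.intro assms G.group_axioms)
  show q: "gam_quad H (h a) (h b) (h c) (h d)"
    by (intro gam_quad.intro gam_quad_axioms.intro assms)
      (simp_all flip: h.hom_mult add: G.ab G.cb G.ca G.da G.db G.dc)
  show "gam_quad.ev H (h a) (h b) (h c) (h d) u = h (gam_quad.ev G a b c d u)"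
    by (cases u) (simp add: gam_quad.ev.simps[OF q] h.hom_int_pow)
qed

text \<open>Converse of \<open>model_param_equiv\<close>: the generators a^i and b^j a^(e p^(n-m))
  satisfy the relations with the new parameters, and they still generate because i and j are prime
  to p.\<close>

lemma model_change:
  assumes H: "group H" and p: "Factorial_Ring.prime p" and nm: "2 \<le> m" "m \<le> n"
    and mod: "model H p n m q" and param_equiv: "param_equiv p n q q'"
  shows "model H p n m q'"
proof -
  let ?p = "int p"
  have p0: "p \<noteq> 0" using p by auto
  obtain \<psi> where \<psi>: "\<psi> \<in> hom Gam H" and sur: "range \<psi> = carrier H"
    and ker: "\<And>x. \<psi> x = \<one>\<^bsub>H\<^esub> \<longleftrightarrow> x \<in> Lam p n m q"
    using mod unfolding model_def by blast
  interpret group_hom Gam H \<psi>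
    by (intro group_hom.intro group_hom_axioms.intro group_Gam \<psi> H)
  obtain \<alpha> \<beta> \<gamma> \<delta> where q: "q = (\<alpha>, \<beta>, \<gamma>, \<delta>)" by (cases q)
  obtain \<alpha>' \<beta>' \<gamma>' \<delta>' where q': "q' = (\<alpha>', \<beta>', \<gamma>', \<delta>')" by (cases q')
  obtain i j e where i: "\<not> ?p dvd i" and j: "\<not> ?p dvd j" and 1: "?p dvd \<alpha> - \<alpha>' * j"
    and 2: "?p dvd \<beta> - \<beta>' * j\<^sup>2"
    and 3: "?p dvd j * \<gamma> + e * \<alpha> + (if p = 2 \<and> n = 2 then e else 0) - \<gamma>' * i * j"
    and 4: "?p dvd j * \<delta> + e * \<beta> - \<delta>' * i * j\<^sup>2"
    using param_equiv unfolding param_equiv_def q q' by auto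
  \<comment> \<open>Chosen so that the p^m-th power of a^e' is the e-th power of a^(p^n).\<close>
  define e' where "e' = e * ?p ^ (n - m)"
  have e': "?p ^ m * e' = ?p ^ n * e"
    using nm by (simp add: e'_def power_add[symmetric] mult.left_commute)
  \<comment> \<open>The last two are the commutators [a, b] and [c, b] of the new generators
    according to \<open>Gam_comm\<close>.\<close>
  define a b c d where abcd: "a = \<psi> (0, i, 0, 0)" "b = \<psi> (j, e', 0, 0)" "c = \<psi> (0, 0, i * j, i * tri j)"
    "d = \<psi> (0, 0, 0, i * j\<^sup>2)"
  have Q: "gam_quad Gam (0, i, 0, 0) (j, e', 0, 0) (0, 0, i * j, i * tri j) (0, 0, 0, i * j\<^sup>2)"
    by (intro gam_quad.intro gam_quad_axioms.intro group_Gam) (simp_all add: power2_eq_square)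
  have q4: "gam_quad H a b c d"
    unfolding abcd by (rule gam_quad_hom[OF Q \<psi> H])
  have ev: "gam_quad.ev H a b c d u =
    \<psi> (gam_quad.ev Gam (0, i, 0, 0) (j, e', 0, 0) (0, 0, i * j, i * tri j) (0, 0, 0, i * j\<^sup>2) u)" for u
    unfolding abcd by (rule gam_quad_hom(2)[OF Q \<psi> H])
  have evc: "gam_quad.ev H a b c d (0, 0, k, l) = \<psi> (0, 0, k * (i * j), k * (i * tri j) + l * (i * j\<^sup>2))" for k l
    unfolding ev by (simp add: gam_quad.ev.simps[OF Q] Gam_pow_special)
  have kcancel: "?p\<^sup>2 dvd k" if "?p\<^sup>2 dvd k * (i * j)" for k
  proof -
    have "coprime ?p (i * j)"
      using i j p by (simp add: prime_imp_coprime)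
    then show ?thesis
      using that coprime_dvd_mult_left_iff[of "?p\<^sup>2" "i * j" k] by simp
  qed
  have eqI: "\<psi> u = \<psi> v" if "w \<in> Lam p n m q" "u = w \<otimes>\<^bsub>Gam\<^esub> v" for u v w
    using that by (simp add: ker[symmetric] del: mult_Gam)
  have N: "?p dvd ?p ^ m" "?p dvd ?p ^ (n + 1)"
    using nm by (auto intro: dvd_power)
  have T: "?p dvd tri (?p ^ m)" "?p dvd int (p ^ m choose 3)"
    using prime_dvd_tri_power(1)[OF p nm(1)] prime_dvd_choose_3[OF p nm(1)] by auto
  let ?\<kappa> = "if p = 2 \<and> n = 2 then e else 0"
  have \<kappa>: "?p\<^sup>2 dvd e' * j * tri (?p ^ m) - ?p * ?\<kappa>"
  proof (cases "p = 2 \<and> m = 2")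
    case True
    then have 6: "tri (?p ^ m) = 6" "tri 4 = 6" by (simp_all add: tri_def)
    show ?thesis
    proof (cases "n = 2")
      case n2: True
      obtain g where "j = 2 * g + 1" using j True by (auto elim: oddE)
      then have "e' * j * tri (?p ^ m) - ?p * ?\<kappa> = 4 * (e * (3 * g + 1))"
        using n2 True by (simp add: 6 e'_def algebra_simps)
      then show ?thesis using True by simp
    next
      case False
      then have "2 dvd e'" unfolding e'_def using True nm by simp
      then obtain g where "e' = 2 * g" by blast
      then show ?thesis using True False by (simp add: 6)
    qed
  next
    case False
    then have "?p\<^sup>2 dvd tri (?p ^ m)"
      using nm p by (intro prime_dvd_tri_power(2)) auto
    moreover have "?\<kappa> = 0" using False nm by auto
    ultimately show ?thesis by simp
  qed
  have psq: "?p\<^sup>2 dvd ?p * u" if "?p dvd u" for u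
    using that p0 by (simp add: power2_eq_square)
  have pwh: "\<psi> x [^]\<^bsub>H\<^esub> N = \<psi> (x [^]\<^bsub>Gam\<^esub> N)" for x and N :: int
    by (simp add: hom_int_pow)
  have r1: "d [^]\<^bsub>H\<^esub> ?p = \<one>\<^bsub>H\<^esub>" "c [^]\<^bsub>H\<^esub> (?p\<^sup>2) = \<one>\<^bsub>H\<^esub>"
    unfolding abcd pwh ker Gam_pow_special
    by (simp_all add: Lam_central_iff[OF p0] power2_eq_square)
  have cd: "c [^]\<^bsub>H\<^esub> k \<otimes>\<^bsub>H\<^esub> d [^]\<^bsub>H\<^esub> l = \<psi> (0, 0, k * (i * j), k * (i * tri j) + l * (i * j\<^sup>2))" for k l :: int
    unfolding evc[symmetric] gam_quad.ev.simps[OF q4]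
    using gam_quad.c_closed[OF q4] gam_quad.d_closed[OF q4] gam_quad.a_closed[OF q4] gam_quad.b_closed[OF q4] by simp
  have r3: "a [^]\<^bsub>H\<^esub> (?p ^ n) = c [^]\<^bsub>H\<^esub> (?p * \<alpha>') \<otimes>\<^bsub>H\<^esub> d [^]\<^bsub>H\<^esub> \<beta>'"
  proof -
    have "(0, ?p ^ n * i, - (?p * \<alpha>') * (i * j), - ((?p * \<alpha>') * (i * tri j) + \<beta>' * (i * j\<^sup>2))) \<in> Lam p n m q"
      unfolding q Lam_iff
    proof (intro exI conjI)
      have "?p\<^sup>2 dvd ?p * (i * (\<alpha> - \<alpha>' * j))" using 1 by (intro psq) simp
      then show "?p\<^sup>2 dvd - (?p * \<alpha>') * (i * j) + ?p * (0 * \<gamma> + i * \<alpha>)"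
        by (simp add: algebra_simps)
      have "?p dvd i * (\<beta> - \<beta>' * j\<^sup>2) - ?p * \<alpha>' * (i * tri j)" using 2 by simp
      then show "?p dvd - ((?p * \<alpha>') * (i * tri j) + \<beta>' * (i * j\<^sup>2)) + 0 * \<delta> + i * \<beta>"
        by (simp add: algebra_simps)
    qed simp_all
    then show ?thesis
      unfolding cd unfolding abcd pwh Gam_pow_special
      by (rule eqI) simp
  qed
  have r4: "b [^]\<^bsub>H\<^esub> (?p ^ m) = c [^]\<^bsub>H\<^esub> (?p * \<gamma>') \<otimes>\<^bsub>H\<^esub> d [^]\<^bsub>H\<^esub> \<delta>'"
  proof -
    let ?k = "e' * j * tri (?p ^ m)" and ?l = "e' * (j\<^sup>2 * int (p ^ m choose 3) + tri j * tri (?p ^ m))"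
    have pw: "(j, e', 0, 0) [^]\<^bsub>Gam\<^esub> (?p ^ m) = (?p ^ m * j, ?p ^ m * e', ?k, ?l)"
      using Gam_nat_pow[of j e' 0 0 "p ^ m"] int_pow_int[of Gam "(j, e', 0, 0)" "p ^ m"] by simp
    have "(?p ^ m * j, ?p ^ m * e', ?k - (?p * \<gamma>') * (i * j), ?l - ((?p * \<gamma>') * (i * tri j) + \<delta>' * (i * j\<^sup>2))) \<in> Lam p n m q"
      unfolding q Lam_iff
    proof (intro exI conjI)
      have "?p\<^sup>2 dvd ?p * (j * \<gamma> + e * \<alpha> + ?\<kappa> - \<gamma>' * i * j) + (?k - ?p * ?\<kappa>)"
        using psq[OF 3] \<kappa> by (rule dvd_add)
      then show "?p\<^sup>2 dvd ?k - (?p * \<gamma>') * (i * j) + ?p * (j * \<gamma> + e * \<alpha>)"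
        by (simp add: algebra_simps split del: if_split)
      have "?p dvd ?l - (?p * \<gamma>') * (i * tri j)"
        using T by (intro dvd_add dvd_diff; simp)
      then have "?p dvd ?l - (?p * \<gamma>') * (i * tri j) + (j * \<delta> + e * \<beta> - \<delta>' * i * j\<^sup>2)"
        using 4 by (rule dvd_add)
      then show "?p dvd ?l - ((?p * \<gamma>') * (i * tri j) + \<delta>' * (i * j\<^sup>2)) + j * \<delta> + e * \<beta>"
        by (simp add: algebra_simps)
    qed (simp_all add: e')
    then show ?thesis
      unfolding cd unfolding abcd pwh pw
      by (rule eqI) simp
  qed
  have ind1: "?p ^ m dvd J \<and> ?p ^ n dvd I" if ev1: "gam_quad.ev H a b c d (J, I, K, L) = \<one>\<^bsub>H\<^esub>" for J I K L
  proof -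
    obtain k l where kl: "(j, e', 0, 0) [^]\<^bsub>Gam\<^esub> J = (J * j, J * e', k, l)"
      using Gam_int_pow_fst by blast
    obtain k' l' where "gam_quad.ev Gam (0, i, 0, 0) (j, e', 0, 0) (0, 0, i * j, i * tri j) (0, 0, 0, i * j\<^sup>2) (J, I, K, L)
        = (J * j, J * e' + I * i, k', l')"
      unfolding gam_quad.ev.simps[OF Q] Gam_pow_special kl by simp
    then have "(J * j, J * e' + I * i, k', l') \<in> Lam p n m q"
      using ev1 unfolding ev by (simp add: ker)
    then have 5: "?p ^ m dvd J * j" "?p ^ n dvd J * e' + I * i"
      unfolding q Lam_iff by auto
    have "coprime (?p ^ m) j" "coprime (?p ^ n) i"
      using i j p by (simp_all add: prime_imp_coprime)
    with 5 have m: "?p ^ m dvd J"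
      using coprime_dvd_mult_left_iff by blast
    then have "?p ^ m * e' dvd J * e'" by simp
    then have "?p ^ n dvd J * e'" unfolding e' by (rule dvd_mult_left)
    with 5 have "?p ^ n dvd I * i" by (simp add: dvd_add_right_iff)
    with \<open>coprime (?p ^ n) i\<close> m show ?thesis
      using coprime_dvd_mult_left_iff by blast
  qed
  have ind2: "?p\<^sup>2 dvd K \<and> ?p dvd L" if ev1: "gam_quad.ev H a b c d (0, 0, K, L) = \<one>\<^bsub>H\<^esub>" for K L
  proof -
    have *: "?p\<^sup>2 dvd K * (i * j)" "?p dvd K * (i * tri j) + L * (i * j\<^sup>2)"
      using ev1 unfolding evc ker Lam_central_iff[OF p0] by auto
    from *(1) have K: "?p\<^sup>2 dvd K" by (rule kcancel)
    then have "?p dvd K" by (simp add: power2_eq_square dvd_mult_left)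
    then have "?p dvd L * (i * j\<^sup>2)" using *(2) by (simp add: dvd_add_right_iff)
    then have "?p dvd L" using i j p by (simp add: prime_dvd_mult_iff prime_dvd_power_iff)
    with K show ?thesis by blast
  qed
  have sur': "range (gam_quad.ev H a b c d) = carrier H"
  proof -
    define I where "I = range (gam_quad.ev H a b c d)"
    have evh: "gam_quad.ev H a b c d \<in> hom Gam H" by (rule gam_quad.ev_hom[OF q4])
    interpret e: group_hom Gam H "gam_quad.ev H a b c d"
      by (intro group_hom.intro group_hom_axioms.intro group_Gam evh H)
    have I: "subgroup I H"
      using e.img_is_subgroup by (simp add: I_def)
    \<comment> \<open>An element of p-power order is a power of its s-th power if p does not divide
      s.\<close>
    have bez: "\<exists>u::int. \<psi> x = (\<psi> x [^]\<^bsub>H\<^esub> s) [^]\<^bsub>H\<^esub> u"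
      if s: "\<not> ?p dvd s" and x: "\<psi> (x [^]\<^bsub>Gam\<^esub> (?p ^ N)) = \<one>\<^bsub>H\<^esub>" for s :: int and x N
    proof -
      have "coprime s (?p ^ N)"
        using s p prime_imp_coprime[of ?p s] by (simp add: coprime_commute)
      then obtain u v where uv: "s * u + ?p ^ N * v = 1"
        by (metis bezout_int coprime_imp_gcd_eq_1 mult.commute)
      have "\<psi> x = \<psi> x [^]\<^bsub>H\<^esub> (s * u + ?p ^ N * v)" unfolding uv by simp
      also have "\<dots> = (\<psi> x [^]\<^bsub>H\<^esub> s) [^]\<^bsub>H\<^esub> u \<otimes>\<^bsub>H\<^esub> (\<psi> x [^]\<^bsub>H\<^esub> (?p ^ N)) [^]\<^bsub>H\<^esub> v"
        by (simp add: H.int_pow_mult H.int_pow_pow)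
      also have "\<psi> x [^]\<^bsub>H\<^esub> (?p ^ N) = \<one>\<^bsub>H\<^esub>" using x by (simp add: hom_int_pow)
      also have "(\<psi> x [^]\<^bsub>H\<^esub> s) [^]\<^bsub>H\<^esub> u \<otimes>\<^bsub>H\<^esub> \<one>\<^bsub>H\<^esub> [^]\<^bsub>H\<^esub> v = (\<psi> x [^]\<^bsub>H\<^esub> s) [^]\<^bsub>H\<^esub> u"
        by simp
      finally show ?thesis by (rule exI)
    qed
    \<comment> \<open>The orders of a and b divide p^(n+1) and p^(m+1): the p-th powers of c^p and
      of d vanish. The witnesses are r = p and t = p.\<close>
    have "(0, ?p ^ (n + 1), 0, 0) \<in> Lam p n m q" "(?p ^ (m + 1), 0, 0, 0) \<in> Lam p n m q"
      unfolding q Lam_iff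
      by (rule exI[of _ 0], rule exI[of _ ?p], simp add: power2_eq_square,
          rule exI[of _ ?p], rule exI[of _ 0], simp add: power2_eq_square)
    then have pow: "\<psi> ((0, 1, 0, 0) [^]\<^bsub>Gam\<^esub> (?p ^ (n + 1))) = \<one>\<^bsub>H\<^esub>" "\<psi> ((1, 0, 0, 0) [^]\<^bsub>Gam\<^esub> (?p ^ (m + 1))) = \<one>\<^bsub>H\<^esub>"
      by (simp_all add: ker Gam_pow_special)
    have ab: "a \<in> I" "b \<in> I"
      unfolding I_def using gam_quad.ev_gens[OF q4] by (metis rangeI)+
    have a: "a = \<psi> (0, 1, 0, 0) [^]\<^bsub>H\<^esub> i"
      unfolding abcd by (simp add: pwh Gam_pow_special)
    have 1: "\<psi> (0, 1, 0, 0) \<in> I"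
      using bez[OF i pow(1)] ab(1) unfolding a[symmetric] using H.subgroup_int_pow_closed[OF I] by metis
    \<comment> \<open>With a already in I, the factor a^e' can be stripped from the new b.\<close>
    have "(j, 0, 0, 0) = (j, e', 0, 0) \<otimes>\<^bsub>Gam\<^esub> (0, - e', 0, 0)" by simp
    also have "\<dots> = (j, e', 0, 0) \<otimes>\<^bsub>Gam\<^esub> (0, 1, 0, 0) [^]\<^bsub>Gam\<^esub> (- e')"
      by (simp add: Gam_pow_special)
    finally have "\<psi> (j, 0, 0, 0) = b \<otimes>\<^bsub>H\<^esub> \<psi> (0, 1, 0, 0) [^]\<^bsub>H\<^esub> (- e')"
      unfolding abcd by (simp del: mult_Gam add: hom_int_pow)
    then have "\<psi> (j, 0, 0, 0) \<in> I"
      using ab 1 H.subgroup_int_pow_closed[OF I] subgroup.m_closed[OF I] by simp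
    moreover have "\<psi> (j, 0, 0, 0) = \<psi> (1, 0, 0, 0) [^]\<^bsub>H\<^esub> j"
      by (simp add: pwh Gam_pow_special)
    ultimately have "\<psi> (1, 0, 0, 0) \<in> I"
      using bez[OF j pow(2)] H.subgroup_int_pow_closed[OF I] by metis
    then have "range \<psi> \<subseteq> I"
      using 1 by (intro hom_Gam_range_subset[OF \<psi> H I])
    then show ?thesis
      using subgroup.subset[OF I] unfolding sur I_def by blast
  qed
  show ?thesis
    by (rule gam_quad_model(2)[OF q4 q' r1 r3 r4 ind1 ind2 sur'])
qed

section \<open>Presented groups as quotients\<close>

lemma (in normal) mem_rcos_one_iff: "x \<in> carrier G \<Longrightarrow> H #> x = H \<longleftrightarrow> x \<in> H"
  by (metis coset_join1 coset_join2 is_subgroup subset)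

text \<open>Because m is at least 2, all exponents of b and a in \<open>Lam\<close> are divisible by
  p^2, and the \<open>tri\<close> of such an exponent of b by p. So the corrections in products and
  conjugates vanish modulo p^2 for c and modulo p for d.\<close>

lemma Lam_normal:
  assumes p: "Factorial_Ring.prime p" and nm: "2 \<le> m" "m \<le> n"
  shows "Lam p n m q \<lhd> Gam"
proof -
  let ?p = "int p"
  obtain \<alpha> \<beta> \<gamma> \<delta> where q: "q = (\<alpha>, \<beta>, \<gamma>, \<delta>)" by (cases q)
  have N: "?p\<^sup>2 dvd ?p ^ n * u" "?p\<^sup>2 dvd ?p ^ m * u" for u
    using nm prime_sq_dvd_power[of n p] prime_sq_dvd_power[of m p] by auto
  have p2: "?p dvd u" if "?p\<^sup>2 dvd u" for u
    using that by (simp add: power2_eq_square dvd_mult_left)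
  have T: "?p dvd tri (?p ^ m * t)" for t
    unfolding mult.commute[of _ t] tri_mult using prime_dvd_tri_power(1)[OF p nm(1)] N(2)[of 1, THEN p2]
    by (metis dvd_add dvd_mult dvd_mult2 mult.commute mult.right_neutral tri_mult)
  \<comment> \<open>The exponent of c is divisible by p, so its contribution to the exponent of d
    vanishes modulo p.\<close>
  have k: "?p dvd k" if "?p\<^sup>2 dvd k + ?p * u" for k u
    using p2[OF that] by (simp add: dvd_add_left_iff)
  have sub: "subgroup (Lam p n m q) Gam"
  proof (rule group.subgroupI[OF group_Gam])
    have "(0, 0, 0, 0) \<in> Lam p n m q"
      unfolding q Lam_iff by (intro exI[of _ 0]) simp
    then show "Lam p n m q \<noteq> {}" by blast
  next
    fix x assume x: "x \<in> Lam p n m q"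
    obtain j i k l where xx: "x = (j, i, k, l)" by (cases x)
    obtain t r where tr: "j = ?p ^ m * t" "i = ?p ^ n * r" "?p\<^sup>2 dvd k + ?p * (t * \<gamma> + r * \<alpha>)"
      "?p dvd l + t * \<delta> + r * \<beta>"
      using x unfolding xx q Lam_iff by blast
    have "?p\<^sup>2 dvd ?p ^ n * (r * j) - (k + ?p * (t * \<gamma> + r * \<alpha>))"
      using N tr by (intro dvd_diff)
    moreover have "?p dvd k * j + ?p ^ n * (r * (tri j - j\<^sup>2)) - (l + t * \<delta> + r * \<beta>)"
      by (rule dvd_diff[OF dvd_add tr(4)]) (use k[OF tr(3)] N[THEN p2] in simp_all)
    ultimately show "inv\<^bsub>Gam\<^esub> x \<in> Lam p n m q"
      unfolding xx inv_Gam q Lam_iff using tr(1,2)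
      by (intro exI[of _ "- t"] exI[of _ "- r"]) (simp add: algebra_simps)
  next
    fix x y assume x: "x \<in> Lam p n m q" and y: "y \<in> Lam p n m q"
    obtain j i k l where xx: "x = (j, i, k, l)" by (cases x)
    obtain t r where tr: "j = ?p ^ m * t" "i = ?p ^ n * r" "?p\<^sup>2 dvd k + ?p * (t * \<gamma> + r * \<alpha>)"
      "?p dvd l + t * \<delta> + r * \<beta>"
      using x unfolding xx q Lam_iff by blast
    obtain j' i' k' l' where yy: "y = (j', i', k', l')" by (cases y)
    obtain t' r' where tr': "j' = ?p ^ m * t'" "i' = ?p ^ n * r'" "?p\<^sup>2 dvd k' + ?p * (t' * \<gamma> + r' * \<alpha>)"
      "?p dvd l' + t' * \<delta> + r' * \<beta>"
      using y unfolding yy q Lam_iff by blast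
    have "?p\<^sup>2 dvd (k + ?p * (t * \<gamma> + r * \<alpha>)) + (k' + ?p * (t' * \<gamma> + r' * \<alpha>)) + ?p ^ n * (r * j')"
      by (rule dvd_add[OF dvd_add[OF tr(3) tr'(3)]]) (rule N)
    moreover have "?p dvd (l + t * \<delta> + r * \<beta>) + (l' + t' * \<delta> + r' * \<beta>) + k * j' + ?p ^ n * (r * tri j')"
      by (rule dvd_add[OF dvd_add[OF dvd_add[OF tr(4) tr'(4)]]]) (use k[OF tr(3)] N[THEN p2] in simp_all)
    ultimately show "x \<otimes>\<^bsub>Gam\<^esub> y \<in> Lam p n m q"
      unfolding xx yy mult_Gam q Lam_iff using tr(1,2) tr'(1,2)
      by (intro exI[of _ "t + t'"] exI[of _ "r + r'"]) (simp add: algebra_simps)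
  qed simp
  show ?thesis
  proof (rule group.normal_invI[OF group_Gam sub])
    fix g x :: "int \<times> int \<times> int \<times> int" assume "x \<in> Lam p n m q"
    obtain j i k l where xx: "x = (j, i, k, l)" by (cases x)
    obtain t r where tr: "j = ?p ^ m * t" "i = ?p ^ n * r" "?p\<^sup>2 dvd k + ?p * (t * \<gamma> + r * \<alpha>)"
      "?p dvd l + t * \<delta> + r * \<beta>"
      using \<open>x \<in> _\<close> unfolding xx q Lam_iff by blast
    obtain j' i' k' l' where g: "g = (j', i', k', l')" by (cases g)
    \<comment> \<open>The conjugate is found by solving (j, i, k'', l'') g = g x.\<close>
    define k'' where "k'' = k + i' * j - i * j'"
    define l'' where "l'' = l + k' * j + i' * tri j - k'' * j' - i * tri j'"
    have eq: "(j, i, k'', l'') \<otimes>\<^bsub>Gam\<^esub> g = g \<otimes>\<^bsub>Gam\<^esub> x"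
      by (simp add: g xx k''_def l''_def)
    have "(j, i, k'', l'') = (j, i, k'', l'') \<otimes>\<^bsub>Gam\<^esub> g \<otimes>\<^bsub>Gam\<^esub> inv\<^bsub>Gam\<^esub> g"
      using group.inv_solve_right[OF group_Gam] by auto
    then have conj: "g \<otimes>\<^bsub>Gam\<^esub> x \<otimes>\<^bsub>Gam\<^esub> inv\<^bsub>Gam\<^esub> g = (j, i, k'', l'')"
      unfolding eq by (rule HOL.sym)
    have "?p\<^sup>2 dvd (k + ?p * (t * \<gamma> + r * \<alpha>)) + ?p ^ m * (i' * t) - ?p ^ n * (r * j')"
      by (rule dvd_diff[OF dvd_add[OF tr(3)]]) (rule N)+
    then have 1: "?p\<^sup>2 dvd k'' + ?p * (t * \<gamma> + r * \<alpha>)"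
      by (simp add: k''_def tr(1,2) algebra_simps)
    have Tj: "?p dvd tri j" using T tr(1) by simp
    have "?p dvd (l + t * \<delta> + r * \<beta>) + ?p ^ m * (k' * t) + i' * tri j - k'' * j' - ?p ^ n * (r * tri j')"
      by (rule dvd_diff[OF dvd_diff[OF dvd_add[OF dvd_add[OF tr(4)]]]]) (use Tj k[OF 1] N[THEN p2] in simp_all)
    then have "?p dvd l'' + t * \<delta> + r * \<beta>"
      by (simp add: l''_def tr(1,2) algebra_simps)
    with 1 show "g \<otimes>\<^bsub>Gam\<^esub> x \<otimes>\<^bsub>Gam\<^esub> inv\<^bsub>Gam\<^esub> g \<in> Lam p n m q"
      unfolding conj q Lam_iff using tr(1,2) by blast
  qed
qed

lemma hom_Gam_eqI:
  assumes f: "f \<in> hom Gam H" and g: "g \<in> hom Gam H" and H: "group H"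
    and a: "f (0, 1, 0, 0) = g (0, 1, 0, 0)" and b: "f (1, 0, 0, 0) = g (1, 0, 0, 0)"
  shows "f = g"
proof -
  interpret group H by (rule H)
  interpret F: gam_quad H "f (0, 1, 0, 0)" "f (1, 0, 0, 0)" "f (0, 0, 1, 0)" "f (0, 0, 0, 1)"
    by (rule hom_Gam_quad[OF f H])
  interpret G: gam_quad H "g (0, 1, 0, 0)" "g (1, 0, 0, 0)" "g (0, 0, 1, 0)" "g (0, 0, 0, 1)"
    by (rule hom_Gam_quad[OF g H])
  have canc: "z = w" if "x \<otimes>\<^bsub>H\<^esub> y = y \<otimes>\<^bsub>H\<^esub> (x \<otimes>\<^bsub>H\<^esub> z)" "x \<otimes>\<^bsub>H\<^esub> y = y \<otimes>\<^bsub>H\<^esub> (x \<otimes>\<^bsub>H\<^esub> w)"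
    "x \<in> carrier H" "y \<in> carrier H" "z \<in> carrier H" "w \<in> carrier H" for x y z w
    using that by (metis l_cancel m_closed)
  have c: "f (0, 0, 1, 0) = g (0, 0, 1, 0)"
    by (rule canc[OF F.ab]) (use G.ab a b in simp_all)
  have d: "f (0, 0, 0, 1) = g (0, 0, 0, 1)"
    by (rule canc[OF F.cb]) (use G.cb b c in simp_all)
  have "f (j, i, k, l) = g (j, i, k, l)" for j i k l
    unfolding hom_Gam_unfold[OF f H, of j i k l] hom_Gam_unfold[OF g H, of j i k l] a b c d ..
  then show ?thesis by auto
qed

text \<open>The relations of \<open>Gam\<close> and of the generators of \<open>Lam\<close> for
  given elements. No lower bounds on orders are included, so the elements may lie in a further
  quotient.\<close>

definition std :: "('a, 'b) monoid_scheme \<Rightarrow> nat \<Rightarrow> nat \<Rightarrow> nat \<Rightarrow> int \<times> int \<times> int \<times> int \<Rightarrow>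
    'a \<Rightarrow> 'a \<Rightarrow> 'a \<Rightarrow> 'a \<Rightarrow> bool" where
  "std H p n m = (\<lambda>(\<alpha>, \<beta>, \<gamma>, \<delta>) a b c d. gam_quad H a b c d
     \<and> d [^]\<^bsub>H\<^esub> int p = \<one>\<^bsub>H\<^esub> \<and> c [^]\<^bsub>H\<^esub> ((int p)\<^sup>2) = \<one>\<^bsub>H\<^esub>
     \<and> a [^]\<^bsub>H\<^esub> (int p ^ n) = c [^]\<^bsub>H\<^esub> (int p * \<alpha>) \<otimes>\<^bsub>H\<^esub> d [^]\<^bsub>H\<^esub> \<beta>
     \<and> b [^]\<^bsub>H\<^esub> (int p ^ m) = c [^]\<^bsub>H\<^esub> (int p * \<gamma>) \<otimes>\<^bsub>H\<^esub> d [^]\<^bsub>H\<^esub> \<delta>)"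

fun gam_letter :: "letter \<Rightarrow> int \<times> int \<times> int \<times> int" where
  "gam_letter La = (0, 1, 0, 0)" | "gam_letter Lb = (1, 0, 0, 0)"
| "gam_letter Lc = (0, 0, 1, 0)" | "gam_letter Ld = (0, 0, 0, 1)"

lemma word_eval_presented:
  assumes "gens u \<subseteq> S"
  shows "word_eval (presented_group S R) (\<lambda>x. word_class S R (Gen x)) u = word_class S R u"
  using assms
proof (induction u)
  case (GInv u)
  interpret group "presented_group S R" by (rule group_presented_group)
  have "inv\<^bsub>presented_group S R\<^esub> (word_class S R u) = word_class S R (GInv u)"
  proof (rule inv_equality)
    show "word_class S R (GInv u) \<otimes>\<^bsub>presented_group S R\<^esub> word_class S R u = \<one>\<^bsub>presented_group S R\<^esub>"
      using GInv.prems unfolding one_presented_group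
      by (subst mult_presented_group)
        (simp_all add: inverse_gword_def[symmetric] word_class_eqI pres_eq.l_inv)
  qed (use GInv.prems in \<open>auto simp: carrier_presented_group\<close>)
  then show ?case using GInv by simp
next
  case (GMul u v)
  then show ?case
    by (simp add: mult_presented_group times_gword_def)
qed (simp_all add: one_presented_group one_gword_def)

text \<open>Two maps in opposite directions: \<open>sound\<close> yields a homomorphism from
  \<open>Gam\<close> to P that kills N, and \<open>complete\<close> with von Dyck's theorem yields
  one from P to the quotient by N. The element d is existential because it need not be a
  generator.\<close>

lemma presented_kernel:
  fixes S :: "letter set" and R :: "(letter gword \<times> letter gword) set"
  defines "P \<equiv> presented_group S R" and "f \<equiv> \<lambda>x. word_class S R (Gen x)"
  assumes N: "N \<lhd> Gam" and S: "{La, Lb, Lc} \<subseteq> S"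
    and sound: "\<lbrakk>f \<in> S \<rightarrow> carrier P; \<And>u v. \<lbrakk>(u, v) \<in> R; gens u \<subseteq> S; gens v \<subseteq> S\<rbrakk> \<Longrightarrow> word_eval P f u = word_eval P f v\<rbrakk>
      \<Longrightarrow> \<exists>d. gam_quad P (f La) (f Lb) (f Lc) d \<and> (\<forall>x\<in>N. gam_quad.ev P (f La) (f Lb) (f Lc) d x = \<one>\<^bsub>P\<^esub>)
        \<and> (Ld \<in> S \<longrightarrow> d = f Ld)"
    and complete: "\<And>u v. (u, v) \<in> R \<Longrightarrow> word_eval (Gam Mod N) (\<lambda>x. N #>\<^bsub>Gam\<^esub> gam_letter x) u
        = word_eval (Gam Mod N) (\<lambda>x. N #>\<^bsub>Gam\<^esub> gam_letter x) v"
  shows "\<exists>\<psi> \<in> hom Gam P. range \<psi> = carrier P \<and> (\<forall>x. \<psi> x = \<one>\<^bsub>P\<^esub> \<longleftrightarrow> x \<in> N)"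
proof -
  have P: "group P" unfolding P_def by (rule group_presented_group)
  have fS: "f \<in> S \<rightarrow> carrier P"
    by (auto simp: f_def P_def carrier_presented_group)
  have ev: "word_eval P f u = word_class S R u" if "gens u \<subseteq> S" for u
    unfolding P_def f_def by (rule word_eval_presented[OF that])
  have "word_eval P f u = word_eval P f v" if "(u, v) \<in> R" "gens u \<subseteq> S" "gens v \<subseteq> S" for u v
    using that by (simp add: ev word_class_eqI pres_eq.relator)
  then obtain d where quad: "gam_quad P (f La) (f Lb) (f Lc) d" and d: "Ld \<in> S \<Longrightarrow> d = f Ld"
    and ker1: "\<And>x. x \<in> N \<Longrightarrow> gam_quad.ev P (f La) (f Lb) (f Lc) d x = \<one>\<^bsub>P\<^esub>"
    using sound[OF fS] by blast
  interpret gam_quad P "f La" "f Lb" "f Lc" d by (rule quad)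
  interpret ev: group_hom Gam P "ev"
    by (intro group_hom.intro group_hom_axioms.intro group_Gam P ev_hom)
  interpret N: normal N Gam by (rule N)
  define Q where "Q = Gam Mod N"
  have Q: "group Q" unfolding Q_def by (rule N.factorgroup_is_group)
  define \<pi> where "\<pi> = (\<lambda>x. N #>\<^bsub>Gam\<^esub> x)"
  have \<pi>: "\<pi> \<in> hom Gam Q"
    unfolding Q_def \<pi>_def by (rule N.r_coset_hom_Mod)
  interpret \<pi>: group_hom Gam Q \<pi>
    by (intro group_hom.intro group_hom_axioms.intro group_Gam Q \<pi>)
  have ker\<pi>: "\<pi> x = \<one>\<^bsub>Q\<^esub> \<longleftrightarrow> x \<in> N" for x
    unfolding Q_def \<pi>_def using N.mem_rcos_one_iff[of x] by simp
  have "word_eval Q (\<lambda>x. \<pi> (gam_letter x)) u = word_eval Q (\<lambda>x. \<pi> (gam_letter x)) v" if "(u, v) \<in> R" for u v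
    using complete[OF that] unfolding Q_def \<pi>_def .
  then obtain h where h: "h \<in> hom P Q"
    and hev: "\<And>u. gens u \<subseteq> S \<Longrightarrow> h (word_class S R u) = word_eval Q (\<lambda>x. \<pi> (gam_letter x)) u"
    using group.presented_group_hom[OF Q, of "\<lambda>x. \<pi> (gam_letter x)" S R] unfolding P_def by auto
  \<comment> \<open>Both sides agree on a and b, hence everywhere. So an element killed by
    \<open>ev\<close> is killed by the projection and lies in N.\<close>
  have "h \<circ> ev = \<pi>"
  proof (rule hom_Gam_eqI[OF _ \<pi> Q])
    show "h \<circ> ev \<in> hom Gam Q" by (rule Group.hom_compose[OF ev_hom h])
    show "(h \<circ> ev) (0, 1, 0, 0) = \<pi> (0, 1, 0, 0)" "(h \<circ> ev) (1, 0, 0, 0) = \<pi> (1, 0, 0, 0)"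
      using hev[of "Gen La"] hev[of "Gen Lb"] S ev_gens by (simp_all del: ev.simps) (simp_all add: f_def)
  qed
  then have ker2: "x \<in> N" if "ev x = \<one>\<^bsub>P\<^esub>" for x
    using that hom_one[OF h P Q] unfolding ker\<pi>[symmetric] by (metis comp_apply)
  have "carrier P \<subseteq> range ev"
  proof -
    have sub: "subgroup (range ev) P" using ev.img_is_subgroup by simp
    have gen: "f x \<in> range ev" if "x \<in> S" for x
    proof (cases x)
      case La then show ?thesis using ev_gens(1) by (metis rangeI)
    next
      case Lb then show ?thesis using ev_gens(2) by (metis rangeI)
    next
      case Lc then show ?thesis using ev_gens(3) by (metis rangeI)
    next
      case Ld then show ?thesis using ev_gens(4) d that by (metis rangeI)
    qed
    have "word_eval P f u \<in> range ev" if "gens u \<subseteq> S" for u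
      using that
    proof (induction u)
      case GOne then show ?case using subgroup.one_closed[OF sub] by simp
    next
      case (GInv u) then show ?case using subgroup.m_inv_closed[OF sub] by simp
    next
      case (GMul u v) then show ?case using subgroup.m_closed[OF sub] by simp
    qed (simp add: gen)
    moreover have "carrier P = word_class S R ` {u. gens u \<subseteq> S}"
      unfolding P_def by (rule carrier_presented_group)
    ultimately show ?thesis
      by (auto simp: ev simp del: ev.simps)
  qed
  then have "range ev = carrier P" by auto
  then show ?thesis
    using ev_hom ker1 ker2 by blast
qed

text \<open>Leaves only the comparison of two sets of relations: \<open>sound\<close> derives the
  standard ones from R, and \<open>complete\<close> derives R from the standard ones.\<close>

lemma presented_model:
  fixes S :: "letter set" and R :: "(letter gword \<times> letter gword) set"
  defines "P \<equiv> presented_group S R" and "f \<equiv> \<lambda>x. word_class S R (Gen x)"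
  assumes p: "Factorial_Ring.prime p" and nm: "2 \<le> m" "m \<le> n"
    and S: "{La, Lb, Lc} \<subseteq> S"
    and sound: "\<lbrakk>f \<in> S \<rightarrow> carrier P; \<And>u v. \<lbrakk>(u, v) \<in> R; gens u \<subseteq> S; gens v \<subseteq> S\<rbrakk> \<Longrightarrow> word_eval P f u = word_eval P f v\<rbrakk>
      \<Longrightarrow> \<exists>d. std P p n m q (f La) (f Lb) (f Lc) d \<and> (Ld \<in> S \<longrightarrow> d = f Ld)"
    and complete: "\<And>(Q :: (int \<times> int \<times> int \<times> int) set monoid) g u v.
      \<lbrakk>std Q p n m q (g La) (g Lb) (g Lc) (g Ld); (u, v) \<in> R\<rbrakk> \<Longrightarrow> word_eval Q g u = word_eval Q g v"
  shows "model P p n m q"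
  unfolding P_def model_def
proof (rule presented_kernel[OF Lam_normal[OF p nm] S], goal_cases)
  case 1
  obtain \<alpha> \<beta> \<gamma> \<delta> where q: "q = (\<alpha>, \<beta>, \<gamma>, \<delta>)" by (cases q)
  from 1 obtain d where std: "std P p n m q (f La) (f Lb) (f Lc) d" and d: "Ld \<in> S \<longrightarrow> d = f Ld"
    using sound unfolding P_def f_def by blast
  then have "gam_quad P (f La) (f Lb) (f Lc) d" unfolding std_def q by simp
  moreover have "gam_quad.ev P (f La) (f Lb) (f Lc) d x = \<one>\<^bsub>P\<^esub>" if "x \<in> Lam p n m q" for x
    by (rule gam_quad_model(1)[OF _ q _ _ _ _ that]) (use std in \<open>simp_all add: std_def q\<close>)
  ultimately show ?case using d unfolding P_def f_def by blast
next
  case (2 u v)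
  obtain \<alpha> \<beta> \<gamma> \<delta> where q: "q = (\<alpha>, \<beta>, \<gamma>, \<delta>)" by (cases q)
  interpret N: normal "Lam p n m q" Gam
    by (rule Lam_normal[OF p nm])
  define Q where "Q = Gam Mod Lam p n m q"
  have Q: "group Q" unfolding Q_def by (rule N.factorgroup_is_group)
  define \<pi> where "\<pi> = (\<lambda>x. Lam p n m q #>\<^bsub>Gam\<^esub> x)"
  have \<pi>: "\<pi> \<in> hom Gam Q"
    unfolding Q_def \<pi>_def by (rule N.r_coset_hom_Mod)
  interpret \<pi>: group_hom Gam Q \<pi>
    by (intro group_hom.intro group_hom_axioms.intro group_Gam Q \<pi>)
  have ker\<pi>: "\<pi> x = \<one>\<^bsub>Q\<^esub> \<longleftrightarrow> x \<in> Lam p n m q" for x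
    unfolding Q_def \<pi>_def using N.mem_rcos_one_iff[of x] by simp
  have pow: "\<pi> x [^]\<^bsub>Q\<^esub> N = \<pi> (x [^]\<^bsub>Gam\<^esub> N)" for x and N :: int
    by (simp add: \<pi>.hom_int_pow)
  have eqI: "\<pi> u = \<pi> v" if "w \<in> Lam p n m q" "u = w \<otimes>\<^bsub>Gam\<^esub> v" for u v w
    using that by (simp add: ker\<pi>[symmetric] del: mult_Gam)
  have AL: "(0, int p ^ n, - (int p * \<alpha>), - \<beta>) \<in> Lam p n m q"
    unfolding q Lam_iff by (intro exI[of _ 0] exI[of _ 1]) simp
  have BL: "(int p ^ m, 0, - (int p * \<gamma>), - \<delta>) \<in> Lam p n m q"
    unfolding q Lam_iff by (intro exI[of _ 1] exI[of _ 0]) simp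
  have cd: "\<pi> (0, 0, 1, 0) [^]\<^bsub>Q\<^esub> k \<otimes>\<^bsub>Q\<^esub> \<pi> (0, 0, 0, 1) [^]\<^bsub>Q\<^esub> l = \<pi> (0, 0, k, l)" for k l :: int
    unfolding pow Gam_pow_special by (simp flip: \<pi>.hom_mult)
  have p0: "p \<noteq> 0" using p by auto
  have "gam_quad Q (\<pi> (0, 1, 0, 0)) (\<pi> (1, 0, 0, 0)) (\<pi> (0, 0, 1, 0)) (\<pi> (0, 0, 0, 1))"
    by (rule hom_Gam_quad[OF \<pi> Q])
  moreover have "\<pi> (0, 0, 0, 1) [^]\<^bsub>Q\<^esub> int p = \<one>\<^bsub>Q\<^esub>" "\<pi> (0, 0, 1, 0) [^]\<^bsub>Q\<^esub> ((int p)\<^sup>2) = \<one>\<^bsub>Q\<^esub>"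
    unfolding pow Gam_pow_special ker\<pi> by (simp_all add: Lam_central_iff[OF p0])
  moreover have "\<pi> (0, 1, 0, 0) [^]\<^bsub>Q\<^esub> (int p ^ n) = \<pi> (0, 0, int p * \<alpha>, \<beta>)"
    unfolding pow Gam_pow_special by (rule eqI[OF AL]) simp
  moreover have "\<pi> (1, 0, 0, 0) [^]\<^bsub>Q\<^esub> (int p ^ m) = \<pi> (0, 0, int p * \<gamma>, \<delta>)"
    unfolding pow Gam_pow_special by (rule eqI[OF BL]) simp
  ultimately have "std Q p n m q (\<pi> (gam_letter La)) (\<pi> (gam_letter Lb)) (\<pi> (gam_letter Lc)) (\<pi> (gam_letter Ld))"
    unfolding std_def q by (simp add: cd)
  then show ?case
    using complete[of Q "\<lambda>x. \<pi> (gam_letter x)" u v] 2 unfolding Q_def \<pi>_def by blast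
qed

section \<open>Recognizing the relations\<close>

lemma (in group) comm_eq_iff:
  assumes "x \<in> carrier G" "y \<in> carrier G" "z \<in> carrier G"
  shows "inv x \<otimes> inv y \<otimes> x \<otimes> y = z \<longleftrightarrow> x \<otimes> y = y \<otimes> (x \<otimes> z)"
proof -
  have "inv x \<otimes> inv y \<otimes> x \<otimes> y = inv (y \<otimes> x) \<otimes> (x \<otimes> y)"
    using assms by (simp add: inv_mult_group m_assoc)
  then show ?thesis
    using assms by (metis inv_solve_left m_assoc m_closed)
qed

text \<open>What a listed presentation gives at once. Here d is just [c, b], with unknown order and
  not known to be central; the lemmas of the locale extract both from relations between d and the
  powers A, B, C.\<close>

locale pre_quad = group G for G (structure) +
  fixes a b c d and p n m :: nat
  assumes a_closed [simp, intro]: "a \<in> carrier G" and b_closed [simp, intro]: "b \<in> carrier G"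
    and c_closed [simp, intro]: "c \<in> carrier G" and d_closed [simp, intro]: "d \<in> carrier G"
    and ab: "a \<otimes> b = b \<otimes> (a \<otimes> c)" and cb: "c \<otimes> b = b \<otimes> (c \<otimes> d)" and ca: "c \<otimes> a = a \<otimes> c"
    and p: "Factorial_Ring.prime p" and nm: "2 \<le> m" "m \<le> n"
begin

definition A where "A = a [^] (int p ^ n)"
definition B where "B = b [^] (int p ^ m)"
definition C where "C = c [^] int p"

lemma ABC_closed [simp, intro]: "A \<in> carrier G" "B \<in> carrier G" "C \<in> carrier G"
  by (simp_all add: A_def B_def C_def)

lemma int_pow_dvd_one:
  assumes "x [^] int p = \<one>" "int p dvd k" "x \<in> carrier G"
  shows "x [^] k = \<one>"
  using assms by (auto simp: int_pow_pow[symmetric] elim!: dvdE)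

lemma c_pow_one:
  assumes "C [^] int p = \<one>" "(int p)\<^sup>2 dvd k"
  shows "c [^] k = \<one>"
  using assms by (auto simp: C_def int_pow_pow power2_eq_square elim!: dvdE)
    (metis c_closed int_pow_one int_pow_pow mult.assoc)

lemma int_pow_minus_one:
  assumes "x [^] (k - 1 :: int) = \<one>" "x \<in> carrier G"
  shows "x [^] k = x"
  using int_pow_mult[of x "k - 1" 1] assms by simp

lemma psq: "(int p)\<^sup>2 dvd int p ^ n" "(int p)\<^sup>2 dvd int p ^ m"
  using nm by (auto intro: prime_sq_dvd_power)

lemma commute_mult:
  assumes "x \<otimes> z = z \<otimes> x" "y \<otimes> z = z \<otimes> y" "x \<in> carrier G" "y \<in> carrier G" "z \<in> carrier G"
  shows "(x \<otimes> y) \<otimes> z = z \<otimes> (x \<otimes> y)"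
  using assms by (metis m_assoc)

lemma commute_pow1:
  assumes "x \<otimes> y = y \<otimes> x" "x \<in> carrier G" "y \<in> carrier G"
  shows "x [^] (i::int) \<otimes> y = y \<otimes> x [^] i"
  using commute_int_pow[OF assms, of i 1] assms by simp

lemma commute_inv:
  assumes "x \<otimes> y = y \<otimes> x" "x \<in> carrier G" "y \<in> carrier G"
  shows "inv x \<otimes> y = y \<otimes> inv x"
  using commute_pow1[OF assms, of "- 1"] assms by (simp add: int_pow_neg)

text \<open>As z is the commutator of x and y, it commutes with whatever commutes with both.\<close>

lemma commute_comm:
  assumes "x \<otimes> y = y \<otimes> (x \<otimes> z)" "x \<otimes> w = w \<otimes> x" "y \<otimes> w = w \<otimes> y"
    "x \<in> carrier G" "y \<in> carrier G" "z \<in> carrier G" "w \<in> carrier G"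
  shows "z \<otimes> w = w \<otimes> z"
proof -
  have "z = inv x \<otimes> inv y \<otimes> x \<otimes> y"
    using comm_eq_iff[of x y z] assms by simp
  moreover have "(inv x \<otimes> inv y \<otimes> x \<otimes> y) \<otimes> w = w \<otimes> (inv x \<otimes> inv y \<otimes> x \<otimes> y)"
    using assms by (intro commute_mult commute_inv) simp_all
  ultimately show ?thesis by simp
qed

text \<open>That d commutes with c comes for free, since c = [a, b].\<close>

lemma quadI:
  assumes da: "d \<otimes> a = a \<otimes> d" and db: "d \<otimes> b = b \<otimes> d"
  shows "gam_quad G a b c d"
proof -
  have "c \<otimes> d = d \<otimes> c"
    using commute_comm[OF ab da[symmetric] db[symmetric]] by simp
  then show ?thesis
    using da db by unfold_locales (simp_all add: ab cb ca)
qed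

lemma stdI:
  assumes "gam_quad G a b c d" "d [^] int p = \<one>" "C [^] int p = \<one>"
    "A = C [^] \<alpha> \<otimes> d [^] \<beta>" "B = C [^] \<gamma> \<otimes> d [^] \<delta>"
  shows "std G p n m (\<alpha>, \<beta>, \<gamma>, \<delta>) a b c d"
  using assms unfolding std_def A_def B_def C_def by (simp add: int_pow_pow power2_eq_square)

lemma cA: "c \<otimes> A = A \<otimes> c" and CA: "C \<otimes> A = A \<otimes> C"
  using commute_int_pow[OF ca, of 1 "int p ^ n"] commute_int_pow[OF ca, of "int p" "int p ^ n"]
  by (simp_all add: A_def C_def)

lemma aA: "A \<otimes> a = a \<otimes> A" and bB: "B \<otimes> b = b \<otimes> B" and cC: "C \<otimes> c = c \<otimes> C" and aC: "C \<otimes> a = a \<otimes> C"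
  unfolding A_def B_def C_def by (simp_all add: commute_pow1 ca)

text \<open>Conjugation by b takes a to a c and so A to A c^(p^n), where p^2 divides p^n.\<close>

lemma A_b:
  assumes "C [^] int p = \<one>"
  shows "A \<otimes> b = b \<otimes> A"
proof -
  have "A \<otimes> b = b \<otimes> (a \<otimes> c) [^] (int p ^ n)"
    unfolding A_def by (rule conj_int_pow[OF ab]) simp_all
  also have "\<dots> = b \<otimes> (A \<otimes> c [^] (int p ^ n))"
    using int_pow_mult_distrib[OF ca[symmetric]] by (simp add: A_def)
  finally show ?thesis
    using c_pow_one[OF assms psq(1)] by simp
qed

text \<open>Conjugation by b takes c to c d and so C to C d^p.\<close>

lemma C_b:
  assumes "d \<otimes> c = c \<otimes> d" "d [^] int p = \<one>"
  shows "C \<otimes> b = b \<otimes> C"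
proof -
  have "C \<otimes> b = b \<otimes> (c \<otimes> d) [^] int p"
    unfolding C_def by (rule conj_int_pow[OF cb]) simp_all
  also have "\<dots> = b \<otimes> (C \<otimes> d [^] int p)"
    using int_pow_mult_distrib[OF assms(1)[symmetric]] by (simp add: C_def)
  finally show ?thesis
    using assms by simp
qed

text \<open>The order of the deductions matters: A and C, hence d, commute with a and with c; then
  \<open>C_b\<close> applies, and A and C, hence d, commute with b.\<close>

lemma quad_AC:
  assumes d: "d = A [^] (u::int) \<otimes> C [^] (v::int)" and "d [^] int p = \<one>" "C [^] int p = \<one>"
  shows "gam_quad G a b c d"
proof (rule quadI)
  show "d \<otimes> a = a \<otimes> d"
    unfolding d by (intro commute_mult commute_pow1 aA aC) simp_all
  have "d \<otimes> c = c \<otimes> d"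
    unfolding d by (intro commute_mult commute_pow1 cA[symmetric] cC) simp_all
  then have "C \<otimes> b = b \<otimes> C"
    using assms by (intro C_b)
  then show "d \<otimes> b = b \<otimes> d"
    unfolding d by (intro commute_mult commute_pow1 A_b assms) simp_all
qed

lemma c_bpow:
  assumes db: "d \<otimes> b = b \<otimes> d"
  shows "c \<otimes> b [^] (N::nat) = b [^] N \<otimes> (c \<otimes> d [^] N)"
proof (induction N)
  case (Suc N)
  have db': "d [^] N \<otimes> b = b \<otimes> d [^] N"
    using commute_pow1[OF db, of "int N"] by (simp add: int_pow_int)
  have "c \<otimes> b [^] Suc N = (c \<otimes> b [^] N) \<otimes> b"
    by (simp add: m_assoc)
  also have "\<dots> = b [^] N \<otimes> (c \<otimes> (d [^] N \<otimes> b))"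
    unfolding Suc by (simp add: m_assoc)
  also have "\<dots> = b [^] N \<otimes> (c \<otimes> b \<otimes> d [^] N)"
    unfolding db' by (simp add: m_assoc)
  also have "\<dots> = b [^] Suc N \<otimes> (c \<otimes> d [^] Suc N)"
    unfolding cb nat_pow_Suc2[OF d_closed] by (simp add: m_assoc)
  finally show ?case .
qed simp

lemma a_bpow:
  assumes db: "d \<otimes> b = b \<otimes> d" and dc: "d \<otimes> c = c \<otimes> d"
  shows "a \<otimes> b [^] (N::nat) = b [^] N \<otimes> (a \<otimes> (c [^] N \<otimes> d [^] tri (int N)))"
proof (induction N)
  case (Suc N)
  have T: "tri (int (Suc N)) = int N + tri (int N)"
    by (simp add: tri_add)
  have db': "d [^] tri (int N) \<otimes> b = b \<otimes> d [^] tri (int N)"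
    using commute_pow1[OF db] by simp
  have cb': "c [^] N \<otimes> b = b \<otimes> (c [^] N \<otimes> d [^] int N)"
    using conj_int_pow[OF cb, of "int N"] int_pow_mult_distrib[OF dc[symmetric], of "int N"]
    by (simp add: int_pow_int)
  have "a \<otimes> b [^] Suc N = (a \<otimes> b [^] N) \<otimes> b"
    by (simp add: m_assoc)
  also have "\<dots> = b [^] N \<otimes> (a \<otimes> (c [^] N \<otimes> (d [^] tri (int N) \<otimes> b)))"
    unfolding Suc by (simp add: m_assoc)
  also have "\<dots> = b [^] N \<otimes> (a \<otimes> (c [^] N \<otimes> b \<otimes> d [^] tri (int N)))"
    unfolding db' by (simp add: m_assoc)
  also have "\<dots> = b [^] N \<otimes> (a \<otimes> b \<otimes> (c [^] N \<otimes> (d [^] int N \<otimes> d [^] tri (int N))))"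
    unfolding cb' by (simp add: m_assoc)
  also have "\<dots> = b [^] Suc N \<otimes> (a \<otimes> (c [^] Suc N \<otimes> d [^] tri (int (Suc N))))"
    unfolding ab T int_pow_mult[OF d_closed] nat_pow_Suc2[OF c_closed] by (simp add: m_assoc)
  finally show ?case .
qed simp

lemma B_nat: "B = b [^] (p ^ m)"
  unfolding B_def by (metis int_pow_int of_nat_power)

text \<open>The commutator of c and B is d^(p^m).\<close>

lemma c_B:
  assumes db: "d \<otimes> b = b \<otimes> d" and "d [^] int p = \<one>"
  shows "B \<otimes> c = c \<otimes> B"
proof -
  have "d [^] (int (p ^ m)) = \<one>"
    by (rule int_pow_dvd_one) (use assms nm in \<open>simp_all add: dvd_power\<close>)
  then have dN: "d [^] (p ^ m) = \<one>" by (simp only: int_pow_int)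
  have "c \<otimes> B = B \<otimes> (c \<otimes> \<one>)"
    using c_bpow[OF db, of "p ^ m"] unfolding dN B_nat .
  also have "\<dots> = B \<otimes> c" by simp
  finally show ?thesis by (rule HOL.sym)
qed

text \<open>The commutator of a and B is c^(p^m) d^(\<open>tri\<close> (p^m)), and p^2 and p divide
  the two exponents.\<close>

lemma a_B:
  assumes db: "d \<otimes> b = b \<otimes> d" and dc: "d \<otimes> c = c \<otimes> d" and "d [^] int p = \<one>" "C [^] int p = \<one>"
  shows "B \<otimes> a = a \<otimes> B"
proof -
  have "c [^] (int (p ^ m)) = \<one>"
    by (rule c_pow_one) (use assms psq in simp_all)
  then have cN: "c [^] (p ^ m) = \<one>" by (simp only: int_pow_int)
  have dN: "d [^] tri (int (p ^ m)) = \<one>"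
    by (rule int_pow_dvd_one) (use assms prime_dvd_tri_power(1)[OF p nm(1)] in simp_all)
  have "a \<otimes> B = B \<otimes> (a \<otimes> (\<one> \<otimes> \<one>))"
    using a_bpow[OF db dc, of "p ^ m"] unfolding cN dN B_nat .
  also have "\<dots> = B \<otimes> a" by simp
  finally show ?thesis by (rule HOL.sym)
qed

text \<open>Here the deduction starts from b: A and B, hence d, commute with b; by
  \<open>c_B\<close> then B and d commute with c; by \<open>a_B\<close> finally B and d commute with
  a.\<close>

lemma quad_AB:
  assumes d: "d = A [^] (u::int) \<otimes> B [^] (v::int)" and dp: "d [^] int p = \<one>" and C: "C [^] int p = \<one>"
  shows "gam_quad G a b c d"
proof -
  have db: "d \<otimes> b = b \<otimes> d"
    unfolding d by (intro commute_mult commute_pow1 A_b bB C) simp_all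
  have dc: "d \<otimes> c = c \<otimes> d"
    using c_B[OF db dp] unfolding d by (intro commute_mult commute_pow1 cA[symmetric]) simp_all
  have "d \<otimes> a = a \<otimes> d"
    using a_B[OF db dc dp C] unfolding d by (intro commute_mult commute_pow1 aA) simp_all
  then show ?thesis using db by (rule quadI)
qed

lemma std_d:
  assumes "d \<otimes> a = a \<otimes> d" "d \<otimes> b = b \<otimes> d" "d [^] int p = \<one>" "C [^] int p = \<one>" "A = C [^] \<alpha>" "B = C [^] \<gamma>"
  shows "std G p n m (\<alpha>, 0, \<gamma>, 0) a b c d"
  using assms by (intro stdI quadI) simp_all

text \<open>The order of c has to be derived. As d = B^(-1) commutes with b, B commutes with c and
  C; so A = C B^(-s) commutes with B, and C^p = A^p B^(s p) = 1.\<close>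

lemma std_L1:
  assumes A: "A [^] int p = \<one>" and B: "B [^] int p = \<one>" and C: "C = A \<otimes> B [^] (s::int)" and dB: "inv d = B"
  shows "std G p n m (1, s, 0, -1) a b c d"
proof -
  have d: "d = inv B" using dB by (metis d_closed inv_inv)
  have d': "d = B [^] (- 1 :: int)" using d by (simp add: int_pow_neg)
  have dp: "d [^] int p = \<one>" using B by (simp add: d int_pow_inv)
  have db: "d \<otimes> b = b \<otimes> d" unfolding d' by (rule commute_pow1[OF bB]) simp_all
  have "B \<otimes> C = C \<otimes> B"
    unfolding C_def using commute_pow1[OF c_B[OF db dp, symmetric]] by simp
  then have BC: "C \<otimes> B = B \<otimes> C" by (rule HOL.sym)
  have AC: "A = C \<otimes> inv (B [^] s)"
    using inv_solve_right[of A C "B [^] s"] C by simp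
  also have "\<dots> = C \<otimes> B [^] (- s)" by (simp add: int_pow_neg)
  finally have "A \<otimes> B = B \<otimes> A"
    using commute_mult[OF BC, of "B [^] (- s)"] commute_pow1[of B B] by simp
  then have "A \<otimes> B [^] s = B [^] s \<otimes> A"
    using commute_pow1[of B A s] by simp
  then have Xp: "C [^] int p = \<one>"
    using A B by (simp add: C int_pow_mult_distrib int_pow_pow mult.commute[of s])
      (simp add: int_pow_pow[symmetric])
  have "gam_quad G a b c d"
    using quad_AB[of 0 "- 1"] dp Xp d' by simp
  moreover have "A = C \<otimes> d [^] s"
    using AC by (simp add: d int_pow_inv)
  ultimately show ?thesis
    using dp Xp by (intro stdI) (simp_all add: d int_pow_neg)
qed

text \<open>Since A and C commute, d is (C A^(-1))^t, and raising to the inverse t' of t gives A = C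
  d^(-t').\<close>

lemma std_L2:
  assumes A: "A [^] int p = \<one>" and B: "B = \<one>" and C: "C [^] int p = \<one>"
    and d: "d = C [^] (t::int) \<otimes> inv (A [^] t)" and t: "int p dvd t * t' - 1"
  shows "std G p n m (1, - t', 0, 0) a b c d"
proof -
  have CA': "C [^] u \<otimes> A [^] v = A [^] v \<otimes> C [^] u" for u v :: int
    by (rule commute_int_pow[OF CA]) simp_all
  have d': "d = A [^] (- t) \<otimes> C [^] t"
    unfolding d using CA'[of t "- t"] by (simp add: int_pow_neg)
  have dk: "d [^] k = A [^] (- t * k) \<otimes> C [^] (t * k)" for k :: int
    unfolding d' by (subst int_pow_mult_distrib[OF CA'[symmetric]]) (simp_all add: int_pow_pow)
  have dp: "d [^] int p = \<one>"
    unfolding dk using A C by (simp add: int_pow_dvd_one)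
  have "A [^] (t * t' - 1) = \<one>" "C [^] (1 - t * t') = \<one>"
    using t A C by (auto intro!: int_pow_dvd_one simp: dvd_diff_commute)
  then have "A [^] (t * t') = A" "C \<otimes> C [^] (- (t * t')) = \<one>"
    using int_pow_minus_one[of A "t * t'"] int_pow_mult[of C 1 "- (t * t')"] by simp_all
  then have "d [^] (- t') = C [^] (- (t * t')) \<otimes> A"
    unfolding dk using CA'[of "- (t * t')" 1] by simp
  then have "C \<otimes> d [^] (- t') = (C \<otimes> C [^] (- (t * t'))) \<otimes> A"
    by (simp add: m_assoc)
  also have "\<dots> = A"
    by (simp only: \<open>C \<otimes> C [^] (- (t * t')) = \<one>\<close> l_one ABC_closed)
  finally have "A = C \<otimes> d [^] (- t')" by (rule HOL.sym)
  then show ?thesis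
    using dp C B d' by (intro stdI quad_AC[of "- t" t]) simp_all
qed

text \<open>With t' inverse to \<nu>, the relation for d^(-1) is solved as A = d^(-t'). The exponent
  g is 1 for (L4) and 0 for (L5).\<close>

lemma std_L4:
  assumes A: "A [^] int p = \<one>" and C: "C [^] int p = \<one>" and B: "B = C [^] (g::int)"
    and d: "inv d = A [^] (\<nu>::int)" and t: "int p dvd \<nu> * t' - 1"
  shows "std G p n m (0, - t', g, 0) a b c d"
proof -
  have d': "d = A [^] (- \<nu>)"
    using d by (metis ABC_closed(1) d_closed int_pow_neg inv_inv)
  have dp: "d [^] int p = \<one>"
    unfolding d' using A by (simp add: int_pow_pow int_pow_dvd_one)
  have "A [^] (\<nu> * t' - 1) = \<one>"
    using t A by (simp add: int_pow_dvd_one)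
  then have "A [^] (\<nu> * t') = A"
    by (rule int_pow_minus_one) simp
  then have "A = d [^] (- t')"
    unfolding d' by (simp add: int_pow_pow)
  then show ?thesis
    using dp C B d' by (intro stdI quad_AC[of "- \<nu>" 0]) simp_all
qed

text \<open>For d = C B^(-1) the deduction is started by the relation between B and a: B commutes
  with a and b, hence with c = [a, b] and with C. This gives d^p = 1 and d c = c d, and
  \<open>C_b\<close> does the rest.\<close>

lemma std_L6:
  assumes A: "A = \<one>" and Bp: "B [^] int p = \<one>" and C: "C [^] int p = \<one>"
    and d: "d = C \<otimes> inv B" and Ba: "B \<otimes> a = a \<otimes> B"
  shows "std G p n m (0, 0, 1, -1) a b c d"
proof -
  have cB: "c \<otimes> B = B \<otimes> c"
    using commute_comm[OF ab Ba[symmetric] bB[symmetric]] by simp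
  have CB: "C \<otimes> B = B \<otimes> C"
    unfolding C_def using commute_pow1[OF cB] by simp
  have dp: "d [^] int p = \<one>"
    unfolding d using commute_inv[OF CB[symmetric]] C Bp
    by (subst int_pow_mult_distrib) (simp_all add: int_pow_inv)
  have "d \<otimes> c = c \<otimes> d"
    unfolding d using cC commute_inv[OF cB[symmetric]] by (intro commute_mult) simp_all
  then have "C \<otimes> b = b \<otimes> C" using dp by (rule C_b)
  then have "d \<otimes> b = b \<otimes> d"
    unfolding d using commute_inv[OF bB] by (intro commute_mult) simp_all
  moreover have "d \<otimes> a = a \<otimes> d"
    unfolding d using aC commute_inv[OF Ba] by (intro commute_mult) simp_all
  moreover have "B = C \<otimes> inv d"
  proof -
    have "C \<otimes> inv d = C \<otimes> B \<otimes> inv C"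
      unfolding d by (simp add: inv_mult_group m_assoc)
    also have "\<dots> = B"
      unfolding CB by (simp add: m_assoc)
    finally show ?thesis by simp
  qed
  ultimately show ?thesis
    using A C dp by (intro stdI quadI) (simp_all add: int_pow_neg)
qed

text \<open>With t' inverse to v, the relation d = B^v is solved as B = d^t'. Type (L8) has v = t' =
  -1; (K4) and (K10) have v = t' = 1.\<close>

lemma std_L8:
  assumes A: "A = C [^] (g::int)" and Bp: "B [^] int p = \<one>" and C: "C [^] int p = \<one>"
    and d: "d = B [^] (v::int)" and t: "int p dvd v * t' - 1"
  shows "std G p n m (g, 0, 0, t') a b c d"
proof -
  have dp: "d [^] int p = \<one>"
    unfolding d using Bp by (simp add: int_pow_pow int_pow_dvd_one)
  have "B [^] (v * t' - 1) = \<one>"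
    using t Bp by (simp add: int_pow_dvd_one)
  then have "B [^] (v * t') = B"
    by (rule int_pow_minus_one) simp
  then have "B = d [^] t'"
    unfolding d by (simp add: int_pow_pow)
  then show ?thesis
    using dp C A d by (intro stdI quad_AB[of 0 v]) simp_all
qed

text \<open>Here d is A itself, so \<open>quad_AC\<close> applies; g = 0 gives (K7) and g = 1 gives
  (K8).\<close>

lemma std_L7:
  assumes "A [^] int p = \<one>" and "C [^] int p = \<one>" and "B = C [^] (g::int)" and "d = A"
  shows "std G p n m (0, 1, g, 0) a b c d"
  using assms by (intro stdI quad_AC[of 1 0]) simp_all

text \<open>For p = 2 the element A is its own inverse, so d = A B is solved as B = A d = C
  d.\<close>

lemma std_K6:
  assumes p2: "p = 2" and A: "A [^] int p = \<one>" and Bp: "B [^] int p = \<one>" and C: "C = A" and d: "d = A \<otimes> B"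
  shows "std G p n m (1, 0, 1, 1) a b c d"
proof -
  have Xp: "C [^] int p = \<one>" using A C by simp
  have "A \<otimes> b = b \<otimes> A" by (rule A_b[OF Xp])
  then have "A \<otimes> B = B \<otimes> A"
    unfolding B_def using commute_pow1[of b A] by simp
  then have dp: "d [^] int p = \<one>"
    unfolding d using A Bp by (subst int_pow_mult_distrib) simp_all
  have "A \<otimes> A = \<one>"
  proof -
    have "A \<otimes> A = A [^] (1 + 1 :: int)" by (simp only: int_pow_mult int_pow_1 ABC_closed)
    also have "1 + 1 = int p" using p2 by simp
    finally show ?thesis using A by simp
  qed
  then have "B = A \<otimes> d"
    unfolding d by (simp add: m_assoc[symmetric])
  then show ?thesis
    using dp Xp C by (intro stdI quad_AB[of 1 1]) (simp_all add: d)
qed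

text \<open>For p = 2 the element C is its own inverse, so d = A C is solved as A = C d; g = 0 gives
  (K1) and g = 1 gives (K2).\<close>

lemma std_K2:
  assumes p2: "p = 2" and A: "A [^] int p = \<one>" and C: "C [^] int p = \<one>" and d: "d = A \<otimes> C" and B: "B = C [^] (g::int)"
  shows "std G p n m (1, 1, g, 0) a b c d"
proof -
  have dp: "d [^] int p = \<one>"
    unfolding d using A C CA by (subst int_pow_mult_distrib) simp_all
  have "C \<otimes> C = \<one>"
  proof -
    have "C \<otimes> C = C [^] (1 + 1 :: int)" by (simp only: int_pow_mult int_pow_1 ABC_closed)
    also have "1 + 1 = int p" using p2 by simp
    finally show ?thesis using C by simp
  qed
  then have "A = C \<otimes> d"
    unfolding d CA[symmetric] by (simp add: m_assoc[symmetric])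
  then show ?thesis
    using dp C B by (intro stdI quad_AC[of 1 1]) (simp_all add: d)
qed

end

section \<open>Powers of the generators and exponent arithmetic\<close>

context pre_quad
begin

lemma A_pow: "a [^] (p ^ n * k) = A [^] int k" "a [^] (p ^ n) = A" "a [^] (k * p ^ n) = A [^] int k"
  and B_pow: "b [^] (p ^ m * k) = B [^] int k" "b [^] (p ^ m) = B" "b [^] (k * p ^ m) = B [^] int k"
  and C_pow: "c [^] (p * k) = C [^] int k" "c [^] p = C" "c [^] (k * p) = C [^] int k"
proof -
  have *: "x [^] (N * k) = (x [^] int N) [^] int k" if "x \<in> carrier G" for x N k
    using that by (simp add: int_pow_pow flip: int_pow_int)
  show "a [^] (p ^ n * k) = A [^] int k" "b [^] (p ^ m * k) = B [^] int k" "c [^] (p * k) = C [^] int k"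
    unfolding A_def B_def C_def by (simp_all add: *)
  then show "a [^] (k * p ^ n) = A [^] int k" "b [^] (k * p ^ m) = B [^] int k" "c [^] (k * p) = C [^] int k"
    by (simp_all add: mult.commute)
  show "a [^] (p ^ n) = A" "b [^] (p ^ m) = B" "c [^] p = C"
    unfolding A_def B_def C_def by (simp_all flip: int_pow_int)
qed

lemma ABC_pow: "a [^] (p ^ (n + 1)) = A [^] int p" "b [^] (p ^ (m + 1)) = B [^] int p" "c [^] (p ^ 2) = C [^] int p"
  using A_pow(1)[of p] B_pow(1)[of p] C_pow(1)[of p] by (simp_all add: mult.commute power2_eq_square)

lemma ABC_pow2:
  assumes "p = 2"
  shows "n = 2 \<Longrightarrow> a [^] (8::nat) = A [^] int p" "n = 2 \<Longrightarrow> a [^] (4::nat) = A"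
    "m = 2 \<Longrightarrow> b [^] (8::nat) = B [^] int p" "m = 2 \<Longrightarrow> b [^] (4::nat) = B"
    "c [^] (4::nat) = C [^] int p" "c [^] (2::nat) = C"
  using ABC_pow A_pow(2) B_pow(2) C_pow(2) assms by simp_all

end

text \<open>The setting for \<open>complete\<close>: once the standard relations hold, A, B, C and d
  all have the form \<open>D k l\<close>, and relators are checked by computing with exponents
  modulo p.\<close>

locale std_quad = gam_quad G a b c d + pre_quad G a b c d p n m
  for G (structure) and a b c d p n m +
  fixes \<alpha> \<beta> \<gamma> \<delta> :: int
  assumes std: "std G p n m (\<alpha>, \<beta>, \<gamma>, \<delta>) a b c d"
begin

definition D :: "int \<Rightarrow> int \<Rightarrow> 'a" where "D k l = C [^] k \<otimes> d [^] l"

lemma D_ev: "D k l = ev (0, 0, int p * k, l)"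
  by (simp add: D_def C_def int_pow_pow)

lemma dp: "d [^] int p = \<one>" and Cp: "C [^] int p = \<one>" and A_D: "A = D \<alpha> \<beta>" and B_D: "B = D \<gamma> \<delta>"
  and C_D: "C = D 1 0" and d_D: "d = D 0 1" and one_D: "\<one> = D 0 0"
  using std unfolding std_def by (simp_all add: A_def B_def C_def D_def int_pow_pow power2_eq_square)

lemma D_mult: "D k l \<otimes> D k' l' = D (k + k') (l + l')"
  unfolding D_ev ev_mult[symmetric] by (simp add: algebra_simps)

lemma D_closed [simp]: "D k l \<in> carrier G"
  by (simp add: D_def)

lemma D_inv: "inv (D k l) = D (- k) (- l)"
  by (rule inv_equality) (simp_all add: D_mult flip: one_D)

lemma D_pow: "D k l [^] (z::int) = D (k * z) (l * z)"
proof -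
  have nat: "D k l [^] (z::nat) = D (k * int z) (l * int z)" for z
    by (induction z) (simp_all add: D_mult algebra_simps flip: one_D)
  show ?thesis
    by (cases z rule: int_cases2) (simp_all add: int_pow_int int_pow_neg_int nat D_inv)
qed

lemma D_eqI: "\<lbrakk>int p dvd k - k'; int p dvd l - l'\<rbrakk> \<Longrightarrow> D k l = D k' l'"
proof -
  assume "int p dvd k - k'" "int p dvd l - l'"
  then have "D (k - k') (l - l') = \<one>"
    using dp Cp by (simp add: D_def int_pow_dvd_one)
  then have "D (k - k') (l - l') \<otimes> D k' l' = D k' l'"
    by simp
  then show ?thesis by (simp add: D_mult)
qed

lemma D_eq_d: "\<lbrakk>int p dvd k; int p dvd l - 1\<rbrakk> \<Longrightarrow> D k l = d"
  using D_eqI[of k 0 l 1] d_D by simp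

lemma dinv_D: "inv d = D 0 (- 1)"
  using D_inv[of 0 1] d_D by simp

lemmas D_simps = A_D B_D C_D one_D dinv_D D_mult D_inv D_pow

lemma ABp: "A [^] int p = \<one>" "B [^] int p = \<one>"
  unfolding D_simps by (auto intro: D_eqI)

end

lemma std_quadI:
  assumes "std G p n m (\<alpha>, \<beta>, \<gamma>, \<delta>) a b c d" "Factorial_Ring.prime p" "2 \<le> m" "m \<le> n"
  shows "std_quad G a b c d p n m \<alpha> \<beta> \<gamma> \<delta>"
proof -
  interpret gam_quad G a b c d using assms unfolding std_def by simp
  show ?thesis
    by unfold_locales (use assms ab cb ca in auto)
qed

section \<open>Evaluation of relators and models of presentations\<close>

lemma word_eval_simps:
  "word_eval G f 1 = \<one>\<^bsub>G\<^esub>" "word_eval G f (u * v) = word_eval G f u \<otimes>\<^bsub>G\<^esub> word_eval G f v"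
  "word_eval G f (inverse u) = inv\<^bsub>G\<^esub> word_eval G f u"
  by (simp_all add: one_gword_def times_gword_def inverse_gword_def)

lemma (in group) word_eval_pow:
  "f x \<in> carrier G \<Longrightarrow> word_eval G f (Gen x ^ k) = f x [^] k"
  by (induction k) (simp_all add: word_eval_simps, metis nat_pow_Suc nat_pow_Suc2)

lemma (in group) word_eval_comm:
  "word_eval G f (comm u v) = inv word_eval G f u \<otimes> inv word_eval G f v \<otimes> word_eval G f u \<otimes> word_eval G f v"
  by (simp add: comm_def word_eval_simps)

lemma (in group) word_eval_comm_eq_iff:
  assumes "f x \<in> carrier G" "f y \<in> carrier G" "z \<in> carrier G"
  shows "word_eval G f (comm (Gen x) (Gen y)) = z \<longleftrightarrow> f x \<otimes> f y = f y \<otimes> (f x \<otimes> z)"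
  using assms by (simp add: word_eval_comm comm_eq_iff)

text \<open>In a presentation without the letter \<open>d\<close>, the commutator \<open>[c, b]\<close> takes its place.\<close>

lemma abc_model:
  assumes p: "Factorial_Ring.prime p" and nm: "2 \<le> m" "m \<le> n"
    and R: "R = insert (comm \<aa> \<bb> \<doteq> \<cc>) (insert (comm \<cc> \<aa> \<doteq> 1) R')"
    and gens: "\<forall>(u, v) \<in> R'. gens u \<subseteq> {La, Lb, Lc} \<and> gens v \<subseteq> {La, Lb, Lc}"
    and sound: "\<And>(P :: letter gword set monoid) f d. \<lbrakk>pre_quad P (f La) (f Lb) (f Lc) d p n m;
        word_eval P f (comm \<cc> \<bb>) = d; word_eval P f (comm \<bb> \<cc>) = inv\<^bsub>P\<^esub> d;
        \<forall>(u, v) \<in> R'. word_eval P f u = word_eval P f v\<rbrakk> \<Longrightarrow> std P p n m (\<alpha>, \<beta>, \<gamma>, \<delta>) (f La) (f Lb) (f Lc) d"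
    and complete: "\<And>(Q :: (int \<times> int \<times> int \<times> int) set monoid) f.
       \<lbrakk>std_quad Q (f La) (f Lb) (f Lc) (f Ld) p n m \<alpha> \<beta> \<gamma> \<delta>;
        word_eval Q f (comm \<cc> \<bb>) = f Ld; word_eval Q f (comm \<bb> \<cc>) = inv\<^bsub>Q\<^esub> (f Ld)\<rbrakk>
       \<Longrightarrow> \<forall>(u, v) \<in> R'. word_eval Q f u = word_eval Q f v"
  shows "model (pres_abc R) p n m (\<alpha>, \<beta>, \<gamma>, \<delta>)"
proof (rule presented_model[OF p nm])
  let ?P = "pres_abc R" and ?f = "\<lambda>x. word_class {La, Lb, Lc} R (Gen x)"
  assume f: "?f \<in> {La, Lb, Lc} \<rightarrow> carrier ?P"
    and rel: "\<And>u v. \<lbrakk>(u, v) \<in> R; gens u \<subseteq> {La, Lb, Lc}; gens v \<subseteq> {La, Lb, Lc}\<rbrakk>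
      \<Longrightarrow> word_eval ?P ?f u = word_eval ?P ?f v"
  interpret group ?P by (rule group_presented_group)
  define f where "f = ?f"
  have cl: "f La \<in> carrier ?P" "f Lb \<in> carrier ?P" "f Lc \<in> carrier ?P"
    using f unfolding f_def by auto
  define d where "d = word_eval ?P f (comm \<cc> \<bb>)"
  have d: "d \<in> carrier ?P" unfolding d_def using cl by (simp add: word_eval_comm)
  have "word_eval ?P f (comm \<aa> \<bb>) = word_eval ?P f \<cc>" "word_eval ?P f (comm \<cc> \<aa>) = word_eval ?P f 1"
    unfolding f_def by (rule rel; simp add: R comm_def)+
  then have "f La \<otimes>\<^bsub>?P\<^esub> f Lb = f Lb \<otimes>\<^bsub>?P\<^esub> (f La \<otimes>\<^bsub>?P\<^esub> f Lc)" "f Lc \<otimes>\<^bsub>?P\<^esub> f La = f La \<otimes>\<^bsub>?P\<^esub> f Lc"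
    using cl by (simp_all add: word_eval_comm_eq_iff word_eval_simps)
  moreover have "f Lc \<otimes>\<^bsub>?P\<^esub> f Lb = f Lb \<otimes>\<^bsub>?P\<^esub> (f Lc \<otimes>\<^bsub>?P\<^esub> d)"
    using cl d d_def comm_eq_iff[of "f Lc" "f Lb" d] by (simp add: word_eval_comm)
  ultimately have pq: "pre_quad ?P (f La) (f Lb) (f Lc) d p n m"
    by unfold_locales (use cl d p nm in simp_all)
  have "word_eval ?P f (comm \<bb> \<cc>) = inv\<^bsub>?P\<^esub> d"
    unfolding d_def using cl by (simp add: word_eval_comm inv_mult_group m_assoc)
  moreover have "\<forall>(u, v) \<in> R'. word_eval ?P f u = word_eval ?P f v"
  proof clarify
    fix u v assume "(u, v) \<in> R'"
    then show "word_eval ?P f u = word_eval ?P f v"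
      unfolding f_def using gens by (intro rel) (auto simp: R)
  qed
  ultimately have "std ?P p n m (\<alpha>, \<beta>, \<gamma>, \<delta>) (f La) (f Lb) (f Lc) d"
    using pq d_def by (intro sound) simp_all
  then show "\<exists>d. std ?P p n m (\<alpha>, \<beta>, \<gamma>, \<delta>) (?f La) (?f Lb) (?f Lc) d \<and> (Ld \<in> {La, Lb, Lc} \<longrightarrow> d = ?f Ld)"
    unfolding f_def by auto
next
  fix Q :: "(int \<times> int \<times> int \<times> int) set monoid" and g u v
  assume std: "std Q p n m (\<alpha>, \<beta>, \<gamma>, \<delta>) (g La) (g Lb) (g Lc) (g Ld)" and "(u, v) \<in> R"
  interpret std_quad Q "g La" "g Lb" "g Lc" "g Ld" p n m \<alpha> \<beta> \<gamma> \<delta>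
    by (rule std_quadI[OF std p nm])
  have cb1: "word_eval Q g (comm \<cc> \<bb>) = g Ld"
    using cb by (simp add: word_eval_comm comm_eq_iff)
  have "word_eval Q g (comm \<bb> \<cc>) = inv\<^bsub>Q\<^esub> word_eval Q g (comm \<cc> \<bb>)"
    by (simp add: word_eval_comm inv_mult_group m_assoc)
  then have "\<forall>(u, v) \<in> R'. word_eval Q g u = word_eval Q g v"
    using cb1 by (intro complete std_quad_axioms) simp_all
  moreover have "word_eval Q g (comm \<aa> \<bb>) = word_eval Q g \<cc>" "word_eval Q g (comm \<cc> \<aa>) = word_eval Q g 1"
    using ab ca by (simp_all add: word_eval_comm_eq_iff word_eval_simps)
  ultimately show "word_eval Q g u = word_eval Q g v"
    using \<open>(u, v) \<in> R\<close> by (auto simp: R)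
qed simp

text \<open>Order and centrality of d are among the relators here, so only c^p, a^(p^n) and b^(p^m)
  remain to be examined, and the latter two are powers of the first.\<close>

lemma abcd_model:
  assumes p: "Factorial_Ring.prime p" and nm: "2 \<le> m" "m \<le> n"
    and R: "R = {comm \<aa> \<bb> \<doteq> \<cc>, comm \<cc> \<aa> \<doteq> 1, comm \<cc> \<bb> \<doteq> \<dd>, comm \<dd> \<aa> \<doteq> 1, comm \<dd> \<bb> \<doteq> 1, \<dd> ^ p \<doteq> 1} \<union> R'"
    and gens: "\<forall>(u, v) \<in> R'. gens u \<subseteq> {La, Lb, Lc, Ld} \<and> gens v \<subseteq> {La, Lb, Lc, Ld}"
    and sound: "\<And>(P :: letter gword set monoid) f. \<lbrakk>pre_quad P (f La) (f Lb) (f Lc) (f Ld) p n m;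
        \<forall>(u, v) \<in> R'. word_eval P f u = word_eval P f v\<rbrakk>
        \<Longrightarrow> pre_quad.C P (f Lc) p [^]\<^bsub>P\<^esub> int p = \<one>\<^bsub>P\<^esub>
          \<and> pre_quad.A P (f La) p n = pre_quad.C P (f Lc) p [^]\<^bsub>P\<^esub> \<alpha>
          \<and> pre_quad.B P (f Lb) p m = pre_quad.C P (f Lc) p [^]\<^bsub>P\<^esub> \<gamma>"
    and complete: "\<And>(Q :: (int \<times> int \<times> int \<times> int) set monoid) f.
       std_quad Q (f La) (f Lb) (f Lc) (f Ld) p n m \<alpha> 0 \<gamma> 0
       \<Longrightarrow> \<forall>(u, v) \<in> R'. word_eval Q f u = word_eval Q f v"
  shows "model (pres_abcd R) p n m (\<alpha>, 0, \<gamma>, 0)"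
proof (rule presented_model[OF p nm])
  let ?S = "{La, Lb, Lc, Ld}"
  let ?P = "pres_abcd R" and ?f = "\<lambda>x. word_class ?S R (Gen x)"
  assume f: "?f \<in> ?S \<rightarrow> carrier ?P"
    and rel: "\<And>u v. \<lbrakk>(u, v) \<in> R; gens u \<subseteq> ?S; gens v \<subseteq> ?S\<rbrakk> \<Longrightarrow> word_eval ?P ?f u = word_eval ?P ?f v"
  interpret group ?P by (rule group_presented_group)
  define f where "f = ?f"
  have cl: "f La \<in> carrier ?P" "f Lb \<in> carrier ?P" "f Lc \<in> carrier ?P" "f Ld \<in> carrier ?P"
    using f unfolding f_def by auto
  have gp: "gens (\<dd> ^ k) \<subseteq> ?S" for k by (induction k) simp_all
  have "word_eval ?P f (comm \<aa> \<bb>) = word_eval ?P f \<cc>" "word_eval ?P f (comm \<cc> \<aa>) = word_eval ?P f 1"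
    "word_eval ?P f (comm \<cc> \<bb>) = word_eval ?P f \<dd>"
    "word_eval ?P f (comm \<dd> \<aa>) = word_eval ?P f 1" "word_eval ?P f (comm \<dd> \<bb>) = word_eval ?P f 1"
    "word_eval ?P f (\<dd> ^ p) = word_eval ?P f 1"
    unfolding f_def by (rule rel; use gp in \<open>simp add: R comm_def\<close>)+
  then have r: "f La \<otimes>\<^bsub>?P\<^esub> f Lb = f Lb \<otimes>\<^bsub>?P\<^esub> (f La \<otimes>\<^bsub>?P\<^esub> f Lc)" "f Lc \<otimes>\<^bsub>?P\<^esub> f La = f La \<otimes>\<^bsub>?P\<^esub> f Lc"
    "f Lc \<otimes>\<^bsub>?P\<^esub> f Lb = f Lb \<otimes>\<^bsub>?P\<^esub> (f Lc \<otimes>\<^bsub>?P\<^esub> f Ld)"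
    "f Ld \<otimes>\<^bsub>?P\<^esub> f La = f La \<otimes>\<^bsub>?P\<^esub> f Ld" "f Ld \<otimes>\<^bsub>?P\<^esub> f Lb = f Lb \<otimes>\<^bsub>?P\<^esub> f Ld"
    "f Ld [^]\<^bsub>?P\<^esub> int p = \<one>\<^bsub>?P\<^esub>"
    using cl by (simp_all add: word_eval_comm_eq_iff word_eval_simps word_eval_pow int_pow_int)
  interpret pre_quad ?P "f La" "f Lb" "f Lc" "f Ld" p n m
    by unfold_locales (use cl p nm r in simp_all)
  have "\<forall>(u, v) \<in> R'. word_eval ?P f u = word_eval ?P f v"
  proof clarify
    fix u v assume "(u, v) \<in> R'"
    then show "word_eval ?P f u = word_eval ?P f v"
      unfolding f_def using gens by (intro rel) (auto simp: R)
  qed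
  then have "std ?P p n m (\<alpha>, 0, \<gamma>, 0) (f La) (f Lb) (f Lc) (f Ld)"
    using sound[OF pre_quad_axioms] r by (intro std_d) simp_all
  then show "\<exists>d. std ?P p n m (\<alpha>, 0, \<gamma>, 0) (?f La) (?f Lb) (?f Lc) d \<and> (Ld \<in> ?S \<longrightarrow> d = ?f Ld)"
    unfolding f_def by auto
next
  fix Q :: "(int \<times> int \<times> int \<times> int) set monoid" and g u v
  assume std: "std Q p n m (\<alpha>, 0, \<gamma>, 0) (g La) (g Lb) (g Lc) (g Ld)" and "(u, v) \<in> R"
  interpret std_quad Q "g La" "g Lb" "g Lc" "g Ld" p n m \<alpha> 0 \<gamma> 0
    by (rule std_quadI[OF std p nm])
  have "\<forall>(u, v) \<in> R'. word_eval Q g u = word_eval Q g v"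
    by (rule complete[OF std_quad_axioms])
  moreover have "word_eval Q g (comm \<aa> \<bb>) = word_eval Q g \<cc>" "word_eval Q g (comm \<cc> \<aa>) = word_eval Q g 1"
    "word_eval Q g (comm \<cc> \<bb>) = word_eval Q g \<dd>"
    "word_eval Q g (comm \<dd> \<aa>) = word_eval Q g 1" "word_eval Q g (comm \<dd> \<bb>) = word_eval Q g 1"
    "word_eval Q g (\<dd> ^ p) = word_eval Q g 1"
    using ab ca cb da db dp by (simp_all add: word_eval_comm_eq_iff word_eval_simps word_eval_pow flip: int_pow_int)
  ultimately show "word_eval Q g u = word_eval Q g v"
    using \<open>(u, v) \<in> R\<close> by (auto simp: R)
qed simp


lemma gens_pow [simp]: "gens (u ^ k :: 'g gword) = (if k = 0 then {} else gens u)"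
  by (induction k) auto

lemma gens_comm [simp]: "gens (comm u v) = gens u \<union> gens v"
  by (auto simp: comm_def)

text \<open>Fermat's little theorem. For p = 2 the power is 1, which is right because t is
  odd.\<close>

lemma prime_power_inverse:
  assumes "Factorial_Ring.prime p" "\<not> p dvd t"
  shows "int p dvd int t * int t ^ (p - 2) - 1"
proof -
  have "p \<ge> 2" using assms by (simp add: prime_ge_2_nat)
  have "[t ^ (p - 1) = 1] (mod p)"
    using fermat_theorem assms by blast
  then have "[int t ^ (p - 1) = 1] (mod int p)"
    by (metis cong_int_iff of_nat_1 of_nat_power)
  moreover have "int t ^ (p - 1) = int t * int t ^ (p - 2)"
    using \<open>p \<ge> 2\<close> by (metis Suc_1 Suc_diff_Suc less_eq_Suc_le not_less_eq_eq numeral_2_eq_2 power_Suc le_SucI diff_Suc_1 diff_Suc_eq_diff_pred)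
  ultimately show ?thesis
    by (simp add: cong_iff_dvd_diff)
qed

lemmas (in pre_quad) wsimps = word_eval_simps word_eval_pow A_pow B_pow C_pow ABC_pow

section \<open>Parameters of the types (L)\<close>

context
  fixes p n m :: nat
  assumes p: "Factorial_Ring.prime p" and nm: "2 \<le> m" "m \<le> n"
begin

lemma model_L1:
  "model (listed_group p (L1 n m s)) p n m (1, int s, 0, -1)"
  unfolding listed_group.simps
\<comment> \<open>The set R' collects the relators other than [a, b] = c and [c, a] = 1, which
  \<open>abc_model\<close> treats once and for all.\<close>
proof (rule abc_model[OF p nm, where R' = "{\<aa> ^ (p ^ (n + 1)) \<doteq> 1, \<bb> ^ (p ^ (m + 1)) \<doteq> 1, \<cc> ^ p \<doteq> \<aa> ^ (p ^ n) * \<bb> ^ (s * p ^ m), comm \<bb> \<cc> \<doteq> \<bb> ^ (p ^ m)}"], blast, simp, goal_cases)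
  case (1 P f d)
  interpret pre_quad P "f La" "f Lb" "f Lc" d p n m by (fact 1)
  show ?case
    using 1(2-) by (intro std_L1) (simp_all add: wsimps)
next
  case (2 Q f)
  interpret std_quad Q "f La" "f Lb" "f Lc" "f Ld" p n m "1" "int s" "0" "-1" by (fact 2)
  show ?case
    using 2(2-) ABp Cp by (simp add: wsimps) (simp add: D_simps)
qed

lemma model_L2:
  assumes "\<not> p dvd t"
  shows "model (listed_group p (L2 n m t)) p n m (1, - (int t ^ (p - 2)), 0, 0)"
  unfolding listed_group.simps
proof (rule abc_model[OF p nm, where R' = "{\<aa> ^ (p ^ (n + 1)) \<doteq> 1, \<bb> ^ (p ^ m) \<doteq> 1, \<cc> ^ (p ^ 2) \<doteq> 1, comm \<cc> \<bb> \<doteq> \<cc> ^ (t * p) * inverse (\<aa> ^ (t * p ^ n))}"], blast, simp, goal_cases)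
  case (1 P f d)
  interpret pre_quad P "f La" "f Lb" "f Lc" d p n m by (fact 1)
  show ?case
    using 1(2-) by (intro std_L2[OF _ _ _ _ prime_power_inverse[OF p assms]]) (simp_all add: wsimps)
next
  case (2 Q f)
  interpret std_quad Q "f La" "f Lb" "f Lc" "f Ld" p n m "1" "- (int t ^ (p - 2))" "0" "0" by (fact 2)
  \<comment> \<open>The two factors are c^(t p) and the inverse of a^(t p^n). Their powers of c
    cancel, and d is left with exponent t^(p-2) t, which is 1 modulo p.\<close>
  have "D (int t) 0 \<otimes>\<^bsub>Q\<^esub> D (- int t) (int t ^ (p - 2) * int t) = f Ld"
    unfolding D_mult using prime_power_inverse[OF p assms] by (intro D_eq_d) (simp_all add: mult.commute)
  then show ?case
    using 2(2-) ABp Cp by (simp add: wsimps) (simp add: D_simps)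
qed

lemma model_L3: "model (listed_group p (L3 n m)) p n m (1, 0, 0, 0)"
  unfolding listed_group.simps
proof (rule abcd_model[OF p nm, where R' = "{\<aa> ^ (p ^ (n + 1)) \<doteq> 1, \<bb> ^ (p ^ m) \<doteq> 1, \<cc> ^ p \<doteq> \<aa> ^ (p ^ n)}"], blast, simp, goal_cases)
  case (1 P f)
  interpret pre_quad P "f La" "f Lb" "f Lc" "f Ld" p n m by (fact 1)
  show ?case
    using 1(2-) by (simp add: wsimps)
next
  case (2 Q f)
  interpret std_quad Q "f La" "f Lb" "f Lc" "f Ld" p n m 1 0 0 0 by (fact 2)
  show ?case
    using ABp Cp by (simp add: wsimps) (simp add: D_simps)
qed

lemma model_L4:
  assumes "\<not> p dvd \<nu>"
  shows "model (listed_group p (L4 n m \<nu>)) p n m (0, - (int \<nu> ^ (p - 2)), 1, 0)"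
  unfolding listed_group.simps
proof (rule abc_model[OF p nm, where R' = "{\<aa> ^ (p ^ (n + 1)) \<doteq> 1, \<bb> ^ (p ^ (m + 1)) \<doteq> 1, \<cc> ^ p \<doteq> \<bb> ^ (p ^ m), comm \<bb> \<cc> \<doteq> \<aa> ^ (\<nu> * p ^ n)}"], blast, simp, goal_cases)
  case (1 P f d)
  interpret pre_quad P "f La" "f Lb" "f Lc" d p n m by (fact 1)
  show ?case
    using 1(2-) by (intro std_L4[OF _ _ _ _ prime_power_inverse[OF p assms]]) (simp_all add: wsimps)
next
  case (2 Q f)
  interpret std_quad Q "f La" "f Lb" "f Lc" "f Ld" p n m "0" "- (int \<nu> ^ (p - 2))" "1" "0" by (fact 2)
  have "D 0 (- (int \<nu> ^ (p - 2) * int \<nu>)) = D 0 (- 1)"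
    using prime_power_inverse[OF p assms] by (intro D_eqI) (simp_all add: mult.commute dvd_diff_commute)
  then show ?case
    using 2(2-) ABp Cp by (simp add: wsimps) (simp add: D_simps)
qed

lemma model_L5:
  assumes "\<not> p dvd \<nu>"
  shows "model (listed_group p (L5 n m \<nu>)) p n m (0, - (int \<nu> ^ (p - 2)), 0, 0)"
  unfolding listed_group.simps
proof (rule abc_model[OF p nm, where R' = "{\<aa> ^ (p ^ (n + 1)) \<doteq> 1, \<bb> ^ (p ^ m) \<doteq> 1, \<cc> ^ (p ^ 2) \<doteq> 1, comm \<bb> \<cc> \<doteq> \<aa> ^ (\<nu> * p ^ n)}"], blast, simp, goal_cases)
  case (1 P f d)
  interpret pre_quad P "f La" "f Lb" "f Lc" d p n m by (fact 1)
  show ?case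
    using 1(2-) by (intro std_L4[OF _ _ _ _ prime_power_inverse[OF p assms]]) (simp_all add: wsimps)
next
  case (2 Q f)
  interpret std_quad Q "f La" "f Lb" "f Lc" "f Ld" p n m "0" "- (int \<nu> ^ (p - 2))" "0" "0" by (fact 2)
  have "D 0 (- (int \<nu> ^ (p - 2) * int \<nu>)) = D 0 (- 1)"
    using prime_power_inverse[OF p assms] by (intro D_eqI) (simp_all add: mult.commute dvd_diff_commute)
  then show ?case
    using 2(2-) ABp Cp by (simp add: wsimps) (simp add: D_simps)
qed

lemma model_L6:
  "model (listed_group p (L6 n m)) p n m (0, 0, 1, -1)"
  unfolding listed_group.simps
proof (rule abc_model[OF p nm, where R' = "{\<aa> ^ (p ^ n) \<doteq> 1, \<bb> ^ (p ^ (m + 1)) \<doteq> 1, \<cc> ^ (p ^ 2) \<doteq> 1, comm \<cc> \<bb> \<doteq> \<cc> ^ p * inverse (\<bb> ^ (p ^ m)), comm (\<bb> ^ (p ^ m)) \<aa> \<doteq> 1}"], blast, simp, goal_cases)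
  case (1 P f d)
  interpret pre_quad P "f La" "f Lb" "f Lc" d p n m by (fact 1)
  show ?case
    using 1(2-) by (intro std_L6) (simp_all add: wsimps word_eval_comm[of f "_ ^ _"] comm_eq_iff)
next
  case (2 Q f)
  interpret std_quad Q "f La" "f Lb" "f Lc" "f Ld" p n m "0" "0" "1" "-1" by (fact 2)
  have "D 0 0 = \<one>\<^bsub>Q\<^esub>" "D 0 1 = f Ld" by (simp_all flip: one_D d_D)
  moreover have "B \<otimes>\<^bsub>Q\<^esub> f La = f La \<otimes>\<^bsub>Q\<^esub> B"
    using commute_inv[OF da] by (simp add: aC B_D D_def int_pow_neg commute_mult)
  ultimately show ?case
    using 2(2-) ABp Cp by (simp add: wsimps word_eval_comm[of f "_ ^ _"] comm_eq_iff) (simp add: D_simps)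
qed

lemma model_L7: "model (listed_group p (L7 n m)) p n m (0, 0, 1, 0)"
  unfolding listed_group.simps
proof (rule abcd_model[OF p nm, where R' = "{\<aa> ^ (p ^ n) \<doteq> 1, \<bb> ^ (p ^ (m + 1)) \<doteq> 1, \<cc> ^ p \<doteq> \<bb> ^ (p ^ m)}"], blast, simp, goal_cases)
  case (1 P f)
  interpret pre_quad P "f La" "f Lb" "f Lc" "f Ld" p n m by (fact 1)
  show ?case
    using 1(2-) by (simp add: wsimps)
next
  case (2 Q f)
  interpret std_quad Q "f La" "f Lb" "f Lc" "f Ld" p n m 0 0 1 0 by (fact 2)
  show ?case
    using ABp Cp by (simp add: wsimps) (simp add: D_simps)
qed

lemma model_L8:
  "model (listed_group p (L8 n m)) p n m (0, 0, 0, -1)"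
  unfolding listed_group.simps
proof (rule abc_model[OF p nm, where R' = "{\<aa> ^ (p ^ n) \<doteq> 1, \<bb> ^ (p ^ (m + 1)) \<doteq> 1, \<cc> ^ (p ^ 2) \<doteq> 1, comm \<bb> \<cc> \<doteq> \<bb> ^ (p ^ m)}"], blast, simp, goal_cases)
  case (1 P f d)
  interpret pre_quad P "f La" "f Lb" "f Lc" d p n m by (fact 1)
  have "inv\<^bsub>P\<^esub> d = B" using 1(2-) by (simp add: wsimps)
  then have "d = inv\<^bsub>P\<^esub> B" by (metis d_closed inv_inv)
  then show ?case
    using 1(2-) by (intro std_L8[of 0 "- 1" "- 1"]) (simp_all add: wsimps int_pow_neg)
next
  case (2 Q f)
  interpret std_quad Q "f La" "f Lb" "f Lc" "f Ld" p n m "0" "0" "0" "-1" by (fact 2)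
  show ?case
    using 2(2-) ABp Cp by (simp add: wsimps) (simp add: D_simps)
qed

lemma model_L9: "model (listed_group p (L9 n m)) p n m (0, 0, 0, 0)"
  unfolding listed_group.simps
proof (rule abcd_model[OF p nm, where R' = "{\<aa> ^ (p ^ n) \<doteq> 1, \<bb> ^ (p ^ m) \<doteq> 1, \<cc> ^ (p ^ 2) \<doteq> 1}"], blast, simp, goal_cases)
  case (1 P f)
  interpret pre_quad P "f La" "f Lb" "f Lc" "f Ld" p n m by (fact 1)
  show ?case
    using 1(2-) by (simp add: wsimps)
next
  case (2 Q f)
  interpret std_quad Q "f La" "f Lb" "f Lc" "f Ld" p n m 0 0 0 0 by (fact 2)
  show ?case
    using ABp Cp by (simp add: wsimps) (simp add: D_simps)
qed

end

section \<open>Parameters of the types (K)\<close>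

lemma model_K1:
  "model (listed_group p K1) 2 2 2 (1, 1, 0, 0)"
  unfolding listed_group.simps
proof (rule abc_model[OF two_is_prime_nat order.refl order.refl, where R' = "{\<aa> ^ 8 \<doteq> 1, \<bb> ^ 4 \<doteq> 1, \<cc> ^ 4 \<doteq> 1, comm \<cc> \<bb> \<doteq> \<cc> ^ 2 * \<aa> ^ 4}"], blast, simp, goal_cases)
  case (1 P f d)
  interpret pre_quad P "f La" "f Lb" "f Lc" d 2 2 2 by (fact 1)
  show ?case
    using 1(2-) by (intro std_K2) (simp_all add: wsimps ABC_pow2 CA)
next
  case (2 Q f)
  interpret std_quad Q "f La" "f Lb" "f Lc" "f Ld" 2 2 2 "1" "1" "0" "0" by (fact 2)
  have "D 1 0 \<otimes>\<^bsub>Q\<^esub> D 1 1 = f Ld"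
    unfolding D_mult by (rule D_eq_d) simp_all
  then show ?case
    using 2(2-) ABp Cp by (simp add: wsimps ABC_pow2) (simp add: D_simps)
qed

lemma model_K2:
  "model (listed_group p K2) 2 2 2 (1, 1, 1, 0)"
  unfolding listed_group.simps
proof (rule abc_model[OF two_is_prime_nat order.refl order.refl, where R' = "{\<aa> ^ 8 \<doteq> 1, \<bb> ^ 8 \<doteq> 1, \<cc> ^ 2 \<doteq> \<bb> ^ 4, comm \<cc> \<bb> \<doteq> \<aa> ^ 4 * \<bb> ^ 4}"], blast, simp, goal_cases)
  case (1 P f d)
  interpret pre_quad P "f La" "f Lb" "f Lc" d 2 2 2 by (fact 1)
  show ?case
    \<comment> \<open>By the relation c^2 = b^4, the element a^4 b^4 is A C, the form that
      \<open>std_K2\<close> requires.\<close>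
    using 1(2-) by (intro std_K2) (simp_all add: wsimps ABC_pow2 CA)
next
  case (2 Q f)
  interpret std_quad Q "f La" "f Lb" "f Lc" "f Ld" 2 2 2 "1" "1" "1" "0" by (fact 2)
  have "D 1 1 \<otimes>\<^bsub>Q\<^esub> D 1 0 = f Ld"
    unfolding D_mult by (rule D_eq_d) simp_all
  then show ?case
    using 2(2-) ABp Cp by (simp add: wsimps ABC_pow2) (simp add: D_simps)
qed

lemma model_K3: "model (listed_group p K3) 2 2 2 (1, 0, 0, 0)"
  unfolding listed_group.simps
proof (rule abcd_model[OF two_is_prime_nat order.refl order.refl, where R' = "{\<aa> ^ 8 \<doteq> 1, \<bb> ^ 4 \<doteq> 1, \<cc> ^ 2 \<doteq> \<aa> ^ 4}"], blast, simp, goal_cases)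
  case (1 P f)
  interpret pre_quad P "f La" "f Lb" "f Lc" "f Ld" 2 2 2 by (fact 1)
  show ?case
    using 1(2-) by (simp add: wsimps ABC_pow2)
next
  case (2 Q f)
  interpret std_quad Q "f La" "f Lb" "f Lc" "f Ld" 2 2 2 1 0 0 0 by (fact 2)
  show ?case
    using ABp Cp by (simp add: wsimps ABC_pow2) (simp add: D_simps)
qed

lemma model_K4:
  "model (listed_group p K4) 2 2 2 (1, 0, 0, 1)"
  unfolding listed_group.simps
proof (rule abc_model[OF two_is_prime_nat order.refl order.refl, where R' = "{\<aa> ^ 8 \<doteq> 1, \<bb> ^ 8 \<doteq> 1, \<cc> ^ 2 \<doteq> \<aa> ^ 4, comm \<cc> \<bb> \<doteq> \<bb> ^ 4}"], blast, simp, goal_cases)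
  case (1 P f d)
  interpret pre_quad P "f La" "f Lb" "f Lc" d 2 2 2 by (fact 1)
  show ?case
    using 1(2-) by (intro std_L8[of 1 1 1]) (simp_all add: wsimps ABC_pow2 CA)
next
  case (2 Q f)
  interpret std_quad Q "f La" "f Lb" "f Lc" "f Ld" 2 2 2 "1" "0" "0" "1" by (fact 2)
  have "D 0 0 \<otimes>\<^bsub>Q\<^esub> D 0 1 = f Ld"
    unfolding D_mult by (rule D_eq_d) simp_all
  then show ?case
    using 2(2-) ABp Cp by (simp add: wsimps ABC_pow2) (simp add: D_simps)
qed

lemma model_K5: "model (listed_group p K5) 2 2 2 (1, 0, 1, 0)"
  unfolding listed_group.simps
proof (rule abcd_model[OF two_is_prime_nat order.refl order.refl, where R' = "{\<aa> ^ 8 \<doteq> 1, \<bb> ^ 4 \<doteq> \<cc> ^ 2, \<cc> ^ 2 \<doteq> \<aa> ^ 4}"], blast, simp, goal_cases)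
  case (1 P f)
  interpret pre_quad P "f La" "f Lb" "f Lc" "f Ld" 2 2 2 by (fact 1)
  show ?case
    using 1(2-) by (simp add: wsimps ABC_pow2)
next
  case (2 Q f)
  interpret std_quad Q "f La" "f Lb" "f Lc" "f Ld" 2 2 2 1 0 1 0 by (fact 2)
  show ?case
    using ABp Cp by (simp add: wsimps ABC_pow2) (simp add: D_simps)
qed

lemma model_K6:
  "model (listed_group p K6) 2 2 2 (1, 0, 1, 1)"
  unfolding listed_group.simps
proof (rule abc_model[OF two_is_prime_nat order.refl order.refl, where R' = "{\<aa> ^ 8 \<doteq> 1, \<bb> ^ 8 \<doteq> 1, \<cc> ^ 2 \<doteq> \<aa> ^ 4, comm \<cc> \<bb> \<doteq> \<aa> ^ 4 * \<bb> ^ 4}"], blast, simp, goal_cases)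
  case (1 P f d)
  interpret pre_quad P "f La" "f Lb" "f Lc" d 2 2 2 by (fact 1)
  show ?case
    using 1(2-) by (intro std_K6) (simp_all add: wsimps ABC_pow2 CA)
next
  case (2 Q f)
  interpret std_quad Q "f La" "f Lb" "f Lc" "f Ld" 2 2 2 "1" "0" "1" "1" by (fact 2)
  have "D 1 0 \<otimes>\<^bsub>Q\<^esub> D 1 1 = f Ld"
    unfolding D_mult by (rule D_eq_d) simp_all
  then show ?case
    using 2(2-) ABp Cp by (simp add: wsimps ABC_pow2) (simp add: D_simps)
qed

lemma model_K7:
  "model (listed_group p K7) 2 2 2 (0, 1, 0, 0)"
  unfolding listed_group.simps
proof (rule abc_model[OF two_is_prime_nat order.refl order.refl, where R' = "{\<aa> ^ 8 \<doteq> 1, \<bb> ^ 4 \<doteq> 1, \<cc> ^ 4 \<doteq> 1, comm \<cc> \<bb> \<doteq> \<aa> ^ 4}"], blast, simp, goal_cases)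
  case (1 P f d)
  interpret pre_quad P "f La" "f Lb" "f Lc" d 2 2 2 by (fact 1)
  show ?case
    using 1(2-) by (intro std_L7) (simp_all add: wsimps ABC_pow2 CA)
next
  case (2 Q f)
  interpret std_quad Q "f La" "f Lb" "f Lc" "f Ld" 2 2 2 "0" "1" "0" "0" by (fact 2)
  have "D 0 0 \<otimes>\<^bsub>Q\<^esub> D 0 1 = f Ld"
    unfolding D_mult by (rule D_eq_d) simp_all
  then show ?case
    using 2(2-) ABp Cp by (simp add: wsimps ABC_pow2) (simp add: D_simps)
qed

lemma model_K8:
  "model (listed_group p K8) 2 2 2 (0, 1, 1, 0)"
  unfolding listed_group.simps
proof (rule abc_model[OF two_is_prime_nat order.refl order.refl, where R' = "{\<aa> ^ 8 \<doteq> 1, \<bb> ^ 8 \<doteq> 1, \<cc> ^ 2 \<doteq> \<bb> ^ 4, comm \<cc> \<bb> \<doteq> \<aa> ^ 4}"], blast, simp, goal_cases)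
  case (1 P f d)
  interpret pre_quad P "f La" "f Lb" "f Lc" d 2 2 2 by (fact 1)
  show ?case
    using 1(2-) by (intro std_L7) (simp_all add: wsimps ABC_pow2 CA)
next
  case (2 Q f)
  interpret std_quad Q "f La" "f Lb" "f Lc" "f Ld" 2 2 2 "0" "1" "1" "0" by (fact 2)
  have "D 0 0 \<otimes>\<^bsub>Q\<^esub> D 0 1 = f Ld"
    unfolding D_mult by (rule D_eq_d) simp_all
  then show ?case
    using 2(2-) ABp Cp by (simp add: wsimps ABC_pow2) (simp add: D_simps)
qed

lemma model_K9: "model (listed_group p K9) 2 2 2 (0, 0, 0, 0)"
  unfolding listed_group.simps
proof (rule abcd_model[OF two_is_prime_nat order.refl order.refl, where R' = "{\<aa> ^ 4 \<doteq> 1, \<bb> ^ 4 \<doteq> 1, \<cc> ^ 4 \<doteq> 1}"], blast, simp, goal_cases)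
  case (1 P f)
  interpret pre_quad P "f La" "f Lb" "f Lc" "f Ld" 2 2 2 by (fact 1)
  show ?case
    using 1(2-) by (simp add: wsimps ABC_pow2)
next
  case (2 Q f)
  interpret std_quad Q "f La" "f Lb" "f Lc" "f Ld" 2 2 2 0 0 0 0 by (fact 2)
  show ?case
    using ABp Cp by (simp add: wsimps ABC_pow2) (simp add: D_simps)
qed

lemma model_K10:
  "model (listed_group p K10) 2 2 2 (0, 0, 0, 1)"
  unfolding listed_group.simps
proof (rule abc_model[OF two_is_prime_nat order.refl order.refl, where R' = "{\<aa> ^ 4 \<doteq> 1, \<bb> ^ 8 \<doteq> 1, \<cc> ^ 4 \<doteq> 1, comm \<cc> \<bb> \<doteq> \<bb> ^ 4}"], blast, simp, goal_cases)
  case (1 P f d)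
  interpret pre_quad P "f La" "f Lb" "f Lc" d 2 2 2 by (fact 1)
  show ?case
    using 1(2-) by (intro std_L8[of 0 1 1]) (simp_all add: wsimps ABC_pow2 CA)
next
  case (2 Q f)
  interpret std_quad Q "f La" "f Lb" "f Lc" "f Ld" 2 2 2 "0" "0" "0" "1" by (fact 2)
  have "D 0 0 \<otimes>\<^bsub>Q\<^esub> D 0 1 = f Ld"
    unfolding D_mult by (rule D_eq_d) simp_all
  then show ?case
    using 2(2-) ABp Cp by (simp add: wsimps ABC_pow2) (simp add: D_simps)
qed

section \<open>The parameters of the listed groups\<close>

text \<open>The exponents (n, m) of the quotient M_p(n, m, 1); the types (K) all have n = m =
  2.\<close>

primrec dims :: "label \<Rightarrow> nat \<times> nat" where
  "dims K1 = (2, 2)" | "dims K2 = (2, 2)" | "dims K3 = (2, 2)" | "dims K4 = (2, 2)" | "dims K5 = (2, 2)"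
| "dims K6 = (2, 2)" | "dims K7 = (2, 2)" | "dims K8 = (2, 2)" | "dims K9 = (2, 2)" | "dims K10 = (2, 2)"
| "dims (L1 n m s) = (n, m)" | "dims (L2 n m t) = (n, m)" | "dims (L3 n m) = (n, m)"
| "dims (L4 n m \<nu>) = (n, m)" | "dims (L5 n m \<nu>) = (n, m)" | "dims (L6 n m) = (n, m)"
| "dims (L7 n m) = (n, m)" | "dims (L8 n m) = (n, m)" | "dims (L9 n m) = (n, m)"

text \<open>Where the paper writes an inverse modulo \<open>p\<close>, the power with exponent \<open>p - 2\<close> is used;
  for \<open>p = 2\<close> it is \<open>1\<close>.\<close>

primrec params :: "nat \<Rightarrow> label \<Rightarrow> int \<times> int \<times> int \<times> int" where
  "params p K1 = (1, 1, 0, 0)" | "params p K2 = (1, 1, 1, 0)" | "params p K3 = (1, 0, 0, 0)"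
| "params p K4 = (1, 0, 0, 1)" | "params p K5 = (1, 0, 1, 0)" | "params p K6 = (1, 0, 1, 1)"
| "params p K7 = (0, 1, 0, 0)" | "params p K8 = (0, 1, 1, 0)" | "params p K9 = (0, 0, 0, 0)"
| "params p K10 = (0, 0, 0, 1)"
| "params p (L1 n m s) = (1, int s, 0, -1)" | "params p (L2 n m t) = (1, - (int t ^ (p - 2)), 0, 0)"
| "params p (L3 n m) = (1, 0, 0, 0)" | "params p (L4 n m \<nu>) = (0, - (int \<nu> ^ (p - 2)), 1, 0)"
| "params p (L5 n m \<nu>) = (0, - (int \<nu> ^ (p - 2)), 0, 0)" | "params p (L6 n m) = (0, 0, 1, -1)"
| "params p (L7 n m) = (0, 0, 1, 0)" | "params p (L8 n m) = (0, 0, 0, -1)" | "params p (L9 n m) = (0, 0, 0, 0)"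

text \<open>Zero is a square, so a non-residue is not divisible by p.\<close>

lemma nu_values_not_dvd:
  assumes "Factorial_Ring.prime p" "p \<noteq> 2 \<Longrightarrow> \<nu>\<^sub>0 < p \<and> \<not> QuadRes (int p) (int \<nu>\<^sub>0)" "\<nu> \<in> nu_values p \<nu>\<^sub>0"
  shows "\<not> p dvd \<nu>"
proof
  assume dvd: "p dvd \<nu>"
  have "\<nu> \<noteq> 1" using dvd assms(1) by (auto simp: prime_nat_iff)
  then have "p \<noteq> 2" "\<nu> = \<nu>\<^sub>0" using assms(3) by (auto simp: nu_values_def split: if_splits)
  moreover from this have "\<nu>\<^sub>0 = 0" using assms(2) dvd by (auto dest: dvd_imp_le)
  ultimately have "QuadRes (int p) (int \<nu>\<^sub>0)"
    unfolding QuadRes_def by (intro exI[of _ 0]) simp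
  with \<open>p \<noteq> 2\<close> assms(2) show False by simp
qed

lemma listed_model:
  assumes p: "Factorial_Ring.prime p" and \<nu>\<^sub>0: "p \<noteq> 2 \<Longrightarrow> \<nu>\<^sub>0 < p \<and> \<not> QuadRes (int p) (int \<nu>\<^sub>0)"
    and l: "l \<in> labels p \<nu>\<^sub>0 n m"
  shows "model (listed_group p l) p (fst (dims l)) (snd (dims l)) (params p l)"
    and "2 \<le> snd (dims l)" "snd (dims l) \<le> fst (dims l)"
proof -
  have "l \<in> K_labels p \<or> l \<in> L_labels p \<nu>\<^sub>0 n m"
    using l by (simp add: labels_def)
  then have "model (listed_group p l) p (fst (dims l)) (snd (dims l)) (params p l)
    \<and> 2 \<le> snd (dims l) \<and> snd (dims l) \<le> fst (dims l)"
  proof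
    assume "l \<in> K_labels p"
    then show ?thesis
      using model_K1[of p] model_K2[of p] model_K3[of p] model_K4[of p] model_K5[of p] model_K6[of p] model_K7[of p]
        model_K8[of p] model_K9[of p] model_K10[of p]
      by (auto simp: K_labels_def simp del: listed_group.simps split: if_splits)
  next
    assume L: "l \<in> L_labels p \<nu>\<^sub>0 n m"
    then have nm: "2 \<le> m" "m \<le> n" by (auto simp: L_labels_def split: if_splits)
    have t: "\<not> p dvd t" if "t \<in> {1..<p}" for t
      using that by (auto dest: dvd_imp_le)
    note \<nu> = nu_values_not_dvd[OF p \<nu>\<^sub>0]
    from L nm show ?thesis
      unfolding L_labels_def
      using model_L1[OF p nm] model_L2[OF p nm t] model_L3[OF p nm] model_L4[OF p nm \<nu>] model_L5[OF p nm \<nu>]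
        model_L6[OF p nm] model_L7[OF p nm] model_L8[OF p nm] model_L9[OF p nm]
      by (auto simp del: listed_group.simps split: if_splits)
  qed
  then show "model (listed_group p l) p (fst (dims l)) (snd (dims l)) (params p l)"
    "2 \<le> snd (dims l)" "snd (dims l) \<le> fst (dims l)" by auto
qed

section \<open>Orbits of the parameters for p = n = 2\<close>

lemma param_equiv_2_iff: "param_equiv 2 2 (\<alpha>, \<beta>, \<gamma>, \<delta>) (\<alpha>', \<beta>', \<gamma>', \<delta>') \<longleftrightarrow> even (\<alpha> - \<alpha>') \<and> even (\<beta> - \<beta>') \<and>
   (even (\<gamma> - \<gamma>') \<and> even (\<delta> - \<delta>') \<or> even (\<gamma> + \<alpha> + 1 - \<gamma>') \<and> even (\<delta> + \<beta> - \<delta>'))"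
proof
  assume "param_equiv 2 2 (\<alpha>, \<beta>, \<gamma>, \<delta>) (\<alpha>', \<beta>', \<gamma>', \<delta>')"
  then show "even (\<alpha> - \<alpha>') \<and> even (\<beta> - \<beta>') \<and>
   (even (\<gamma> - \<gamma>') \<and> even (\<delta> - \<delta>') \<or> even (\<gamma> + \<alpha> + 1 - \<gamma>') \<and> even (\<delta> + \<beta> - \<delta>'))"
    unfolding param_equiv_def by auto
next
  assume *: "even (\<alpha> - \<alpha>') \<and> even (\<beta> - \<beta>') \<and>
   (even (\<gamma> - \<gamma>') \<and> even (\<delta> - \<delta>') \<or> even (\<gamma> + \<alpha> + 1 - \<gamma>') \<and> even (\<delta> + \<beta> - \<delta>'))"
  show "param_equiv 2 2 (\<alpha>, \<beta>, \<gamma>, \<delta>) (\<alpha>', \<beta>', \<gamma>', \<delta>')"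
  proof (cases "even (\<gamma> - \<gamma>') \<and> even (\<delta> - \<delta>')")
    case True
    then show ?thesis
      unfolding param_equiv_def split using * by (intro exI[of _ 1] exI[of _ "0::int"]) auto
  next
    case False
    then show ?thesis
      unfolding param_equiv_def split using * by (intro exI[of _ 1]) auto
  qed
qed

text \<open>Modulo 2 the numbers i and j are 1, and e = 1 adds (\<alpha> + 1, \<beta>) to (\<gamma>,
  \<delta>). This shift is trivial for (\<alpha>, \<beta>) = (1, 0) only, so the 16 vectors form 4 +
  3 * 2 = 10 orbits.\<close>

lemma K_complete: "\<exists>l \<in> K_labels 2. param_equiv 2 2 q (params 2 l)"
proof -
  obtain \<alpha> \<beta> \<gamma> \<delta> where q: "q = (\<alpha>, \<beta>, \<gamma>, \<delta>)" by (cases q)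
  show ?thesis
    unfolding K_labels_def q by (simp add: param_equiv_2_iff) presburger
qed

lemma K_distinct:
  assumes "l \<in> K_labels 2" "l' \<in> K_labels 2" "param_equiv 2 2 (params 2 l) (params 2 l')"
  shows "l = l'"
  using assms unfolding K_labels_def by (auto simp: param_equiv_2_iff)

section \<open>Orbits of the parameters in the remaining cases\<close>

text \<open>All numbers are taken modulo p. If \<alpha> = \<alpha>' = 1 then j = 1, which fixes
  \<beta>. If \<alpha> = 1 and \<gamma> = \<gamma>' = 0 then e = 0, which makes the vanishing of
  \<delta> an invariant. If \<alpha> or \<beta> is 0 then e does not affect \<gamma> or \<delta>,
  respectively.\<close>

lemma param_equiv_L:
  assumes p: "Factorial_Ring.prime p" and n: "\<not> (p = 2 \<and> n = 2)"
    and param_equiv: "param_equiv p n (\<alpha>, \<beta>, \<gamma>, \<delta>) (\<alpha>', \<beta>', \<gamma>', \<delta>')"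
  shows "int p dvd \<alpha> \<longleftrightarrow> int p dvd \<alpha>'"
    and "int p dvd \<beta> \<longleftrightarrow> int p dvd \<beta>'"
    and "\<lbrakk>\<alpha> = 1; \<alpha>' = 1\<rbrakk> \<Longrightarrow> int p dvd \<beta> - \<beta>'"
    and "\<lbrakk>\<alpha> = 1; \<gamma> = 0; \<gamma>' = 0\<rbrakk> \<Longrightarrow> int p dvd \<delta> \<longleftrightarrow> int p dvd \<delta>'"
    and "\<alpha> = 0 \<Longrightarrow> int p dvd \<gamma> \<longleftrightarrow> int p dvd \<gamma>'"
    and "\<beta> = 0 \<Longrightarrow> int p dvd \<delta> \<longleftrightarrow> int p dvd \<delta>'"
    and "\<exists>j. \<not> int p dvd j \<and> int p dvd \<beta> - \<beta>' * j\<^sup>2"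
proof -
  let ?p = "int p"
  obtain i j e where i: "\<not> ?p dvd i" and j: "\<not> ?p dvd j" and 1: "?p dvd \<alpha> - \<alpha>' * j"
    and 2: "?p dvd \<beta> - \<beta>' * j\<^sup>2" and 3: "?p dvd j * \<gamma> + e * \<alpha> - \<gamma>' * i * j"
    and 4: "?p dvd j * \<delta> + e * \<beta> - \<delta>' * i * j\<^sup>2"
    using param_equiv n unfolding param_equiv_def by auto
  have pp: "Factorial_Ring.prime ?p" using p by simp
  have iff: "?p dvd x \<longleftrightarrow> ?p dvd y" if "?p dvd x - y" for x y
    using that by (metis diff_add_cancel dvd_add_right_iff dvd_add)
  note pd = prime_dvd_mult_iff[OF pp] prime_dvd_power_iff[OF pp]
  show "?p dvd \<alpha> \<longleftrightarrow> ?p dvd \<alpha>'" using iff[OF 1] j by (simp add: pd)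
  show "?p dvd \<beta> \<longleftrightarrow> ?p dvd \<beta>'" using iff[OF 2] j by (simp add: pd)
  show "\<exists>j. \<not> ?p dvd j \<and> ?p dvd \<beta> - \<beta>' * j\<^sup>2" using 2 j by blast
  show "?p dvd \<gamma> \<longleftrightarrow> ?p dvd \<gamma>'" if "\<alpha> = 0"
    using iff[OF 3] i j that by (simp add: pd)
  show "?p dvd \<delta> \<longleftrightarrow> ?p dvd \<delta>'" if "\<beta> = 0"
    using iff[OF 4] i j that by (simp add: pd)
  show "?p dvd \<beta> - \<beta>'" if "\<alpha> = 1" "\<alpha>' = 1"
  proof -
    have "?p dvd (1 - j) * (\<beta>' * (1 + j))" using 1 that by (intro dvd_mult2) simp
    then have "?p dvd (\<beta> - \<beta>' * j\<^sup>2) - (1 - j) * (\<beta>' * (1 + j))" using 2 by (rule dvd_diff[rotated])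
    then show ?thesis by (simp add: algebra_simps power2_eq_square)
  qed
  show "?p dvd \<delta> \<longleftrightarrow> ?p dvd \<delta>'" if "\<alpha> = 1" "\<gamma> = 0" "\<gamma>' = 0"
  proof -
    have "?p dvd e" using 3 that by simp
    then have "?p dvd (j * \<delta> + e * \<beta> - \<delta>' * i * j\<^sup>2) - e * \<beta>" by (intro dvd_diff[OF 4]) simp
    then have "?p dvd j * \<delta> - \<delta>' * i * j\<^sup>2" by simp
    from iff[OF this] show ?thesis using i j by (simp add: pd)
  qed
qed

text \<open>Multiplication by t t' clears the inverses t^(p-2) and t'^(p-2).\<close>

lemma inverse_mod_inj:
  assumes p: "Factorial_Ring.prime p" and t: "\<not> p dvd t" "\<not> p dvd t'"
    and eq: "int p dvd int t ^ (p - 2) - int t' ^ (p - 2) * u"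
  shows "int p dvd int t' - int t * u"
proof -
  let ?x = "int t ^ (p - 2)" and ?x' = "int t' ^ (p - 2)"
  note 1 = prime_power_inverse[OF p t(1)] and 2 = prime_power_inverse[OF p t(2)]
  have "int p dvd (?x - ?x' * u) * (int t * int t') - int t' * (int t * ?x - 1) + int t * u * (int t' * ?x' - 1)"
    by (intro dvd_add[OF dvd_diff] dvd_mult2[OF eq] dvd_mult[OF 1] dvd_mult[OF 2])
  then show ?thesis by (simp add: algebra_simps)
qed

lemma nat_eq_of_dvd:
  assumes "int p dvd int s - int s'" "s < p" "s' < p"
  shows "s = s'"
  using assms by (metis cong_iff_dvd_diff cong_int_iff cong_less_modulus_unique_nat)

text \<open>The vanishing of the parameters separates the types. Within a type, s and t are
  recovered from \<beta> because \<alpha> = 1, and \<nu> is recovered up to squares.\<close>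

lemma L_distinct:
  assumes p: "Factorial_Ring.prime p" and \<nu>\<^sub>0: "p \<noteq> 2 \<Longrightarrow> \<nu>\<^sub>0 < p \<and> \<not> QuadRes (int p) (int \<nu>\<^sub>0)"
    and l: "l \<in> L_labels p \<nu>\<^sub>0 n m" "l' \<in> L_labels p \<nu>\<^sub>0 n m"
    and param_equiv: "param_equiv p n (params p l) (params p l')"
  shows "l = l'"
proof -
  have n: "\<not> (p = 2 \<and> n = 2)" using l by (auto simp: L_labels_def split: if_splits)
  have p1: "p \<noteq> 1" using p by auto
  obtain \<alpha> \<beta> \<gamma> \<delta> where q: "params p l = (\<alpha>, \<beta>, \<gamma>, \<delta>)" by (cases "params p l")
  obtain \<alpha>' \<beta>' \<gamma>' \<delta>' where q': "params p l' = (\<alpha>', \<beta>', \<gamma>', \<delta>')" by (cases "params p l'")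
  note inv = param_equiv_L[OF p n param_equiv[unfolded q q']]
  have t: "\<not> p dvd t" if "t \<in> {1..<p}" for t
    using that by (auto dest: dvd_imp_le)
  note \<nu> = nu_values_not_dvd[OF p \<nu>\<^sub>0]
  have pw: "\<not> int p dvd int t ^ N" if "\<not> p dvd t" for t N
    using that p by (metis int_dvd_int_iff of_nat_power prime_dvd_power)
  have tt: "t = t'" if "t \<in> {1..<p}" "t' \<in> {1..<p}" "int p dvd int t ^ (p - 2) - int t' ^ (p - 2)" for t t'
    using inverse_mod_inj[OF p t t, of t t' 1] that nat_eq_of_dvd[of p t' t] by simp
  \<comment> \<open>If the values were different, 1 and \<open>\<nu>\<^sub>0\<close> would differ by
    a square factor modulo p, making \<open>\<nu>\<^sub>0\<close> a residue.\<close>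
  have \<nu>\<nu>: "\<nu> = \<nu>'" if "\<nu> \<in> nu_values p \<nu>\<^sub>0" "\<nu>' \<in> nu_values p \<nu>\<^sub>0" "\<not> int p dvd j"
      "int p dvd int \<nu> ^ (p - 2) - int \<nu>' ^ (p - 2) * j\<^sup>2" for \<nu> \<nu>' j
  proof (rule ccontr)
    assume ne: "\<nu> \<noteq> \<nu>'"
    have 1: "int p dvd int \<nu>' - int \<nu> * j\<^sup>2"
      using inverse_mod_inj[OF p \<nu> \<nu>, of \<nu> \<nu>' "j\<^sup>2"] that by simp
    have "p \<noteq> 2" and "\<nu> = 1 \<and> \<nu>' = \<nu>\<^sub>0 \<or> \<nu> = \<nu>\<^sub>0 \<and> \<nu>' = 1"
      using ne that by (auto simp: nu_values_def split: if_splits)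
    then have "QuadRes (int p) (int \<nu>\<^sub>0)"
    proof (elim disjE conjE)
      assume "\<nu> = 1" "\<nu>' = \<nu>\<^sub>0"
      then show ?thesis
        unfolding QuadRes_def using 1 by (intro exI[of _ j]) (simp add: cong_iff_dvd_diff dvd_diff_commute)
    next
      assume *: "\<nu> = \<nu>\<^sub>0" "\<nu>' = 1"
      have "coprime j (int p)"
        using \<open>\<not> int p dvd j\<close> p prime_imp_coprime[of "int p" j] by (simp add: coprime_commute)
      then obtain y where y: "[j * y = 1] (mod int p)"
        using cong_solve_coprime_int by blast
      have "[int \<nu>\<^sub>0 * j\<^sup>2 = 1] (mod int p)"
        using 1 * by (simp add: cong_iff_dvd_diff dvd_diff_commute)
      then have "[int \<nu>\<^sub>0 * j\<^sup>2 * y\<^sup>2 = 1 * y\<^sup>2] (mod int p)" by (rule cong_scalar_right)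
      then have 3: "[1 * y\<^sup>2 = int \<nu>\<^sub>0 * j\<^sup>2 * y\<^sup>2] (mod int p)" by (rule cong_sym)
      have "[int \<nu>\<^sub>0 * (j * y)\<^sup>2 = int \<nu>\<^sub>0 * 1\<^sup>2] (mod int p)"
        using y by (intro cong_mult cong_pow) simp_all
      then have "[int \<nu>\<^sub>0 * j\<^sup>2 * y\<^sup>2 = int \<nu>\<^sub>0] (mod int p)"
        by (simp add: power_mult_distrib mult.assoc)
      from cong_trans[OF 3 this] have "[y\<^sup>2 = int \<nu>\<^sub>0] (mod int p)" by simp
      then show ?thesis unfolding QuadRes_def by blast
    qed
    with \<nu>\<^sub>0[OF \<open>p \<noteq> 2\<close>] show False by simp
  qed
  consider (a) s where "l = L1 n m s" "s < p" | (b) t where "l = L2 n m t" "t \<in> {1..<p}" | (c) "l = L3 n m"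
    | (d) \<nu> where "l = L4 n m \<nu>" "\<nu> \<in> nu_values p \<nu>\<^sub>0" | (e) \<nu> where "l = L5 n m \<nu>" "\<nu> \<in> nu_values p \<nu>\<^sub>0"
    | (f) "l = L6 n m" | (g) "l = L7 n m" | (h) "l = L8 n m" | (i) "l = L9 n m"
    using l(1) unfolding L_labels_def by (auto split: if_splits)
  note cases = this
  consider (a) s where "l' = L1 n m s" "s < p" | (b) t where "l' = L2 n m t" "t \<in> {1..<p}" | (c) "l' = L3 n m"
    | (d) \<nu> where "l' = L4 n m \<nu>" "\<nu> \<in> nu_values p \<nu>\<^sub>0" | (e) \<nu> where "l' = L5 n m \<nu>" "\<nu> \<in> nu_values p \<nu>\<^sub>0"
    | (f) "l' = L6 n m" | (g) "l' = L7 n m" | (h) "l' = L8 n m" | (i) "l' = L9 n m"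
    using l(2) unfolding L_labels_def by (auto split: if_splits)
  note cases' = this
  have aa: "l = l'" if "l = L1 n m s" "s < p" "l' = L1 n m s'" "s' < p" for s s'
    using inv(3) q q' that nat_eq_of_dvd[of p s s'] by simp
  have bb: "l = l'" if "l = L2 n m s" "s \<in> {1..<p}" "l' = L2 n m s'" "s' \<in> {1..<p}" for s s'
    using inv(3) q q' that tt[of s' s] by auto
  have \<nu>2: "\<nu> = \<nu>'" if "\<beta> = - (int \<nu> ^ (p - 2))" "\<beta>' = - (int \<nu>' ^ (p - 2))"
    "\<nu> \<in> nu_values p \<nu>\<^sub>0" "\<nu>' \<in> nu_values p \<nu>\<^sub>0" for \<nu> \<nu>'
  proof -
    obtain j where j: "\<not> int p dvd j" "int p dvd \<beta> - \<beta>' * j\<^sup>2" using inv(7) by blast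
    then have "int p dvd - (\<beta> - \<beta>' * j\<^sup>2)" by (simp only: dvd_minus_iff)
    then show ?thesis
      using \<nu>\<nu>[OF that(3,4) j(1)] that(1,2) by simp
  qed
  have dd: "l = l'" if "l = L4 n m s" "s \<in> nu_values p \<nu>\<^sub>0" "l' = L4 n m s'" "s' \<in> nu_values p \<nu>\<^sub>0" for s s'
    using \<nu>2 q q' that by simp
  have ee: "l = l'" if "l = L5 n m s" "s \<in> nu_values p \<nu>\<^sub>0" "l' = L5 n m s'" "s' \<in> nu_values p \<nu>\<^sub>0" for s s'
    using \<nu>2 q q' that by simp
  show ?thesis
    \<comment> \<open>Nine types against nine: equal types are settled by comparing their
      parameters, different ones contradict an invariant.\<close>
    by (cases rule: cases; cases rule: cases'; (simp; fail | (rule aa bb dd ee; assumption) |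
      (use inv(1-6) q q' p1 in \<open>auto simp: pw t \<nu>\<close>)))
qed


text \<open>By Euler's criterion both numbers have -1 as their power with exponent (p - 1) / 2, so
  their product has 1.\<close>

lemma QuadRes_mult_nonresidue:
  assumes p: "Factorial_Ring.prime p" "p \<noteq> 2" and x: "\<not> QuadRes (int p) x" and y: "\<not> QuadRes (int p) y"
  shows "QuadRes (int p) (x * y)"
proof (rule ccontr)
  assume xy: "\<not> QuadRes (int p) (x * y)"
  have p2: "2 < p" using p prime_ge_2_nat[of p] by linarith
  let ?N = "(p - 1) div 2"
  have euler: "[- 1 = a ^ ?N] (mod int p)" if "\<not> QuadRes (int p) a" for a
  proof -
    have "\<not> [a = 0] (mod int p)"
    proof
      assume "[a = 0] (mod int p)"
      then have "QuadRes (int p) a"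
        unfolding QuadRes_def by (intro exI[of _ 0]) (simp add: cong_sym)
      with that show False by simp
    qed
    then have "Legendre a (int p) = - 1" using that by (simp add: Legendre_def)
    then show ?thesis using euler_criterion[OF p(1) p2, of a] by simp
  qed
  have "[(- 1) * (- 1) = x ^ ?N * y ^ ?N] (mod int p)"
    by (rule cong_mult[OF euler[OF x] euler[OF y]])
  then have "[1 = (x * y) ^ ?N] (mod int p)" by (simp add: power_mult_distrib)
  with euler[OF xy] have "[- 1 = 1] (mod int p)" by (meson cong_sym cong_trans)
  then have "int p dvd - 1 - 1" by (simp only: cong_iff_dvd_diff)
  then have "int p dvd - int 2" by simp
  then have "int p dvd int 2" by (simp only: dvd_minus_iff)
  then have "p dvd 2" by (simp only: int_dvd_int_iff)
  then show False using p2 by (auto dest: dvd_imp_le)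
qed

lemma prime_inverse_mod:
  assumes p: "Factorial_Ring.prime p" and x: "\<not> int p dvd x"
  obtains y where "int p dvd x * y - 1" "\<not> int p dvd y"
proof -
  have "coprime x (int p)"
    using x p prime_imp_coprime[of "int p" x] by (simp add: coprime_commute)
  then obtain y where y: "[x * y = 1] (mod int p)"
    using cong_solve_coprime_int by blast
  then have 1: "int p dvd x * y - 1" by (simp add: cong_iff_dvd_diff)
  have "\<not> int p dvd y"
  proof
    assume "int p dvd y"
    then have "int p dvd x * y - (x * y - 1)" by (intro dvd_diff[OF dvd_mult 1])
    then have "p = 1" by simp
    with p show False by simp
  qed
  with 1 that show ?thesis by blast
qed

text \<open>Row reduction of the matrix with rows (\<alpha>, \<beta>) and (\<gamma>, \<delta>): j
  normalizes the first row, e adds a multiple of it to the second, and i scales the second. If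
  \<alpha> is a unit, the determinant decides between (L1) and the types (L2), (L3).\<close>

lemma L_complete:
  assumes p: "Factorial_Ring.prime p" and \<nu>\<^sub>0: "p \<noteq> 2 \<Longrightarrow> \<nu>\<^sub>0 < p \<and> \<not> QuadRes (int p) (int \<nu>\<^sub>0)"
    and nm: "2 \<le> m" "m \<le> n" and n: "p = 2 \<Longrightarrow> 3 \<le> n"
  shows "\<exists>l \<in> L_labels p \<nu>\<^sub>0 n m. param_equiv p n q (params p l)"
proof -
  let ?p = "int p"
  have pp: "Factorial_Ring.prime ?p" using p by simp
  have p2: "p \<ge> 2" using p by (rule prime_ge_2_nat)
  obtain \<alpha> \<beta> \<gamma> \<delta> where q: "q = (\<alpha>, \<beta>, \<gamma>, \<delta>)" by (cases q)
  have L: "L_labels p \<nu>\<^sub>0 n m = L1 n m ` {0..<p} \<union> L2 n m ` {1..<p} \<union> {L3 n m}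
           \<union> L4 n m ` nu_values p \<nu>\<^sub>0 \<union> L5 n m ` nu_values p \<nu>\<^sub>0
           \<union> {L6 n m, L7 n m, L8 n m, L9 n m}"
    using nm n by (simp add: L_labels_def)
  have param_equivI: "param_equiv p n q (\<alpha>', \<beta>', \<gamma>', \<delta>')"
    if "\<not> ?p dvd i" "\<not> ?p dvd j" "?p dvd \<alpha> - \<alpha>' * j" "?p dvd \<beta> - \<beta>' * j\<^sup>2"
      "?p dvd j * \<gamma> + e * \<alpha> - \<gamma>' * i * j" "?p dvd j * \<delta> + e * \<beta> - \<delta>' * i * j\<^sup>2" for i j e \<alpha>' \<beta>' \<gamma>' \<delta>'
    unfolding param_equiv_def q split using that n by (intro exI[of _ i] exI[of _ j] exI[of _ e]) auto
  have p1: "\<not> ?p dvd 1" using p2 by simp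
  note pd = prime_dvd_mult_iff[OF pp] prime_dvd_power_iff[OF pp]
  show ?thesis
  proof (cases "?p dvd \<alpha>")
    case False
    then obtain y where y: "?p dvd \<alpha> * y - 1" "\<not> ?p dvd y" by (rule prime_inverse_mod[OF p])
    have y2: "?p dvd w - w * y\<^sup>2 * \<alpha>\<^sup>2" for w
    proof -
      have "w - w * y\<^sup>2 * \<alpha>\<^sup>2 = (\<alpha> * y - 1) * (- w * (\<alpha> * y + 1))"
        by (simp add: algebra_simps power2_eq_square)
      then show ?thesis using y(1) by (metis dvd_mult2)
    qed
    have y2': "?p dvd w - \<beta>' * \<alpha>\<^sup>2" if "?p dvd \<beta>' - w * y\<^sup>2" for w \<beta>'
    proof -
      have "?p dvd (w - w * y\<^sup>2 * \<alpha>\<^sup>2) - (\<beta>' - w * y\<^sup>2) * \<alpha>\<^sup>2"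
        by (rule dvd_diff[OF y2 dvd_mult2[OF that]])
      then show ?thesis by (simp add: algebra_simps)
    qed
    let ?w = "\<alpha> * \<delta> - \<gamma> * \<beta>"
    show ?thesis
    proof (cases "?p dvd ?w")
      case w: False
      \<comment> \<open>The residue of \<beta> / \<alpha>^2, because j = \<alpha> divides \<beta> by
        j^2.\<close>
      define s where "s = nat ((\<beta> * y\<^sup>2) mod ?p)"
      have s: "int s = (\<beta> * y\<^sup>2) mod ?p" "s < p"
        using p2 by (simp_all add: s_def nat_less_iff)
      have "param_equiv p n q (params p (L1 n m s))"
        unfolding params.simps
      \<comment> \<open>The choice j = \<alpha> makes the new \<alpha> equal to 1, and e = -
        \<gamma> clears \<gamma>. This turns \<delta> into the determinant ?w, and i = - ?w /
        \<alpha>^2 normalizes it to -1.\<close>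
      proof (rule param_equivI[of "- ?w * y\<^sup>2" \<alpha> _ _ "- \<gamma>"])
        show "\<not> ?p dvd - ?w * y\<^sup>2" 
          using w y(2) by (simp only: pd dvd_minus_iff zero_less_numeral simp_thms)
        show "?p dvd \<beta> - int s * \<alpha>\<^sup>2"
          by (rule y2') (simp add: s(1) mod_eq_dvd_iff[symmetric])
        show "?p dvd \<alpha> * \<delta> + - \<gamma> * \<beta> - - 1 * (- ?w * y\<^sup>2) * \<alpha>\<^sup>2"
          using y2[of ?w] by (simp add: algebra_simps)
      qed (use False in simp_all)
      then show ?thesis
          using s(2) by (intro bexI[of _ "L1 n m s"]) (simp_all add: L)
    next
      case w: True
      show ?thesis
      proof (cases "?p dvd \<beta>")
        case True
        have "param_equiv p n q (params p (L3 n m))"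
          unfolding params.simps by (rule param_equivI[of 1 \<alpha> _ _ "- \<gamma>"]) (use False w True p1 in simp_all)
        then show ?thesis unfolding L by blast
      next
        case \<beta>: False
        then have "\<not> ?p dvd - (\<beta> * y\<^sup>2)" using y(2) by (simp add: pd)
        \<comment> \<open>The parameter of (L2) is the negative of the inverse of t, so t must be -
          \<alpha>^2 / \<beta>; y is the inverse of \<alpha>.\<close>
        then obtain z where z: "?p dvd - (\<beta> * y\<^sup>2) * z - 1" "\<not> ?p dvd z"
          by (rule prime_inverse_mod[OF p])
        define t where "t = nat (z mod ?p)"
        have t: "int t = z mod ?p" "t < p"
          using p2 by (simp_all add: t_def nat_less_iff)
        have tz: "?p dvd int t - z" by (simp add: t(1) mod_eq_dvd_iff[symmetric])
        then have "\<not> ?p dvd int t" using z(2) by (metis diff_add_cancel dvd_add_right_iff dvd_diff_commute)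
        then have tp: "\<not> p dvd t" by simp
        then have t0: "t \<noteq> 0" by (metis dvd_0_right)
        have "param_equiv p n q (params p (L2 n m t))"
          unfolding params.simps
        proof (rule param_equivI[of 1 \<alpha> _ _ "- \<gamma>"])
          show "?p dvd \<beta> - - (int t ^ (p - 2)) * \<alpha>\<^sup>2"
          proof (rule y2')
            let ?x = "int t ^ (p - 2)" and ?b = "\<beta> * y\<^sup>2"
            have "?p dvd ?x * (- ?b * z - 1) - (- ?b) * (int t * ?x - 1) + (int t - z) * (- ?b * ?x)"
              using prime_power_inverse[OF p tp] z(1) tz
              by (intro dvd_add[OF dvd_diff] dvd_mult dvd_mult2[OF tz]) simp_all
            also have "?x * (- ?b * z - 1) - (- ?b) * (int t * ?x - 1) + (int t - z) * (- ?b * ?x)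
              = - ?x - ?b"
              by (simp add: algebra_simps)
            finally show "?p dvd - ?x - ?b" by simp
          qed
        qed (use False w p1 in simp_all)
        then show ?thesis
          using t(2) t0 by (intro bexI[of _ "L2 n m t"]) (simp_all add: L)
      qed
    qed
  next
    case \<alpha>: True
    show ?thesis
    proof (cases "?p dvd \<beta>")
      case False
      then obtain y where y: "?p dvd \<beta> * y - 1" "\<not> ?p dvd y" by (rule prime_inverse_mod[OF p])
      \<comment> \<open>Only squares j^2 can be divided out of \<beta>; one of - \<beta> and -
        \<beta> \<open>\<nu>\<^sub>0\<close> is a square, which provides \<nu> and j.\<close>
      have "\<exists>\<nu> \<in> nu_values p \<nu>\<^sub>0. QuadRes ?p (- \<beta> * int \<nu>)"
      proof (cases "p = 2")
        case True
        then have "odd \<beta>" using False by simp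
        then show ?thesis
          unfolding QuadRes_def nu_values_def using True
          by (intro bexI[of _ 1] exI[of _ 1]) (simp_all add: cong_iff_dvd_diff)
      next
        case p2: False
        show ?thesis
        proof (cases "QuadRes ?p (- \<beta>)")
          case True
          then show ?thesis unfolding nu_values_def using p2 by (intro bexI[of _ 1]) simp_all
        next
          case False
          then have "QuadRes ?p (- \<beta> * int \<nu>\<^sub>0)"
            using QuadRes_mult_nonresidue[OF p p2] \<nu>\<^sub>0[OF p2] by blast
          then show ?thesis unfolding nu_values_def using p2 by (intro bexI[of _ \<nu>\<^sub>0]) simp_all
        qed
      qed
      then obtain \<nu> j where \<nu>: "\<nu> \<in> nu_values p \<nu>\<^sub>0" and j: "[j\<^sup>2 = - \<beta> * int \<nu>] (mod ?p)"
        unfolding QuadRes_def by blast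
      have \<nu>p: "\<not> p dvd \<nu>" by (rule nu_values_not_dvd[OF p \<nu>\<^sub>0 \<nu>])
      have j': "?p dvd j\<^sup>2 + \<beta> * int \<nu>" using j by (simp add: cong_iff_dvd_diff)
      have jp: "\<not> ?p dvd j"
      proof
        assume "?p dvd j"
        then have "?p dvd (j\<^sup>2 + \<beta> * int \<nu>) - j * j" using j' by (intro dvd_diff) simp_all
        then have "?p dvd \<beta> * int \<nu>" by (simp add: power2_eq_square)
        then show False using False \<nu>p by (simp add: pd)
      qed
      have b: "?p dvd \<beta> - - (int \<nu> ^ (p - 2)) * j\<^sup>2"
      proof -
        let ?x = "int \<nu> ^ (p - 2)"
        have "?p dvd ?x * (j\<^sup>2 + \<beta> * int \<nu>) - \<beta> * (int \<nu> * ?x - 1)"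
          by (intro dvd_diff[OF dvd_mult[OF j'] dvd_mult[OF prime_power_inverse[OF p \<nu>p]]])
        then show ?thesis by (simp add: algebra_simps)
      qed
      \<comment> \<open>The choice e = - j \<delta> / \<beta> clears \<delta>.\<close>
      have d: "?p dvd j * \<delta> + (- j * \<delta> * y) * \<beta>"
      proof -
        have "?p dvd (\<beta> * y - 1) * (- j * \<delta>)" using y(1) by (rule dvd_mult2)
        then show ?thesis by (simp add: algebra_simps)
      qed
      show ?thesis
      proof (cases "?p dvd \<gamma>")
        case True
        have "param_equiv p n q (params p (L5 n m \<nu>))"
          unfolding params.simps by (rule param_equivI[OF p1 jp _ b, of _ "- j * \<delta> * y"]) (use \<alpha> True d in simp_all)
        then show ?thesis
          using \<nu> by (intro bexI[of _ "L5 n m \<nu>"]) (simp_all add: L)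
      next
        case False
        have "param_equiv p n q (params p (L4 n m \<nu>))"
          unfolding params.simps by (rule param_equivI[OF False jp _ b, of _ "- j * \<delta> * y"]) (use \<alpha> d in simp_all)
        then show ?thesis
          using \<nu> by (intro bexI[of _ "L4 n m \<nu>"]) (simp_all add: L)
      qed
    next
      case \<beta>: True
      show ?thesis
      proof (cases "?p dvd \<gamma>")
        case \<gamma>: True
        show ?thesis
        proof (cases "?p dvd \<delta>")
          case True
          have "param_equiv p n q (params p (L9 n m))"
            unfolding params.simps by (rule param_equivI[OF p1 p1, of _ _ 0]) (use \<alpha> \<beta> \<gamma> True in simp_all)
          then show ?thesis unfolding L by blast
        next
          case False
          have "param_equiv p n q (params p (L8 n m))"
            unfolding params.simps by (rule param_equivI[of "- \<delta>" 1 _ _ 0]) (use \<alpha> \<beta> \<gamma> False p1 in simp_all)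
          then show ?thesis unfolding L by blast
        qed
      next
        case \<gamma>: False
        show ?thesis
        proof (cases "?p dvd \<delta>")
          case True
          have "param_equiv p n q (params p (L7 n m))"
            unfolding params.simps by (rule param_equivI[OF \<gamma> p1, of _ _ 0]) (use \<alpha> \<beta> True in simp_all)
          then show ?thesis unfolding L by blast
        next
          case False
          obtain y where y: "?p dvd \<gamma> * y - 1" "\<not> ?p dvd y" using \<gamma> by (rule prime_inverse_mod[OF p])
          have "param_equiv p n q (params p (L6 n m))"
            unfolding params.simps
          \<comment> \<open>With i = \<gamma>, the condition j \<delta> = - i j^2 for the new
            \<delta> = -1 leads to j = - \<delta> / \<gamma>.\<close>
          proof (rule param_equivI[OF \<gamma>, of "- \<delta> * y" _ _ 0])
            show "\<not> ?p dvd - \<delta> * y" using False y(2) by (simp add: pd)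
            have "?p dvd (\<gamma> * y - 1) * (\<delta>\<^sup>2 * y)" using y(1) by (rule dvd_mult2)
            then show "?p dvd - \<delta> * y * \<delta> + 0 * \<beta> - - 1 * \<gamma> * (- \<delta> * y)\<^sup>2"
              by (simp add: algebra_simps power2_eq_square)
          qed (use \<alpha> \<beta> in simp_all)
          then show ?thesis unfolding L by blast
        qed
      qed
    qed
  qed
qed

section \<open>The structure of the groups\<close>

text \<open>The kernel of the map from \<open>Gam\<close> to M_p(n, m, 1) that sends d to 1; hence l
  is unrestricted.\<close>

definition Lam0 :: "nat \<Rightarrow> nat \<Rightarrow> nat \<Rightarrow> (int \<times> int \<times> int \<times> int) set" where
  "Lam0 p n m = {(j, i, k, l). int p ^ m dvd j \<and> int p ^ n dvd i \<and> int p dvd k}"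

lemma Lam0_normal:
  assumes "1 \<le> m" "m \<le> n"
  shows "Lam0 p n m \<lhd> Gam"
proof -
  have pn: "int p dvd i" if "int p ^ n dvd i" for i
    using that assms by (meson dvd_power dvd_trans le_trans less_le_trans zero_less_one)
  have pm: "int p dvd i" if "int p ^ m dvd i" for i
    using that assms by (meson dvd_power dvd_trans less_le_trans zero_less_one)
  have sub: "subgroup (Lam0 p n m) Gam"
    by (rule group.subgroupI[OF group_Gam]) (auto simp: Lam0_def inv_Gam pn)
  show ?thesis
  proof (rule group.normal_invI[OF group_Gam sub])
    fix g x :: "int \<times> int \<times> int \<times> int" assume x: "x \<in> Lam0 p n m"
    obtain j i k l where xx: "x = (j, i, k, l)" by (cases x)
    obtain j' i' k' l' where g: "g = (j', i', k', l')" by (cases g)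
    have "int p dvd j" using x pm by (auto simp: Lam0_def xx)
    then show "g \<otimes>\<^bsub>Gam\<^esub> x \<otimes>\<^bsub>Gam\<^esub> inv\<^bsub>Gam\<^esub> g \<in> Lam0 p n m"
      using x pn by (auto simp: Lam0_def xx g inv_Gam algebra_simps)
  qed
qed

text \<open>An instance of \<open>presented_kernel\<close> with the identity in the place of
  d.\<close>

lemma M_p1_model:
  assumes nm: "1 \<le> m" "m \<le> n"
  shows "\<exists>\<psi> \<in> hom Gam (M_p1 p n m). range \<psi> = carrier (M_p1 p n m) \<and>
    (\<forall>x. \<psi> x = \<one>\<^bsub>M_p1 p n m\<^esub> \<longleftrightarrow> x \<in> Lam0 p n m)"
  unfolding M_p1_def
proof (rule presented_kernel[OF Lam0_normal[OF nm] order.refl], goal_cases)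
  let ?R = "{\<aa> ^ (p ^ n) \<doteq> 1, \<bb> ^ (p ^ m) \<doteq> 1, \<cc> ^ p \<doteq> 1, comm \<aa> \<bb> \<doteq> \<cc>, comm \<cc> \<aa> \<doteq> 1, comm \<cc> \<bb> \<doteq> 1}"
  case 1
  let ?P = "pres_abc ?R"
  define f where "f = (\<lambda>x. word_class {La, Lb, Lc} ?R (Gen x))"
  interpret group ?P by (rule group_presented_group)
  have cl: "f La \<in> carrier ?P" "f Lb \<in> carrier ?P" "f Lc \<in> carrier ?P"
    using 1(1) unfolding f_def by auto
  have "\<forall>(u, v) \<in> ?R. word_eval ?P f u = word_eval ?P f v"
  proof clarify
    fix u v assume "(u, v) \<in> ?R"
    then show "word_eval ?P f u = word_eval ?P f v"
      unfolding f_def by (intro 1(2)) (auto split: if_splits)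
  qed
  then have rel: "f La [^]\<^bsub>?P\<^esub> (p ^ n) = \<one>\<^bsub>?P\<^esub>" "f Lb [^]\<^bsub>?P\<^esub> (p ^ m) = \<one>\<^bsub>?P\<^esub>" "f Lc [^]\<^bsub>?P\<^esub> p = \<one>\<^bsub>?P\<^esub>"
    "f La \<otimes>\<^bsub>?P\<^esub> f Lb = f Lb \<otimes>\<^bsub>?P\<^esub> (f La \<otimes>\<^bsub>?P\<^esub> f Lc)" "f Lc \<otimes>\<^bsub>?P\<^esub> f La = f La \<otimes>\<^bsub>?P\<^esub> f Lc"
    "f Lc \<otimes>\<^bsub>?P\<^esub> f Lb = f Lb \<otimes>\<^bsub>?P\<^esub> f Lc"
    using cl by (simp_all add: word_eval_comm_eq_iff word_eval_simps word_eval_pow)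
  interpret q: gam_quad ?P "f La" "f Lb" "f Lc" "\<one>\<^bsub>?P\<^esub>"
    by unfold_locales (use cl rel in simp_all)
  have one: "x [^]\<^bsub>?P\<^esub> i = \<one>\<^bsub>?P\<^esub>" if "x [^]\<^bsub>?P\<^esub> (N::nat) = \<one>\<^bsub>?P\<^esub>" "int N dvd i" "x \<in> carrier ?P" for x N and i :: int
  proof -
    obtain u where "i = int N * u" using \<open>int N dvd i\<close> by blast
    then have "x [^]\<^bsub>?P\<^esub> i = (x [^]\<^bsub>?P\<^esub> N) [^]\<^bsub>?P\<^esub> u"
      using int_pow_pow[OF \<open>x \<in> carrier ?P\<close>, of "int N" u] by (simp add: int_pow_int)
    then show ?thesis by (simp add: \<open>x [^]\<^bsub>?P\<^esub> N = \<one>\<^bsub>?P\<^esub>\<close>)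
  qed
  have "q.ev x = \<one>\<^bsub>?P\<^esub>" if "x \<in> Lam0 p n m" for x
    using that one[OF rel(1)] one[OF rel(2)] one[OF rel(3)] by (cases x) (auto simp: Lam0_def)
  then show ?case using q.gam_quad_axioms unfolding f_def by auto
next
  let ?R = "{\<aa> ^ (p ^ n) \<doteq> 1, \<bb> ^ (p ^ m) \<doteq> 1, \<cc> ^ p \<doteq> 1, comm \<aa> \<bb> \<doteq> \<cc>, comm \<cc> \<aa> \<doteq> 1, comm \<cc> \<bb> \<doteq> 1}"
  case (2 u v)
  interpret N: normal "Lam0 p n m" Gam by (rule Lam0_normal[OF nm])
  define Q where "Q = Gam Mod Lam0 p n m"
  have Q: "group Q" unfolding Q_def by (rule N.factorgroup_is_group)
  define \<pi> where "\<pi> = (\<lambda>x. Lam0 p n m #>\<^bsub>Gam\<^esub> x)"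
  have \<pi>: "\<pi> \<in> hom Gam Q"
    unfolding Q_def \<pi>_def by (rule N.r_coset_hom_Mod)
  interpret \<pi>: group_hom Gam Q \<pi>
    by (intro group_hom.intro group_hom_axioms.intro group_Gam Q \<pi>)
  have ker\<pi>: "\<pi> x = \<one>\<^bsub>Q\<^esub> \<longleftrightarrow> x \<in> Lam0 p n m" for x
    unfolding Q_def \<pi>_def using N.mem_rcos_one_iff[of x] by simp
  interpret q: gam_quad Q "\<pi> (0, 1, 0, 0)" "\<pi> (1, 0, 0, 0)" "\<pi> (0, 0, 1, 0)" "\<pi> (0, 0, 0, 1)"
    by (rule hom_Gam_quad[OF \<pi> Q])
  have pow: "\<pi> x [^]\<^bsub>Q\<^esub> (N::nat) = \<pi> (x [^]\<^bsub>Gam\<^esub> N)" for x N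
    by (simp add: \<pi>.hom_nat_pow)
  have "\<pi> (0, 0, 0, 1) = \<one>\<^bsub>Q\<^esub>" unfolding ker\<pi> by (simp add: Lam0_def)
  then have cb: "\<pi> (0, 0, 1, 0) \<otimes>\<^bsub>Q\<^esub> \<pi> (1, 0, 0, 0) = \<pi> (1, 0, 0, 0) \<otimes>\<^bsub>Q\<^esub> \<pi> (0, 0, 1, 0)"
    using q.cb by simp
  have "\<pi> (0, 1, 0, 0) [^]\<^bsub>Q\<^esub> (p ^ n) = \<one>\<^bsub>Q\<^esub>" "\<pi> (1, 0, 0, 0) [^]\<^bsub>Q\<^esub> (p ^ m) = \<one>\<^bsub>Q\<^esub>" "\<pi> (0, 0, 1, 0) [^]\<^bsub>Q\<^esub> p = \<one>\<^bsub>Q\<^esub>"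
    unfolding pow ker\<pi> Gam_nat_pow by (simp_all add: Lam0_def)
  then have "\<forall>(u, v) \<in> ?R. word_eval Q (\<lambda>x. \<pi> (gam_letter x)) u = word_eval Q (\<lambda>x. \<pi> (gam_letter x)) v"
    using q.ab q.ca cb by (simp add: group.word_eval_comm_eq_iff[OF Q] word_eval_simps group.word_eval_pow[OF Q])
  then show ?case using 2 unfolding Q_def \<pi>_def by blast
qed

section \<open>Normality of G', G_3 and the Frattini subgroup of G'\<close>

text \<open>Inverse automorphisms s and t carry the subgroups above M to those above its image and
  back. They will be conjugations restricted to G'.\<close>

lemma maximal_subgroup_image:
  assumes G: "group G" and s: "s \<in> hom G G" and t: "t \<in> hom G G"
    and st: "\<And>x. x \<in> carrier G \<Longrightarrow> s (t x) = x" and ts: "\<And>x. x \<in> carrier G \<Longrightarrow> t (s x) = x"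
    and M: "maximal_subgroup M G"
  shows "maximal_subgroup (s ` M) G"
proof -
  interpret S: group_hom G G s by (intro group_hom.intro group_hom_axioms.intro G s)
  interpret T: group_hom G G t by (intro group_hom.intro group_hom_axioms.intro G t)
  have Ms: "subgroup M G" and Mn: "M \<noteq> carrier G"
    and max: "\<And>L. \<lbrakk>subgroup L G; M \<subseteq> L\<rbrakk> \<Longrightarrow> L = M \<or> L = carrier G"
    using M unfolding maximal_subgroup_def by auto
  have Mc: "M \<subseteq> carrier G" using Ms by (rule subgroup.subset)
  have inv1: "t ` (s ` A) = A" "s ` (t ` A) = A" if "A \<subseteq> carrier G" for A
  proof -
    have "(\<lambda>x. t (s x)) ` A = (\<lambda>x. x) ` A" "(\<lambda>x. s (t x)) ` A = (\<lambda>x. x) ` A"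
      by ((rule image_cong[OF HOL.refl], use that st ts in blast)+)
    then show "t ` (s ` A) = A" "s ` (t ` A) = A" by (simp_all add: image_image)
  qed
  have sub: "s ` carrier G \<subseteq> carrier G" "t ` carrier G \<subseteq> carrier G" by auto
  have car: "s ` carrier G = carrier G" "t ` carrier G = carrier G"
    using image_mono[OF sub(2), of s] image_mono[OF sub(1), of t] sub inv1[of "carrier G"] by auto
  show ?thesis
    unfolding maximal_subgroup_def
  proof (intro conjI allI impI)
    show "subgroup (s ` M) G" using Ms by (rule S.subgroup_img_is_subgroup)
    show "s ` M \<noteq> carrier G"
      using inv1(1)[OF Mc] car Mn by metis
    fix L assume L: "subgroup L G \<and> s ` M \<subseteq> L"
    then have "subgroup (t ` L) G" using T.subgroup_img_is_subgroup by blast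
    moreover have "M \<subseteq> t ` L" using L inv1(1)[OF Mc] by blast
    ultimately have "t ` L = M \<or> t ` L = carrier G" by (rule max)
    then have "s ` (t ` L) = s ` M \<or> s ` (t ` L) = s ` carrier G" by auto
    then show "L = s ` M \<or> L = carrier G"
      unfolding car using inv1(2)[of L] L subgroup.subset[of L G] by simp
  qed
qed

context group
begin

definition cm :: "'a \<Rightarrow> 'a \<Rightarrow> 'a" where "cm x y = inv x \<otimes> inv y \<otimes> x \<otimes> y"

lemma cm_closed [simp]: "\<lbrakk>x \<in> carrier G; y \<in> carrier G\<rbrakk> \<Longrightarrow> cm x y \<in> carrier G"
  by (simp add: cm_def)

lemma cm_eq: "\<lbrakk>x \<in> carrier G; y \<in> carrier G\<rbrakk> \<Longrightarrow> x \<otimes> y = y \<otimes> (x \<otimes> cm x y)"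
  using comm_eq_iff[of x y "cm x y"] by (simp add: cm_def)

lemma conj_hom:
  assumes "g \<in> carrier G"
  shows "(\<lambda>x. g \<otimes> x \<otimes> inv g) \<in> hom G G"
proof (rule homI)
  have [simp]: "inv g \<otimes> (g \<otimes> u) = u" if "u \<in> carrier G" for u
    using that assms by (simp add: m_assoc[symmetric])
  show "g \<otimes> (x \<otimes> y) \<otimes> inv g = g \<otimes> x \<otimes> inv g \<otimes> (g \<otimes> y \<otimes> inv g)"
    if "x \<in> carrier G" "y \<in> carrier G" for x y
    using that assms by (simp add: m_assoc)
qed (use assms in simp)

lemma derived_normal: "derived_subgroup G \<lhd> G"
  using derived_self_is_normal .

lemma cm_derived: "\<lbrakk>x \<in> carrier G; y \<in> carrier G\<rbrakk> \<Longrightarrow> cm x y \<in> derived_subgroup G"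
proof -
  assume xy: "x \<in> carrier G" "y \<in> carrier G"
  then have "inv x \<otimes> inv y \<otimes> inv (inv x) \<otimes> inv (inv y) \<in> derived_set G (carrier G)"
    by (intro UN_I[of "inv x"] UN_I[of "inv y"]) simp_all
  then have "cm x y \<in> derived_set G (carrier G)" using xy by (simp add: cm_def)
  then show ?thesis unfolding derived_def by (rule generate.incl)
qed

lemma G3_eq: "G3 G = generate G {cm x y |x y. x \<in> derived_subgroup G \<and> y \<in> carrier G}"
  unfolding G3_def commutator_subgroup_def cm_def ..

lemma G3_gens: "{cm x y |x y. x \<in> derived_subgroup G \<and> y \<in> carrier G} \<subseteq> carrier G"
  using normal_imp_subgroup[OF derived_normal, THEN subgroup.subset] by (auto simp: subset_iff)

lemma cm_conj:
  assumes "x \<in> carrier G" "y \<in> carrier G" "g \<in> carrier G"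
  shows "g \<otimes> cm x y \<otimes> inv g = cm (g \<otimes> x \<otimes> inv g) (g \<otimes> y \<otimes> inv g)"
proof -
  have [simp]: "inv g \<otimes> (g \<otimes> u) = u" if "u \<in> carrier G" for u
    using that assms by (simp add: m_assoc[symmetric])
  show ?thesis
    using assms by (simp add: cm_def inv_mult_group m_assoc)
qed

lemma G3_normal: "G3 G \<lhd> G"
  unfolding G3_eq
proof (rule normal_generateI[OF G3_gens])
  fix h g assume h: "h \<in> {cm x y |x y. x \<in> derived_subgroup G \<and> y \<in> carrier G}" and g: "g \<in> carrier G"
  then obtain x y where xy: "h = cm x y" "x \<in> derived_subgroup G" "y \<in> carrier G" by blast
  have "x \<in> carrier G" using xy normal_imp_subgroup[OF derived_normal, THEN subgroup.subset] by blast
  moreover have "g \<otimes> x \<otimes> inv g \<in> derived_subgroup G"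
    using normal_inv_iff derived_normal xy g by blast
  ultimately show "g \<otimes> h \<otimes> inv g \<in> {cm x y |x y. x \<in> derived_subgroup G \<and> y \<in> carrier G}"
    using cm_conj[of x y g] xy g by blast
qed

lemma cm_G3: "\<lbrakk>x \<in> derived_subgroup G; y \<in> carrier G\<rbrakk> \<Longrightarrow> cm x y \<in> G3 G"
  unfolding G3_eq by (rule generate.incl) blast

lemma G3_subset_derived: "G3 G \<subseteq> derived_subgroup G"
  unfolding G3_eq
proof (rule generate_subgroup_incl)
  show "subgroup (derived_subgroup G) G" using derived_normal by (rule normal_imp_subgroup)
  then show "{cm x y |x y. x \<in> derived_subgroup G \<and> y \<in> carrier G} \<subseteq> derived_subgroup G"
    using cm_derived subgroup.subset by blast
qed

text \<open>Conjugation by an element of G permutes the maximal subgroups of G' and so preserves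
  their intersection.\<close>

lemma frattini_derived_normal: "frattini (G\<lparr>carrier := derived_subgroup G\<rparr>) \<lhd> G"
proof -
  let ?D = "derived_subgroup G" and ?H = "G\<lparr>carrier := derived_subgroup G\<rparr>"
  have D: "subgroup ?D G" using derived_normal by (rule normal_imp_subgroup)
  have DH: "group ?H" using D by (rule subgroup.subgroup_is_group) (rule group_axioms)
  \<comment> \<open>Inserting G' itself keeps the family non-empty, in accordance with the carrier
    in the definition of \<open>frattini\<close>.\<close>
  let ?F = "insert ?D {M. maximal_subgroup M ?H}"
  have F: "frattini ?H = \<Inter> ?F" by (auto simp: frattini_def)
  have "subgroup M G" if "M \<in> ?F" for M
    using that D by (auto simp: maximal_subgroup_def intro: incl_subgroup)
  then have sub: "subgroup (frattini ?H) G"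
    unfolding F by (intro subgroups_Inter) auto
  show ?thesis
  proof (rule normal_invI[OF sub])
    fix g x assume g: "g \<in> carrier G" and x: "x \<in> frattini ?H"
    have xD: "x \<in> ?D" using x by (simp add: frattini_def)
    have Dc: "y \<in> carrier G" if "y \<in> ?D" for y using that subgroup.subset[OF D] by blast
    have conjD: "u \<otimes> y \<otimes> inv u \<in> ?D" if "y \<in> ?D" "u \<in> carrier G" for y u
      using normal_inv_iff derived_normal that by blast
    define s where "s = (\<lambda>y. inv g \<otimes> y \<otimes> inv (inv g))"
    define t where "t = (\<lambda>y. g \<otimes> y \<otimes> inv g)"
    have hom: "(\<lambda>y. u \<otimes> y \<otimes> inv u) \<in> hom ?H ?H" if "u \<in> carrier G" for u
      using conj_hom[OF that] conjD[OF _ that] Dc by (auto simp: hom_def)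
    have st: "s (t y) = y" "t (s y) = y" if "y \<in> ?D" for y
      using that g Dc[OF that] by (simp_all add: s_def t_def m_assoc) (simp_all add: m_assoc[symmetric])
    have "t x \<in> M" if M: "maximal_subgroup M ?H" for M
    proof -
      have "maximal_subgroup (s ` M) ?H"
        by (rule maximal_subgroup_image[OF DH _ _ _ _ M, of s t]) (use hom[OF g] hom[OF inv_closed[OF g]] st in \<open>simp_all add: s_def t_def\<close>)
      then have "x \<in> s ` M" using x by (auto simp: frattini_def)
      then obtain y where y: "y \<in> M" "x = s y" by blast
      moreover have "M \<subseteq> ?D" using M subgroup.subset[of M ?H] unfolding maximal_subgroup_def by simp
      ultimately show ?thesis using st(2)[of y] by auto
    qed
    moreover have "t x \<in> ?D" using conjD[OF xD g] by (simp add: t_def)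
    ultimately show "g \<otimes> x \<otimes> inv g \<in> frattini ?H"
      by (auto simp: frattini_def t_def)
  qed
qed

lemma PhiG3_normal: "PhiG3 G \<lhd> G"
proof -
  let ?F = "frattini (G\<lparr>carrier := derived_subgroup G\<rparr>)"
  have F: "?F \<lhd> G" by (rule frattini_derived_normal)
  have Z: "G3 G \<lhd> G" by (rule G3_normal)
  have sub: "subgroup (PhiG3 G) G"
    unfolding PhiG3_def using F Z by (metis mult_norm_subgroup normal_imp_subgroup)
  show ?thesis
  proof (rule normal_invI[OF sub])
    fix g x assume g: "g \<in> carrier G" and "x \<in> PhiG3 G"
    then obtain u v where uv: "x = u \<otimes> v" "u \<in> ?F" "v \<in> G3 G"
      unfolding PhiG3_def set_mult_def by blast
    have c: "u \<in> carrier G" "v \<in> carrier G"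
      using uv F Z by (meson normal_imp_subgroup subgroup.mem_carrier)+
    have "g \<otimes> x \<otimes> inv g = (g \<otimes> u \<otimes> inv g) \<otimes> (g \<otimes> v \<otimes> inv g)"
      using conj_hom[OF g] c unfolding uv hom_def by simp
    moreover have "g \<otimes> u \<otimes> inv g \<in> ?F" "g \<otimes> v \<otimes> inv g \<in> G3 G"
      using normal_inv_iff F Z g uv by blast+
    ultimately show "g \<otimes> x \<otimes> inv g \<in> PhiG3 G"
      unfolding PhiG3_def set_mult_def by blast
  qed
qed

lemma G3_subset_PhiG3: "G3 G \<subseteq> PhiG3 G"
proof
  fix z assume z: "z \<in> G3 G"
  have "z \<in> carrier G" using z G3_normal by (meson normal_imp_subgroup subgroup.mem_carrier)
  moreover have "\<one> \<in> frattini (G\<lparr>carrier := derived_subgroup G\<rparr>)"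
    using frattini_derived_normal by (meson normal_imp_subgroup subgroup.one_closed)
  ultimately show "z \<in> PhiG3 G"
    unfolding PhiG3_def set_mult_def using z by force
qed

end

section \<open>Subgroups of prime order\<close>

lemma prime_bezout:
  assumes "Factorial_Ring.prime p" "\<not> int p dvd u"
  obtains s t where "u * s + int p * t = (1::int)"
proof -
  obtain y where "int p dvd u * y - 1" using assms by (rule prime_inverse_mod)
  then obtain t where "u * y - 1 = int p * t" by blast
  then have "u * y + int p * (- t) = 1" by simp
  then show ?thesis by (rule that)
qed

context group
begin

lemma card_subgroup_dvd:
  assumes "subgroup L G" "subgroup H G" "L \<subseteq> H"
  shows "card L dvd card H"
proof -
  interpret H: group "G\<lparr>carrier := H\<rparr>"
    using assms(2) by (rule subgroup.subgroup_is_group) (rule group_axioms)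
  have "card (rcosets\<^bsub>G\<lparr>carrier := H\<rparr>\<^esub> L) * card L = order (G\<lparr>carrier := H\<rparr>)"
    by (rule H.lagrange[OF subgroup_incl[OF assms]])
  then have "card H = card (rcosets\<^bsub>G\<lparr>carrier := H\<rparr>\<^esub> L) * card L" by (simp add: order_def)
  then show ?thesis by simp
qed

lemma int_pow_mem: "\<lbrakk>subgroup H G; x \<in> H\<rbrakk> \<Longrightarrow> x [^] (i::int) \<in> H"
  by (rule subgroup_int_pow_closed)

text \<open>By Bezout x is a product of powers of x^u and x^p.\<close>

lemma mem_of_pow:
  assumes "Factorial_Ring.prime p" "subgroup H G" "x \<in> carrier G" "x [^] (u::int) \<in> H" "x [^] int p \<in> H"
    "\<not> int p dvd u"
  shows "x \<in> H"
proof -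
  obtain s t where st: "u * s + int p * t = 1" using assms by (auto intro: prime_bezout)
  have "x = x [^] (u * s + int p * t)" unfolding st using assms by simp
  also have "\<dots> = (x [^] u) [^] s \<otimes> (x [^] int p) [^] t"
    using assms by (simp add: int_pow_mult int_pow_pow)
  also have "\<dots> \<in> H"
    using assms int_pow_mem[of H] subgroup.m_closed[of H G] by simp
  finally show ?thesis .
qed

lemma prime_order_subgroup:
  assumes p: "Factorial_Ring.prime p" and Z: "subgroup Z G" and card: "card Z = p"
    and z: "z \<in> Z" "z \<noteq> \<one>" and w: "w \<in> Z"
  shows "\<exists>r::int. w = z [^] r"
proof -
  have zc: "z \<in> carrier G" using Z z subgroup.mem_carrier by fast
  have sub: "subgroup (generate G {z}) G" using zc by (intro generate_is_subgroup) simp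
  have incl: "generate G {z} \<subseteq> Z" using Z z by (intro generate_subgroup_incl) simp_all
  have fin: "finite Z" using card p by (intro card_ge_0_finite) (simp add: prime_gt_0_nat)
  have "card (generate G {z}) dvd p" using card_subgroup_dvd[OF sub Z incl] card by simp
  then have "card (generate G {z}) = 1 \<or> card (generate G {z}) = p"
    using p by (simp add: prime_nat_iff)
  moreover have "{\<one>, z} \<subseteq> generate G {z}"
    using generate.one[of G "{z}"] generate.incl[of z "{z}" G] by auto
  then have "card {\<one>, z} \<le> card (generate G {z})"
    using incl fin by (intro card_mono) (auto intro: finite_subset)
  ultimately have "card (generate G {z}) = card Z" using z(2) card by auto
  then have "generate G {z} = Z" using incl fin by (intro card_subset_eq)
  then show ?thesis using w generate_pow[OF zc] by auto
qed

lemma prime_card_pow_one: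
  assumes "subgroup Z G" "card Z = p" "z \<in> Z" "finite (carrier G)"
  shows "z [^] int p = \<one>"
proof -
  interpret Z: group "G\<lparr>carrier := Z\<rparr>"
    using assms(1) by (rule subgroup.subgroup_is_group) (rule group_axioms)
  have "z [^]\<^bsub>G\<lparr>carrier := Z\<rparr>\<^esub> order (G\<lparr>carrier := Z\<rparr>) = \<one>"
    using Z.pow_order_eq_1[of z] assms by simp
  then show ?thesis
    using assms nat_pow_consistent[of z _ Z] by (simp add: int_pow_int order_def)
qed

text \<open>A conjugation acts on a subgroup of order \<open>p\<close> as \<open>z \<mapsto> z\<^sup>r\<close>; its \<open>p\<^sup>e\<close>-th iterate is trivial
  and equals \<open>z \<mapsto> z\<^sup>r\<close> by Fermat.\<close>

lemma prime_order_normal_central: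
  assumes p: "Factorial_Ring.prime p" and fin: "finite (carrier G)" and ord: "order G = p ^ e"
    and Z: "Z \<lhd> G" and card: "card Z = p" and z: "z \<in> Z" and g: "g \<in> carrier G"
  shows "z \<otimes> g = g \<otimes> z"
proof (cases "z = \<one>")
  case False
  have Zs: "subgroup Z G" using Z by (rule normal_imp_subgroup)
  have zc: "z \<in> carrier G" using Zs z subgroup.mem_carrier by fast
  have zp: "z [^] int p = \<one>" by (rule prime_card_pow_one[OF Zs card z fin])
  have zeq: "z [^] i = z [^] j" if "[i = j] (mod int p)" for i j :: int
  proof -
    obtain t where "i - j = int p * t" using \<open>[i = j] (mod int p)\<close> by (auto simp: cong_iff_dvd_diff)
    then have "i = j + int p * t" by simp
    then show ?thesis
      using zc zp by (simp add: int_pow_mult int_pow_pow[symmetric])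
  qed
  have inv: "inv g \<in> carrier G" using g by simp
  have "inv g \<otimes> z \<otimes> inv (inv g) \<in> Z"
    using normal_inv_iff Z z inv by blast
  then obtain r :: int where "inv g \<otimes> z \<otimes> g = z [^] r"
    using prime_order_subgroup[OF p Zs card z False, of "inv g \<otimes> z \<otimes> g"] g by auto
  then have zg: "z \<otimes> g = g \<otimes> z [^] r"
    using zc g by (metis inv_solve_left' int_pow_closed inv_closed m_assoc m_closed)
  have it: "z \<otimes> g [^] k = g [^] k \<otimes> z [^] (r ^ k)" for k :: nat
  proof (induction k)
    case (Suc k)
    have "z \<otimes> g [^] Suc k = g [^] k \<otimes> (z [^] (r ^ k) \<otimes> g)"
      using zc g Suc by (simp add: m_assoc[symmetric])
    also have "z [^] (r ^ k) \<otimes> g = g \<otimes> (z [^] r) [^] (r ^ k)"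
      using zg zc g by (intro conj_int_pow) simp_all
    also have "g [^] k \<otimes> (g \<otimes> (z [^] r) [^] (r ^ k)) = g [^] Suc k \<otimes> z [^] (r ^ Suc k)"
      using zc g by (simp add: m_assoc int_pow_pow)
    finally show ?case .
  qed (use zc in simp)
  have fermat: "[r ^ (p ^ k) = r] (mod int p)" for k
  proof (induction k)
    case (Suc k)
    have "[(r ^ (p ^ k)) ^ p = r ^ p] (mod int p)" using Suc by (rule cong_pow)
    moreover have "[r ^ p = r] (mod int p)"
    proof (cases "int p dvd r")
      case True
      moreover have "0 < p" using p by (simp add: prime_gt_0_nat)
      ultimately have "int p dvd r ^ p - r" by (simp add: dvd_power_same dvd_power dvd_trans)
      then show ?thesis by (simp add: cong_iff_dvd_diff)
    next
      case False
      obtain s where s: "[r = int s] (mod int p)"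
        using p by (metis cong_mod_right cong_refl mod_int_pos_iff nat_0_le prime_gt_0_nat of_nat_0_less_iff pos_mod_sign)
      then have "\<not> p dvd s" using False by (metis cong_dvd_iff int_dvd_int_iff)
      then have "[s ^ (p - 1) = 1] (mod p)" using p fermat_theorem by blast
      then have "[s ^ (p - 1) * s = 1 * s] (mod p)" by (rule cong_scalar_right)
      moreover have "s ^ (p - 1) * s = s ^ p" using p by (metis power_minus_mult prime_gt_0_nat)
      ultimately have "[int s ^ p = int s] (mod int p)"
        by (metis cong_int_iff mult_1 of_nat_power)
      then show ?thesis using s by (meson cong_pow cong_sym cong_trans)
    qed
    ultimately show ?case by (simp add: power_mult[symmetric] mult.commute cong_trans)
  qed simp
  have "g [^] (p ^ e) = \<one>" using pow_order_eq_1[OF g] ord by simp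
  then have "z = z [^] (r ^ (p ^ e))" using it[of "p ^ e"] zc by simp
  also have "\<dots> = z [^] r" by (rule zeq[OF fermat])
  finally have "z [^] r = z" by (rule HOL.sym)
  with zg show ?thesis by simp
qed (use g in simp)

end

text \<open>\<open>D\<close>, \<open>Z\<close> and \<open>N\<close> abstract \<open>G'\<close>, \<open>G\<^sub>3\<close> and \<open>\<Phi>(G')G\<^sub>3\<close>. The relation \<open>E g u\<close> says that \<open>g\<close> and
  the normal form \<open>u\<close> have the same image in \<open>G/N \<cong> M\<^sub>p(n, m, 1)\<close>. All that is needed of the
  Frattini subgroup is that \<open>N\<close> lies in every maximal subgroup of \<open>D\<close> that contains \<open>Z\<close>.\<close>

locale central_ext = group G for G (structure) +
  fixes p n m :: nat and D Z N :: "'a set" and E :: "'a \<Rightarrow> int \<times> int \<times> int \<times> int \<Rightarrow> bool"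
  assumes fin: "finite (carrier G)" and p: "Factorial_Ring.prime p" and nm: "1 \<le> m" "m \<le> n"
    and p2: "p = 2 \<Longrightarrow> 1 < n"
    and D: "subgroup D G" and Z: "subgroup Z G" and N: "subgroup N G" and ZN: "Z \<subseteq> N" and ND: "N \<subseteq> D"
    and cmD: "\<lbrakk>x \<in> carrier G; y \<in> carrier G\<rbrakk> \<Longrightarrow> cm x y \<in> D"
    and cmZ: "\<lbrakk>x \<in> D; y \<in> carrier G\<rbrakk> \<Longrightarrow> cm x y \<in> Z"
    and Dmin: "\<lbrakk>subgroup H G; \<And>x y. \<lbrakk>x \<in> carrier G; y \<in> carrier G\<rbrakk> \<Longrightarrow> cm x y \<in> H\<rbrakk> \<Longrightarrow> D \<subseteq> H"
    and Zmin: "(\<And>x y. \<lbrakk>x \<in> D; y \<in> carrier G\<rbrakk> \<Longrightarrow> cm x y = \<one>) \<Longrightarrow> Z = {\<one>}"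
    and cardZ: "card Z = p" and cardN: "card N = p ^ 2"
    and Zc: "\<lbrakk>z \<in> Z; g \<in> carrier G\<rbrakk> \<Longrightarrow> z \<otimes> g = g \<otimes> z"
    and Np: "y \<in> N \<Longrightarrow> y [^] int p = \<one>"
    and maxN: "\<lbrakk>subgroup M G; M \<subset> D; Z \<subseteq> M; \<And>L. \<lbrakk>subgroup L G; M \<subseteq> L; L \<subseteq> D\<rbrakk> \<Longrightarrow> L = M \<or> L = D\<rbrakk> \<Longrightarrow> N \<subseteq> M"
    and E_carrier: "E g u \<Longrightarrow> g \<in> carrier G" and E_ex: "g \<in> carrier G \<Longrightarrow> \<exists>u. E g u"
    and E_surj: "\<exists>g. E g u"
    and E_mult: "\<lbrakk>E g u; E h v\<rbrakk> \<Longrightarrow> E (g \<otimes> h) (u \<otimes>\<^bsub>Gam\<^esub> v)"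
    and E_inv: "E g u \<Longrightarrow> E (inv g) (inv\<^bsub>Gam\<^esub> u)"
    and E_N: "E g u \<Longrightarrow> g \<in> N \<longleftrightarrow> u \<in> Lam0 p n m"
begin

section \<open>The chain Z, N, D and commutators with D\<close>

lemma mem_carrier [simp]: "x \<in> D \<Longrightarrow> x \<in> carrier G" "x \<in> N \<Longrightarrow> x \<in> carrier G" "x \<in> Z \<Longrightarrow> x \<in> carrier G"
  using D N Z subgroup.mem_carrier by fast+

lemma E_pow: "E g x \<Longrightarrow> E (g [^] (k::int)) (x [^]\<^bsub>Gam\<^esub> k)"
proof -
  assume E: "E g x"
  have "(0, 0, 0, 0) \<in> Lam0 p n m" by (simp add: Lam0_def)
  obtain g1 where g1: "E g1 (0, 0, 0, 0)" using E_surj by blast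
  have one: "E \<one> (0, 0, 0, 0)"
  proof -
    have "E (inv g1 \<otimes> g1) (inv\<^bsub>Gam\<^esub> (0, 0, 0, 0) \<otimes>\<^bsub>Gam\<^esub> (0, 0, 0, 0))"
      by (rule E_mult[OF E_inv[OF g1] g1])
    then show ?thesis using E_carrier[OF g1] by (simp add: inv_Gam)
  qed
  have nat: "E (g [^] n) (x [^]\<^bsub>Gam\<^esub> n)" for n :: nat
    by (induction n) (simp_all add: one E_mult E)
  show ?thesis
  proof (cases k rule: int_cases2)
    case (nonneg n)
    then show ?thesis using nat by (simp add: int_pow_int)
  next
    case (nonpos n)
    then show ?thesis
      using E_inv[OF nat[of n]] E_carrier[OF E] by (simp add: int_pow_neg_int group.int_pow_neg_int[OF group_Gam])
  qed
qed

text \<open>Commutators have exponent 0 at a and b, and the elements with this property form a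
  subgroup, which therefore contains D.\<close>

lemma E_D: "g \<in> D \<Longrightarrow> \<exists>k l. E g (0, 0, k, l)"
proof -
  assume g: "g \<in> D"
  define H where "H = {g. \<exists>k l. E g (0, 0, k, l)}"
  have "subgroup H G"
  proof (rule subgroupI)
    show "H \<subseteq> carrier G" unfolding H_def using E_carrier by blast
    show "H \<noteq> {}" unfolding H_def using E_surj by blast
    show "inv a \<in> H" if "a \<in> H" for a
      using that E_inv[of a] unfolding H_def by (fastforce simp: inv_Gam)
    show "a \<otimes> b \<in> H" if "a \<in> H" "b \<in> H" for a b
      using that E_mult[of a _ b] unfolding H_def by fastforce
  qed
  moreover have "cm x y \<in> H" if xy: "x \<in> carrier G" "y \<in> carrier G" for x y
  proof -
    obtain j i k l j' i' k' l' where E: "E x (j, i, k, l)" "E y (j', i', k', l')"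
      using E_ex xy by (metis prod_cases4)
    have "E (cm x y) (inv\<^bsub>Gam\<^esub> (j, i, k, l) \<otimes>\<^bsub>Gam\<^esub> inv\<^bsub>Gam\<^esub> (j', i', k', l') \<otimes>\<^bsub>Gam\<^esub> (j, i, k, l) \<otimes>\<^bsub>Gam\<^esub> (j', i', k', l'))"
      unfolding cm_def by (intro E_mult E_inv E)
    then show ?thesis unfolding H_def by (auto simp: inv_Gam)
  qed
  ultimately have "D \<subseteq> H" by (rule Dmin)
  then show ?thesis using g unfolding H_def by blast
qed

lemma N_iff: "E g (0, 0, k, l) \<Longrightarrow> g \<in> N \<longleftrightarrow> int p dvd k"
  using E_N[of g] by (simp add: Lam0_def)

text \<open>The exponent of c modulo p is a coordinate on D / N.\<close>

lemma D_pow: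
  assumes c: "c \<in> D"
  shows "c [^] int p \<in> N" "c \<notin> N \<Longrightarrow> c [^] (u::int) \<in> N \<longleftrightarrow> int p dvd u"
proof -
  obtain k l where E: "E c (0, 0, k, l)" using E_D[OF c] by blast
  have Eu: "E (c [^] u) (0, 0, u * k, u * l)" for u
    using E_pow[OF E, of u] by (simp add: Gam_pow_special)
  show "c [^] int p \<in> N" using N_iff[OF Eu] by simp
  show "c [^] (u::int) \<in> N \<longleftrightarrow> int p dvd u" if "c \<notin> N"
    using N_iff[OF Eu, of u] N_iff[OF E] that p by (simp add: prime_dvd_mult_iff)
qed

text \<open>The exponent u is the quotient modulo p of the c-exponents of g and of the given
  generator.\<close>

lemma D_decomp:
  assumes c: "c \<in> D" "c \<notin> N" and g: "g \<in> D"
  obtains u y where "g = c [^] (u::int) \<otimes> y" "y \<in> N"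
proof -
  obtain k l where E: "E c (0, 0, k, l)" using E_D[OF c(1)] by blast
  obtain k' l' where E': "E g (0, 0, k', l')" using E_D[OF g] by blast
  have "\<not> int p dvd k" using N_iff[OF E] c by simp
  then obtain s t where st: "k * s + int p * t = 1" by (rule prime_bezout[OF p])
  define u where "u = k' * s"
  have "k' - u * k = int p * (t * k')"
  proof -
    have "k' * (k * s + int p * t) = k'" using st by simp
    then show ?thesis by (simp add: u_def algebra_simps)
  qed
  then have dvd: "int p dvd - u * k + k'" by simp
  have "E (c [^] (- u) \<otimes> g) (0, 0, - u * k + k', - u * l + l')"
    using E_mult[OF E_pow[OF E, of "- u"] E'] by (simp add: Gam_pow_special)
  then have "c [^] (- u) \<otimes> g \<in> N" using N_iff dvd by blast
  moreover have "g = c [^] u \<otimes> (c [^] (- u) \<otimes> g)"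
    using c g by (simp add: m_assoc[symmetric] int_pow_mult[symmetric])
  ultimately show ?thesis by (rule that[rotated])
qed

lemma pow_mult_Z_subgroup:
  assumes c: "c \<in> carrier G"
  shows "subgroup {c [^] (u::int) \<otimes> z |u z. z \<in> Z} G"
proof (rule subgroupI)
  show "{c [^] (u::int) \<otimes> z |u z. z \<in> Z} \<subseteq> carrier G" using c by auto
  show "{c [^] (u::int) \<otimes> z |u z. z \<in> Z} \<noteq> {}" using subgroup.one_closed[OF Z] by blast
next
  fix x assume "x \<in> {c [^] (u::int) \<otimes> z |u z. z \<in> Z}"
  then obtain u z where x: "x = c [^] (u::int) \<otimes> z" "z \<in> Z" by blast
  have "inv x = c [^] (- u) \<otimes> inv z"
    using x c Zc[of "inv z" "inv (c [^] u)"] subgroup.m_inv_closed[OF Z] by (simp add: inv_mult_group int_pow_neg)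
  then show "inv x \<in> {c [^] (u::int) \<otimes> z |u z. z \<in> Z}"
    using x subgroup.m_inv_closed[OF Z] by blast
next
  fix x y assume "x \<in> {c [^] (u::int) \<otimes> z |u z. z \<in> Z}" "y \<in> {c [^] (u::int) \<otimes> z |u z. z \<in> Z}"
  then obtain u z v w where xy: "x = c [^] (u::int) \<otimes> z" "z \<in> Z" "y = c [^] (v::int) \<otimes> w" "w \<in> Z" by blast
  have "x \<otimes> y = c [^] u \<otimes> (z \<otimes> c [^] v) \<otimes> w" using xy c by (simp add: m_assoc)
  also have "z \<otimes> c [^] v = c [^] v \<otimes> z" using xy c by (intro Zc) simp_all
  finally have "x \<otimes> y = c [^] (u + v) \<otimes> (z \<otimes> w)" using xy c by (simp add: m_assoc int_pow_mult)
  then show "x \<otimes> y \<in> {c [^] (u::int) \<otimes> z |u z. z \<in> Z}"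
    using xy subgroup.m_closed[OF Z] by blast
qed

text \<open>The subgroup generated by y and Z properly contains Z, and its order divides
  p^2.\<close>

lemma N_decomp:
  assumes y: "y \<in> N" "y \<notin> Z" and w: "w \<in> N"
  obtains r z where "w = y [^] (r::int) \<otimes> z" "z \<in> Z"
proof -
  define L where "L = {y [^] (u::int) \<otimes> z |u z. z \<in> Z}"
  have L: "subgroup L G" unfolding L_def using y by (intro pow_mult_Z_subgroup) simp
  have LN: "L \<subseteq> N"
    unfolding L_def using y ZN int_pow_mem[OF N] subgroup.m_closed[OF N] by auto
  have finN: "finite N" using fin N subgroup.subset finite_subset by blast
  have "y \<otimes> \<one> \<in> L" unfolding L_def using subgroup.one_closed[OF Z] y(1) int_pow_1[of y] by (metis (mono_tags, lifting) mem_Collect_eq mem_carrier(2))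
  then have "y \<in> L" using y by simp
  moreover have "Z \<subseteq> L"
  proof
    fix z assume z: "z \<in> Z"
    then have "z = y [^] (0::int) \<otimes> z" by simp
    then show "z \<in> L" unfolding L_def using z by blast
  qed
  ultimately have "Z \<subset> L" using y by blast
  then have pL: "p < card L" using psubset_card_mono[of L Z] finite_subset[OF LN finN] cardZ by simp
  have "card L dvd p ^ 2" using card_subgroup_dvd[OF L N LN] cardN by simp
  then obtain i where "i \<le> 2" "card L = p ^ i" using p by (auto simp: divides_primepow_nat)
  moreover have "2 \<le> i"
  proof (rule ccontr)
    assume "\<not> 2 \<le> i"
    then have "i = 0 \<or> i = 1" by linarith
    then show False using pL \<open>card L = p ^ i\<close> prime_gt_1_nat[OF p] by auto
  qed
  ultimately have "card L = card N" using cardN by simp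
  then have "L = N" using LN finN by (intro card_subset_eq)
  then show ?thesis using w that unfolding L_def by blast
qed

text \<open>Otherwise the subgroup generated by \<open>c\<close> and \<open>Z\<close> would be maximal in \<open>D\<close> without containing \<open>N\<close>.\<close>

lemma D_pow_notin_Z:
  assumes c: "c \<in> D" "c \<notin> N"
  shows "c [^] int p \<notin> Z"
proof
  assume cp: "c [^] int p \<in> Z"
  have cc: "c \<in> carrier G" using c by simp
  obtain y0 where y0: "y0 \<in> N" "y0 \<notin> Z"
  proof -
    have "Z \<noteq> N"
    proof
      assume "Z = N"
      then have "p ^ 1 = p ^ 2" using cardZ cardN by simp
      then show False using p prime_gt_1_nat[OF p] by (simp only: power_inject_exp)
    qed
    then show ?thesis using ZN that by blast
  qed
  define M where "M = {c [^] (u::int) \<otimes> z |u z. z \<in> Z}"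
  have M: "subgroup M G" unfolding M_def using cc by (rule pow_mult_Z_subgroup)
  have ZM: "Z \<subseteq> M"
  proof
    fix z assume z: "z \<in> Z"
    then have "z = c [^] (0::int) \<otimes> z" by simp
    then show "z \<in> M" unfolding M_def using z by blast
  qed
  have cM: "c \<in> M"
  proof -
    have "c = c [^] (1::int) \<otimes> \<one>" using cc by simp
    then show ?thesis unfolding M_def using subgroup.one_closed[OF Z] by blast
  qed
  \<comment> \<open>A power of c that lies in N has an exponent divisible by p, so by assumption it
    lies in Z; then y0 would lie in Z as well.\<close>
  have y0M: "y0 \<notin> M"
  proof
    assume "y0 \<in> M"
    then obtain u z where uz: "y0 = c [^] (u::int) \<otimes> z" "z \<in> Z" unfolding M_def by blast
    then have eq: "c [^] u = y0 \<otimes> inv z"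
      using cc by (simp add: m_assoc)
    have "c [^] u \<in> N"
      unfolding eq using y0 uz(2) ZN subgroup.m_closed[OF N] subgroup.m_inv_closed[OF N] by blast
    then have "int p dvd u" using D_pow(2)[OF c] by simp
    then obtain v where "u = int p * v" by blast
    then have "c [^] u \<in> Z" using cp int_pow_mem[OF Z cp, of v] cc by (simp add: int_pow_pow)
    then show False using uz y0 subgroup.m_closed[OF Z] by blast
  qed
  have MD: "M \<subseteq> D"
    unfolding M_def using c ZN ND int_pow_mem[OF D] subgroup.m_closed[OF D] by auto
  have "N \<subseteq> M"
  proof (rule maxN[OF M _ ZM])
    show "M \<subset> D" using MD y0 y0M ND by blast
    fix L assume L: "subgroup L G" "M \<subseteq> L" "L \<subseteq> D"
    \<comment> \<open>If L is larger than M, it contains an element of N outside Z, hence N by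
      \<open>N_decomp\<close>, hence D by \<open>D_decomp\<close>.\<close>
    show "L = M \<or> L = D"
    proof (rule disjCI)
      assume "L \<noteq> D"
      show "L = M"
      proof (rule ccontr)
        assume "L \<noteq> M"
        then obtain x where x: "x \<in> L" "x \<notin> M" using L by blast
        obtain u y where uy: "x = c [^] (u::int) \<otimes> y" "y \<in> N"
          using D_decomp[OF c, of x] x L by blast
        have "y \<notin> Z" using x uy unfolding M_def by blast
        have cL: "c [^] v \<in> L" for v :: int using int_pow_mem[OF L(1)] cM L(2) by blast
        have "y = c [^] (- u) \<otimes> x" using uy cc by (simp add: int_pow_neg m_assoc[symmetric])
        then have yL: "y \<in> L" using cL x subgroup.m_closed[OF L(1)] by simp
        have NL: "N \<subseteq> L"
        proof
          fix w assume "w \<in> N"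
          then obtain r z where "w = y [^] (r::int) \<otimes> z" "z \<in> Z"
            using N_decomp[OF uy(2) \<open>y \<notin> Z\<close>] by blast
          then show "w \<in> L"
            using int_pow_mem[OF L(1) yL] ZM L(2) subgroup.m_closed[OF L(1)] by blast
        qed
        have "D \<subseteq> L"
        proof
          fix w assume "w \<in> D"
          then obtain u y where "w = c [^] (u::int) \<otimes> y" "y \<in> N" using D_decomp[OF c] by blast
          then show "w \<in> L" using cL NL subgroup.m_closed[OF L(1)] by blast
        qed
        with \<open>L \<noteq> D\<close> L show False by blast
      qed
    qed
  qed
  then show False using y0 y0M by blast
qed


text \<open>The commutator [c, g] lies in Z, which is central of exponent p, so [c^p, g] = [c, g]^p
  = 1.\<close>

lemma D_pow_central:
  assumes c: "c \<in> D" and g: "g \<in> carrier G"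
  shows "c [^] int p \<otimes> g = g \<otimes> c [^] int p"
proof -
  let ?z = "cm c g"
  have z: "?z \<in> Z" using cmZ c g by blast
  have "c [^] int p \<otimes> g = g \<otimes> (c \<otimes> ?z) [^] int p"
    using cm_eq[of c g] c g by (intro conj_int_pow) simp_all
  also have "(c \<otimes> ?z) [^] int p = c [^] int p \<otimes> ?z [^] int p"
    using c g z Zc[of ?z c] by (intro int_pow_mult_distrib) simp_all
  also have "?z [^] int p = \<one>" using z ZN Np by blast
  finally show ?thesis using c by simp
qed

lemma ex_D_notin_N:
  obtains c0 a0 b0 where "c0 \<in> D" "c0 \<notin> N" "E a0 (0, 1, 0, 0)" "E b0 (1, 0, 0, 0)" "c0 = cm a0 b0"
proof -
  obtain a0 where a0: "E a0 (0, 1, 0, 0)" using E_surj by blast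
  obtain b0 where b0: "E b0 (1, 0, 0, 0)" using E_surj by blast
  have "E (cm a0 b0) (inv\<^bsub>Gam\<^esub> (0, 1, 0, 0) \<otimes>\<^bsub>Gam\<^esub> inv\<^bsub>Gam\<^esub> (1, 0, 0, 0) \<otimes>\<^bsub>Gam\<^esub> (0, 1, 0, 0) \<otimes>\<^bsub>Gam\<^esub> (1, 0, 0, 0))"
    unfolding cm_def by (intro E_mult E_inv a0 b0)
  then have "cm a0 b0 \<in> N \<longleftrightarrow> int p dvd 1" by (simp add: inv_Gam N_iff)
  then have "cm a0 b0 \<notin> N" using prime_gt_1_nat[OF p] by simp
  then show ?thesis using that[of "cm a0 b0" a0 b0] cmD E_carrier a0 b0 by blast
qed

text \<open>N is generated by c^p and Z, both central.\<close>

lemma N_central: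
  assumes y: "y \<in> N" and g: "g \<in> carrier G"
  shows "y \<otimes> g = g \<otimes> y"
proof -
  obtain c where c: "c \<in> D" "c \<notin> N" using ex_D_notin_N by blast
  obtain r z where rz: "y = (c [^] int p) [^] (r::int) \<otimes> z" "z \<in> Z"
    using N_decomp[OF D_pow(1)[OF c(1)] D_pow_notin_Z[OF c] y] by blast
  have "(c [^] int p) [^] r \<otimes> g = g \<otimes> (c [^] int p) [^] r"
    by (rule conj_int_pow[OF D_pow_central[OF c(1) g]]) (use c g in simp_all)
  then show ?thesis
    using rz g c Zc[OF rz(2) g] by (simp add: m_assoc) (simp add: m_assoc[symmetric])
qed

text \<open>The values lie in the central subgroup Z, so commutation with c is
  multiplicative.\<close>

lemma cm_mult_right:
  assumes c: "c \<in> D" and "x \<in> carrier G" "y \<in> carrier G"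
  shows "cm c (x \<otimes> y) = cm c x \<otimes> cm c y"
proof -
  have cc: "c \<in> carrier G" using c by simp
  have Zx: "cm c x \<otimes> y = y \<otimes> cm c x" using Zc cmZ assms by blast
  have "x \<otimes> y \<otimes> (c \<otimes> cm c (x \<otimes> y)) = c \<otimes> (x \<otimes> y)"
    using cm_eq[of c "x \<otimes> y"] assms cc by simp
  also have "\<dots> = (c \<otimes> x) \<otimes> y" using assms cc by (simp add: m_assoc)
  also have "\<dots> = x \<otimes> (c \<otimes> (cm c x \<otimes> y))" unfolding cm_eq[OF cc assms(2)] using assms cc by (simp add: m_assoc)
  also have "\<dots> = x \<otimes> ((c \<otimes> y) \<otimes> cm c x)" unfolding Zx using assms cc by (simp add: m_assoc)
  also have "\<dots> = x \<otimes> y \<otimes> (c \<otimes> (cm c y \<otimes> cm c x))" unfolding cm_eq[OF cc assms(3)] using assms cc by (simp add: m_assoc)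
  also have "cm c y \<otimes> cm c x = cm c x \<otimes> cm c y" using Zc[of "cm c y" "cm c x"] cmZ assms cc by simp
  finally show ?thesis using assms cc by simp
qed

lemma cm_hom: "c \<in> D \<Longrightarrow> cm c \<in> hom G G"
  by (intro homI) (simp_all add: cm_mult_right)

lemma cm_one_iff: "\<lbrakk>x \<in> carrier G; y \<in> carrier G\<rbrakk> \<Longrightarrow> cm x y = \<one> \<longleftrightarrow> x \<otimes> y = y \<otimes> x"
  using comm_eq_iff[of x y \<one>] by (simp add: cm_def)

text \<open>As c' is c^u times a central element of N, commutation with c' is the u-th power of
  commutation with c, with u prime to p.\<close>

lemma cm_D:
  assumes c: "c \<in> D" "c \<notin> N" and c': "c' \<in> D" "c' \<notin> N"
  obtains u where "\<not> int p dvd u" "\<And>g. g \<in> carrier G \<Longrightarrow> cm c' g = cm c g [^] (u::int)"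
proof -
  obtain u y where uy: "c' = c [^] (u::int) \<otimes> y" "y \<in> N" using D_decomp[OF c c'(1)] by blast
  have "\<not> int p dvd u"
  proof
    assume "int p dvd u"
    then have "c [^] u \<in> N" using D_pow(2)[OF c] by blast
    then show False using uy c' subgroup.m_closed[OF N] by blast
  qed
  moreover have "cm c' g = cm c g [^] u" if g: "g \<in> carrier G" for g
  proof -
    have cc: "c \<in> carrier G" "c' \<in> carrier G" "y \<in> carrier G" using c c' uy by simp_all
    have z: "cm c g \<in> Z" using cmZ c g by blast
    have "c [^] u \<otimes> g = g \<otimes> (c \<otimes> cm c g) [^] u"
      using cm_eq[of c g] cc g by (intro conj_int_pow) simp_all
    also have "(c \<otimes> cm c g) [^] u = c [^] u \<otimes> cm c g [^] u"
      using cc g Zc[OF z cc(1)] by (intro int_pow_mult_distrib) simp_all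
    finally have 1: "c [^] u \<otimes> g = g \<otimes> (c [^] u \<otimes> cm c g [^] u)" .
    have 2: "y \<otimes> w = w \<otimes> y" if "w \<in> carrier G" for w by (rule N_central[OF uy(2) that])
    have "c' \<otimes> g = (c [^] u \<otimes> g) \<otimes> y" unfolding uy using 2[OF g] g cc by (simp add: m_assoc)
    also have "\<dots> = g \<otimes> (c [^] u \<otimes> (cm c g [^] u \<otimes> y))" unfolding 1 using g cc by (simp add: m_assoc)
    also have "\<dots> = g \<otimes> (c' \<otimes> cm c g [^] u)" unfolding uy using 2[of "cm c g [^] u"] g cc by (simp add: m_assoc)
    finally have "c' \<otimes> g = g \<otimes> (c' \<otimes> cm c g [^] u)" .
    then show ?thesis using comm_eq_iff[of c' g "cm c g [^] u"] g cc unfolding cm_def by simp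
  qed
  ultimately show ?thesis by (rule that)
qed

text \<open>c has order p modulo N, and c^p has order p modulo Z.\<close>

lemma pow_Z_iff:
  assumes c: "c \<in> D" "c \<notin> N" and k: "c [^] (k::int) \<in> Z"
  shows "(int p)\<^sup>2 dvd k"
proof -
  have cc: "c \<in> carrier G" using c by simp
  have "int p dvd k" using D_pow(2)[OF c] k ZN by blast
  then obtain k' where k': "k = int p * k'" by blast
  have "int p dvd k'"
  proof (rule ccontr)
    assume "\<not> int p dvd k'"
    moreover have "(c [^] int p) [^] k' \<in> Z" using k k' cc by (simp add: int_pow_pow)
    moreover have "(c [^] int p) [^] int p \<in> Z"
      using Np[OF D_pow(1)[OF c(1)]] subgroup.one_closed[OF Z] by simp
    ultimately have "c [^] int p \<in> Z" using mem_of_pow[OF p Z] cc by blast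
    then show False using D_pow_notin_Z[OF c] by simp
  qed
  then show ?thesis unfolding k' by (simp add: power2_eq_square)
qed

text \<open>What suitable generators have to satisfy. Here x and y are normal forms of a and b
  modulo N; \<open>ind\<close> says that they are as independent there as the standard ones, which
  controls the exponents of b and a in a relation.\<close>

lemma model_of_generators:
  assumes a: "E a x" and b: "E b y" and cN: "cm a b \<notin> N"
    and ca: "cm (cm a b) a = \<one>" and cb: "cm (cm a b) b \<noteq> \<one>"
    and an: "a [^] (int p ^ n) \<in> N" and bm: "b [^] (int p ^ m) \<in> N"
    and ind: "\<And>j i k l. y [^]\<^bsub>Gam\<^esub> (j::int) \<otimes>\<^bsub>Gam\<^esub> x [^]\<^bsub>Gam\<^esub> (i::int) \<otimes>\<^bsub>Gam\<^esub> (0, 0, k, l) \<in> Lam0 p n m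
      \<Longrightarrow> int p ^ m dvd j \<and> int p ^ n dvd i"
    and gen: "\<And>H. \<lbrakk>subgroup H G; a \<in> H; b \<in> H; N \<subseteq> H\<rbrakk> \<Longrightarrow> H = carrier G"
  shows "2 \<le> m \<and> (\<exists>q. model G p n m q)"
proof -
  define c where "c = cm a b"
  define d where "d = cm c b"
  have ac: "a \<in> carrier G" and bc: "b \<in> carrier G" using a b E_carrier by auto
  have c: "c \<in> D" "c \<notin> N" using cmD ac bc cN by (auto simp: c_def)
  have cc: "c \<in> carrier G" using c by simp
  have dZ: "d \<in> Z" unfolding d_def using cmZ c bc by blast
  have d1: "d \<noteq> \<one>" using cb by (simp add: d_def c_def)
  have dc: "d \<in> carrier G" using dZ by simp
  interpret q: gam_quad G a b c d
  proof unfold_locales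
    show "a \<otimes> b = b \<otimes> (a \<otimes> c)" unfolding c_def by (rule cm_eq[OF ac bc])
    show "c \<otimes> b = b \<otimes> (c \<otimes> d)" unfolding d_def by (rule cm_eq[OF cc bc])
    show "c \<otimes> a = a \<otimes> c" using ca cm_one_iff[OF cc ac] by (simp add: c_def)
  qed (use ac bc cc dc Zc[OF dZ] in simp_all)
  have dp: "d [^] int p = \<one>" using dZ ZN Np by blast
  have cpN: "c [^] int p \<in> N" by (rule D_pow(1)[OF c(1)])
  have cp2: "c [^] ((int p)\<^sup>2) = \<one>" using Np[OF cpN] cc by (simp add: int_pow_pow power2_eq_square)
  \<comment> \<open>N is generated by c^p and Z, and d generates Z. This supplies the four
    parameters.\<close>
  have Ndec: "\<exists>u v. w = c [^] (int p * u) \<otimes> d [^] (v::int)" if w: "w \<in> N" for w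
  proof -
    obtain r z where rz: "w = (c [^] int p) [^] (r::int) \<otimes> z" "z \<in> Z"
      using N_decomp[OF cpN D_pow_notin_Z[OF c] w] by blast
    obtain v where "z = d [^] (v::int)" using prime_order_subgroup[OF p Z cardZ dZ d1 rz(2)] by blast
    then show ?thesis using rz cc by (auto simp: int_pow_pow)
  qed
  obtain \<alpha> \<beta> where \<alpha>: "a [^] (int p ^ n) = c [^] (int p * \<alpha>) \<otimes> d [^] (\<beta>::int)" using Ndec[OF an] by blast
  obtain \<gamma> \<delta> where \<gamma>: "b [^] (int p ^ m) = c [^] (int p * \<gamma>) \<otimes> d [^] (\<delta>::int)" using Ndec[OF bm] by blast
  have cdZ: "(int p)\<^sup>2 dvd k" if "q.ev (0, 0, k, l) = \<one>" for k l
  proof -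
    have "c [^] k \<otimes> d [^] l = \<one>" using that cc by simp
    then have "c [^] k = inv (d [^] l)" using cc dc by (simp add: inv_equality)
    then have "c [^] k \<in> Z" using int_pow_mem[OF Z dZ, of l] subgroup.m_inv_closed[OF Z] by simp
    then show ?thesis by (rule pow_Z_iff[OF c])
  qed
  \<comment> \<open>b^(p^m) lies in N and is central, so its commutator c^(p^m)
    d^(\<open>tri\<close> (p^m)) with a is trivial. A power of c lies in Z only if p^2 divides its
    exponent.\<close>
  have m2: "2 \<le> m"
  proof -
    let ?N = "int p ^ m"
    have "q.ev (?N, 1, 0, 0) \<otimes> q.ev (0, 0, ?N, tri ?N) = q.ev (0, 1, 0, 0) \<otimes> q.ev (?N, 0, 0, 0)"
      unfolding q.ev_mult[symmetric] by simp
    also have "\<dots> = q.ev (?N, 0, 0, 0) \<otimes> q.ev (0, 1, 0, 0)"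
      using N_central[OF bm ac] ac bc by simp
    also have "\<dots> = q.ev (?N, 1, 0, 0)"
      unfolding q.ev_mult[symmetric] by simp
    finally have "q.ev (0, 0, ?N, tri ?N) = \<one>"
      by (simp del: q.ev.simps)
    then have "(int p)\<^sup>2 dvd ?N" by (rule cdZ)
    then have "int (p ^ 2) dvd int (p ^ m)" by simp
    then have "p ^ 2 dvd p ^ m" by (simp only: int_dvd_int_iff)
    then show ?thesis using prime_gt_1_nat[OF p] by (rule power_dvd_imp_le)
  qed
  have "model G p n m (\<alpha>, \<beta>, \<gamma>, \<delta>)"
  proof (rule gam_quad_model(2)[OF q.gam_quad_axioms HOL.refl dp cp2 \<alpha> \<gamma>])
    fix j i k l assume 1: "q.ev (j, i, k, l) = \<one>"
    obtain kc lc where Ec: "E c (0, 0, kc, lc)" using E_D[OF c(1)] by blast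
    obtain kd ld where Ed: "E d (0, 0, kd, ld)" using E_D dZ ZN ND by blast
    have "E (b [^] j \<otimes> a [^] i \<otimes> (c [^] k \<otimes> d [^] l))
      (y [^]\<^bsub>Gam\<^esub> j \<otimes>\<^bsub>Gam\<^esub> x [^]\<^bsub>Gam\<^esub> i \<otimes>\<^bsub>Gam\<^esub> ((0, 0, kc, lc) [^]\<^bsub>Gam\<^esub> k \<otimes>\<^bsub>Gam\<^esub> (0, 0, kd, ld) [^]\<^bsub>Gam\<^esub> l))"
      by (intro E_mult E_pow a b Ec Ed)
    moreover have "b [^] j \<otimes> a [^] i \<otimes> (c [^] k \<otimes> d [^] l) = \<one>"
      using 1 by (simp add: m_assoc)
    ultimately have "y [^]\<^bsub>Gam\<^esub> j \<otimes>\<^bsub>Gam\<^esub> x [^]\<^bsub>Gam\<^esub> i \<otimes>\<^bsub>Gam\<^esub> (0, 0, k * kc + l * kd, k * lc + l * ld) \<in> Lam0 p n m"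
      using E_N subgroup.one_closed[OF N] by (fastforce simp: Gam_pow_special)
    then show "int p ^ m dvd j \<and> int p ^ n dvd i" by (rule ind)
  next
    fix k l assume 1: "q.ev (0, 0, k, l) = \<one>"
    have k: "(int p)\<^sup>2 dvd k" by (rule cdZ[OF 1])
    then obtain k' where "k = (int p)\<^sup>2 * k'" by blast
    then have "c [^] k = (c [^] ((int p)\<^sup>2)) [^] k'" using int_pow_pow[OF cc] by simp
    then have "c [^] k = \<one>" using cp2 by simp
    then have dl: "d [^] l = \<one>" using 1 dc by simp
    have "int p dvd l"
    proof (rule ccontr)
      assume "\<not> int p dvd l"
      then have "d \<in> {\<one>}"
        using mem_of_pow[OF p triv_subgroup dc, of l] dl dp by simp
      then show False using d1 by simp
    qed
    with k show "(int p)\<^sup>2 dvd k \<and> int p dvd l" by blast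
  next
    interpret e: group_hom Gam G q.ev
      by (intro group_hom.intro group_hom_axioms.intro group_Gam is_group q.ev_hom)
    have sub: "subgroup (range q.ev) G" using e.img_is_subgroup by simp
    have mem: "a \<in> range q.ev" "b \<in> range q.ev" "c \<in> range q.ev" "d \<in> range q.ev"
      using q.ev_gens by (metis rangeI)+
    have "N \<subseteq> range q.ev"
    proof
      fix w assume "w \<in> N"
      then obtain u v where "w = c [^] (int p * u) \<otimes> d [^] (v::int)" using Ndec by blast
      then show "w \<in> range q.ev"
        using int_pow_mem[OF sub mem(3)] int_pow_mem[OF sub mem(4)] subgroup.m_closed[OF sub] by blast
    qed
    then show "range q.ev = carrier G" using gen[OF sub mem(1,2)] by blast
  qed
  then show ?thesis using m2 by blast
qed


text \<open>The hypothesis on the type of the centralizer excludes the case that \<open>b\<close> but not \<open>a\<close>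
  centralizes \<open>D\<close> when \<open>m < n\<close>: all \<open>g\<close> in the centralizer would then satisfy
  \<open>g ^ (p ^ (n - 1)) \<in> N\<close>.\<close>

lemma ex_model:
  assumes cent: "g \<in> carrier G" "\<And>h. h \<in> D \<Longrightarrow> g \<otimes> h = h \<otimes> g" "g [^] (int p ^ (n - 1)) \<notin> N"
  shows "2 \<le> m \<and> (\<exists>q. model G p n m q)"
proof -
  obtain c0 a0 b0 where c0: "c0 \<in> D" "c0 \<notin> N" and a0: "E a0 (0, 1, 0, 0)" and b0: "E b0 (1, 0, 0, 0)"
    and c0_eq: "c0 = cm a0 b0" using ex_D_notin_N by blast
  have cc: "c0 \<in> carrier G" "a0 \<in> carrier G" "b0 \<in> carrier G" using c0 a0 b0 E_carrier by auto
  interpret \<chi>: group_hom G G "cm c0"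
    by (intro group_hom.intro group_hom_axioms.intro is_group cm_hom c0)
  define za where "za = cm c0 a0"
  define zb where "zb = cm c0 b0"
  have zZ: "za \<in> Z" "zb \<in> Z" unfolding za_def zb_def using cmZ c0 cc by auto
  have \<chi>c: "cm c0 c0 = \<one>" using cc by (simp add: cm_one_iff)
  have decomp: "\<exists>y k. g = b0 [^] (j::int) \<otimes> a0 [^] (i::int) \<otimes> c0 [^] (k::int) \<otimes> y \<and> y \<in> N" if g: "E g (j, i, k', l')" for g j i k' l'
  proof -
    have gc: "g \<in> carrier G" using E_carrier g by blast
    have "E (inv (b0 [^] j \<otimes> a0 [^] i) \<otimes> g) (inv\<^bsub>Gam\<^esub> ((1, 0, 0, 0) [^]\<^bsub>Gam\<^esub> j \<otimes>\<^bsub>Gam\<^esub> (0, 1, 0, 0) [^]\<^bsub>Gam\<^esub> i) \<otimes>\<^bsub>Gam\<^esub> (j, i, k', l'))"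
      by (intro E_mult E_inv E_pow a0 b0 g)
    then obtain k l where h: "E (inv (b0 [^] j \<otimes> a0 [^] i) \<otimes> g) (0, 0, k, l)"
      by (auto simp: Gam_pow_special inv_Gam)
    obtain kc lc where Ec: "E c0 (0, 0, kc, lc)" using E_D[OF c0(1)] by blast
    have "\<not> int p dvd kc" using N_iff[OF Ec] c0 by simp
    then obtain s t where st: "kc * s + int p * t = 1" by (rule prime_bezout[OF p])
    \<comment> \<open>With s inverse modulo p to the c-exponent kc of c0, this power of c0 has the
      c-exponent of the element h, which is k.\<close>
    let ?u = "k * s"
    have "k - ?u * kc = int p * (t * k)"
    proof -
      have "k * (kc * s + int p * t) = k" using st by simp
      then show ?thesis by (simp add: algebra_simps)
    qed
    then have dvd: "int p dvd - ?u * kc + k" by simp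
    let ?y = "c0 [^] (- ?u) \<otimes> (inv (b0 [^] j \<otimes> a0 [^] i) \<otimes> g)"
    have "E ?y (0, 0, - ?u * kc + k, - ?u * lc + l)"
      using E_mult[OF E_pow[OF Ec, of "- ?u"] h] by (simp add: Gam_pow_special)
    then have "?y \<in> N" using N_iff dvd by blast
    moreover have "g = b0 [^] j \<otimes> a0 [^] i \<otimes> c0 [^] ?u \<otimes> ?y"
    proof -
      have "w \<otimes> v \<otimes> (inv v \<otimes> (inv w \<otimes> g)) = g" if "w \<in> carrier G" "v \<in> carrier G" for w v
      proof -
        have "w \<otimes> v \<otimes> (inv v \<otimes> (inv w \<otimes> g)) = w \<otimes> (v \<otimes> inv v) \<otimes> inv w \<otimes> g"
          using that gc by (simp only: m_assoc m_closed inv_closed)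
        then show ?thesis using that gc by simp
      qed
      from this[of "b0 [^] j \<otimes> a0 [^] i" "c0 [^] ?u"] show ?thesis
        using cc int_pow_neg[of c0 ?u] by simp
    qed
    ultimately show ?thesis by blast
  qed
  \<comment> \<open>The homomorphism g -> [c0, g] is trivial on c0 and on the central subgroup N, so
    only the exponents of b and a count.\<close>
  have \<chi>: "cm c0 g = zb [^] j \<otimes> za [^] i" if g: "E g (j, i, k', l')" for g j i k' l'
  proof -
    obtain y k where y: "g = b0 [^] (j::int) \<otimes> a0 [^] (i::int) \<otimes> c0 [^] (k::int) \<otimes> y" "y \<in> N"
      using decomp[OF g] by blast
    have "cm c0 y = \<one>" using N_central[OF y(2) cc(1)] y(2) cc by (simp add: cm_one_iff)
    then show ?thesis
      unfolding y(1) using cc y(2) \<chi>c by (simp add: \<chi>.hom_int_pow za_def zb_def)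
  qed
  have fromH: "H = carrier G" if H: "subgroup H G" "a0 \<in> H" "b0 \<in> H" "N \<subseteq> H" for H
  proof -
    have mc: "u \<otimes> v \<in> H" if "u \<in> H" "v \<in> H" for u v using that subgroup.m_closed[OF H(1)] by blast
    have cH: "c0 \<in> H"
      unfolding c0_eq cm_def by (intro mc subgroup.m_inv_closed[OF H(1)] H(2,3))
    have "g \<in> H" if "g \<in> carrier G" for g
    proof -
      obtain j i k' l' where "E g (j, i, k', l')" using E_ex \<open>g \<in> carrier G\<close> by (metis prod_cases4)
      then obtain y k where y: "g = b0 [^] (j::int) \<otimes> a0 [^] (i::int) \<otimes> c0 [^] (k::int) \<otimes> y" "y \<in> N"
        using decomp by blast
      show ?thesis
        unfolding y(1) by (intro mc int_pow_mem[OF H(1)] H(2,3) cH subsetD[OF H(4) y(2)])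
    qed
    then show ?thesis using subgroup.subset[OF H(1)] by blast
  qed
  \<comment> \<open>The conditions on [a, b] may be tested with c0 instead, since by
    \<open>cm_D\<close> the two homomorphisms differ by an exponent prime to p.\<close>
  have gens: "2 \<le> m \<and> (\<exists>q. model G p n m q)"
    if ab: "E a x" "E b y" and cN: "cm a b \<notin> N" and ca: "cm c0 a = \<one>" and cb: "cm c0 b \<noteq> \<one>"
      and an: "x [^]\<^bsub>Gam\<^esub> (int p ^ n) \<in> Lam0 p n m" and bm: "y [^]\<^bsub>Gam\<^esub> (int p ^ m) \<in> Lam0 p n m"
      and ind: "\<And>j i k l. y [^]\<^bsub>Gam\<^esub> (j::int) \<otimes>\<^bsub>Gam\<^esub> x [^]\<^bsub>Gam\<^esub> (i::int) \<otimes>\<^bsub>Gam\<^esub> (0, 0, k, l) \<in> Lam0 p n m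
        \<Longrightarrow> int p ^ m dvd j \<and> int p ^ n dvd i"
      and gen: "\<And>H. \<lbrakk>subgroup H G; a \<in> H; b \<in> H\<rbrakk> \<Longrightarrow> a0 \<in> H \<and> b0 \<in> H" for a b x y
  proof (rule model_of_generators[OF ab cN _ _ _ _ ind])
    have abc: "a \<in> carrier G" "b \<in> carrier G" using ab E_carrier by auto
    obtain u where u: "\<not> int p dvd u" "\<And>g. g \<in> carrier G \<Longrightarrow> cm (cm a b) g = cm c0 g [^] (u::int)"
      using cm_D[OF c0 cmD[OF abc] cN] by blast
    show "cm (cm a b) a = \<one>" using u(2) abc ca by simp
    show "cm (cm a b) b \<noteq> \<one>"
    proof
      assume "cm (cm a b) b = \<one>"
      then have 1: "cm c0 b [^] u \<in> {\<one>}" using u(2) abc by simp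
      have 2: "cm c0 b [^] int p \<in> {\<one>}" using Np cmZ[OF c0(1) abc(2)] ZN by blast
      have "cm c0 b \<in> {\<one>}" by (rule mem_of_pow[OF p triv_subgroup _ 1 2 u(1)]) (use cc abc in simp)
      with cb show False by simp
    qed
    show "a [^] (int p ^ n) \<in> N" "b [^] (int p ^ m) \<in> N"
      using E_N E_pow ab an bm by blast+
    show "H = carrier G" if "subgroup H G" "a \<in> H" "b \<in> H" "N \<subseteq> H" for H
      using fromH gen that by blast
  qed
  have pn: "int p ^ m dvd int p ^ n" using nm by (intro le_imp_power_dvd)
  show ?thesis
  proof (cases "zb = \<one>")
    case False
    \<comment> \<open>Z has order p, so a power of b0 corrects a0 to an element that commutes with
      c0.\<close>
    obtain s where s: "za = zb [^] (s::int)" using prime_order_subgroup[OF p Z cardZ zZ(2) False zZ(1)] by blast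
    let ?x = "(- s, 1, 0, 0) :: int \<times> int \<times> int \<times> int" and ?y = "(1, 0, 0, 0) :: int \<times> int \<times> int \<times> int"
    have Ea: "E (b0 [^] (- s) \<otimes> a0) ?x"
      using E_mult[OF E_pow[OF b0, of "- s"] a0] by (simp add: Gam_pow_special)
    \<comment> \<open>The p^n-th power of b0^(-s) a0 has c-exponent -s \<open>tri\<close> (p^n)
      modulo N, which has to vanish modulo p. For n = 1 this requires p to be odd.\<close>
    have tri: "int p dvd tri (int p ^ n)"
    proof (cases "n = 1")
      case True
      then have "p \<noteq> 2" using p2 by auto
      then have "coprime (int p) 2"
        using p by (simp add: prime_odd_nat prime_gt_1_nat prime_ge_2_nat order.not_eq_order_implies_strict)
      moreover have "int p dvd 2 * tri (int p ^ n)" unfolding two_tri True by simp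
      ultimately show ?thesis using coprime_dvd_mult_right_iff by blast
    next
      case False
      then show ?thesis using nm prime_dvd_tri_power(1)[OF p, of n] by simp
    qed
    show ?thesis
    proof (rule gens[OF Ea b0])
      have "E (cm (b0 [^] (- s) \<otimes> a0) b0) (inv\<^bsub>Gam\<^esub> ?x \<otimes>\<^bsub>Gam\<^esub> inv\<^bsub>Gam\<^esub> ?y \<otimes>\<^bsub>Gam\<^esub> ?x \<otimes>\<^bsub>Gam\<^esub> ?y)"
        unfolding cm_def by (intro E_mult E_inv Ea b0)
      then have "cm (b0 [^] (- s) \<otimes> a0) b0 \<in> N \<longleftrightarrow> int p dvd 1" by (simp add: inv_Gam N_iff)
      then show "cm (b0 [^] (- s) \<otimes> a0) b0 \<notin> N" using prime_gt_1_nat[OF p] by simp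
      show "cm c0 (b0 [^] (- s) \<otimes> a0) = \<one>"
        using \<chi>[OF Ea] s zZ by (simp add: int_pow_neg)
      show "cm c0 b0 \<noteq> \<one>" using False by (simp add: zb_def)
      have "?x [^]\<^bsub>Gam\<^esub> (p ^ n) \<in> Lam0 p n m"
        unfolding Gam_nat_pow using pn tri by (simp add: Lam0_def)
      then show "?x [^]\<^bsub>Gam\<^esub> (int p ^ n) \<in> Lam0 p n m" by (metis int_pow_int of_nat_power)
      show "?y [^]\<^bsub>Gam\<^esub> (int p ^ m) \<in> Lam0 p n m" by (simp add: Gam_pow_special Lam0_def)
      show "int p ^ m dvd j \<and> int p ^ n dvd i"
        if "?y [^]\<^bsub>Gam\<^esub> j \<otimes>\<^bsub>Gam\<^esub> ?x [^]\<^bsub>Gam\<^esub> i \<otimes>\<^bsub>Gam\<^esub> (0, 0, k, l) \<in> Lam0 p n m" for j i k l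
      proof -
        obtain k' l' where x: "?x [^]\<^bsub>Gam\<^esub> i = (i * - s, i * 1, k', l')" using Gam_int_pow_fst by blast
        have 1: "int p ^ m dvd j + i * - s" "int p ^ n dvd i"
          using that unfolding x by (simp_all add: Gam_pow_special Lam0_def)
        have "int p ^ m dvd i * - s" using 1(2) pn by (meson dvd_mult2 dvd_trans)
        then show ?thesis using 1 dvd_add_left_iff by blast
      qed
      show "a0 \<in> H \<and> b0 \<in> H" if H: "subgroup H G" "b0 [^] (- s) \<otimes> a0 \<in> H" "b0 \<in> H" for H
      proof -
        have "a0 = b0 [^] s \<otimes> (b0 [^] (- s) \<otimes> a0)" using cc by (simp add: int_pow_neg m_assoc[symmetric])
        then show ?thesis using H int_pow_mem[OF H(1,3)] subgroup.m_closed[OF H(1)] by metis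
      qed
    qed
  next
    case zb: True
    \<comment> \<open>Otherwise c0 is central, and so is D, which is generated by c0 and N; then Z
      would be trivial.\<close>
    have za: "za \<noteq> \<one>"
    proof
      assume "za = \<one>"
      have "cm x y = \<one>" if xy: "x \<in> D" "y \<in> carrier G" for x y
      proof -
        obtain j i k l where "E y (j, i, k, l)" using E_ex xy by (metis prod_cases4)
        then have c0y: "c0 \<otimes> y = y \<otimes> c0"
          using \<chi> \<open>za = \<one>\<close> zb xy cc by (simp add: cm_one_iff[symmetric])
        obtain u w where uw: "x = c0 [^] (u::int) \<otimes> w" "w \<in> N" using D_decomp[OF c0 xy(1)] by blast
        have "c0 [^] u \<otimes> y = y \<otimes> c0 [^] u" using c0y xy cc by (intro conj_int_pow) simp_all
        then have "x \<otimes> y = y \<otimes> x"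
          using uw xy cc N_central[OF uw(2) xy(2)] by (simp add: m_assoc) (simp add: m_assoc[symmetric])
        then show ?thesis using xy by (simp add: cm_one_iff)
      qed
      then have "Z = {\<one>}" by (rule Zmin)
      then show False using cardZ prime_gt_1_nat[OF p] by simp
    qed
    have "n = m"
    proof (rule ccontr)
      assume "n \<noteq> m"
      then have mn: "m \<le> n - 1" "1 \<le> n - 1" using nm by auto
      obtain j i k l where Eg: "E g (j, i, k, l)" using E_ex cent(1) by (metis prod_cases4)
      have "cm c0 g = \<one>" using cent(2)[OF c0(1)] cent(1) cc by (simp add: cm_one_iff)
      then have za_i: "za [^] i = \<one>" using \<chi>[OF Eg] zb zZ by simp
      have i: "int p dvd i"
      proof (rule ccontr)
        assume "\<not> int p dvd i"
        then have "za \<in> {\<one>}"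
          using mem_of_pow[OF p triv_subgroup, of za i] za_i Np zZ(1) ZN by auto
        then show False using za by simp
      qed
      have pp: "int p ^ n dvd int p ^ (n - 1) * i"
      proof -
        have "int p ^ n = int p ^ (n - 1) * int p" using nm by (metis le_trans power_minus_mult less_eq_Suc_le One_nat_def)
        then show ?thesis using i by (simp add: mult_dvd_mono)
      qed
      have pm: "int p ^ m dvd int p ^ (n - 1)" using mn by (intro le_imp_power_dvd)
      have p1: "int p dvd int p ^ (n - 1)" using mn by (intro dvd_power) linarith
      \<comment> \<open>The term i j \<open>tri\<close> (p^(n-1)) in the exponent of c vanishes
        modulo p because p divides i.\<close>
      have "(j, i, k, l) [^]\<^bsub>Gam\<^esub> (p ^ (n - 1)) \<in> Lam0 p n m"
        unfolding Gam_nat_pow using pp pm p1 i by (simp add: Lam0_def)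
      then have "(j, i, k, l) [^]\<^bsub>Gam\<^esub> (int p ^ (n - 1)) \<in> Lam0 p n m" by (metis int_pow_int of_nat_power)
      then have "g [^] (int p ^ (n - 1)) \<in> N" using E_N[OF E_pow[OF Eg]] by blast
      then show False using cent(3) by blast
    qed
    \<comment> \<open>For n = m the generators a0 and b0 may be exchanged.\<close>
    let ?x = "(1, 0, 0, 0) :: int \<times> int \<times> int \<times> int" and ?y = "(0, 1, 0, 0) :: int \<times> int \<times> int \<times> int"
    show ?thesis
    proof (rule gens[OF b0 a0])
      have "E (cm b0 a0) (inv\<^bsub>Gam\<^esub> ?x \<otimes>\<^bsub>Gam\<^esub> inv\<^bsub>Gam\<^esub> ?y \<otimes>\<^bsub>Gam\<^esub> ?x \<otimes>\<^bsub>Gam\<^esub> ?y)"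
        unfolding cm_def by (intro E_mult E_inv a0 b0)
      then have "cm b0 a0 \<in> N \<longleftrightarrow> int p dvd - 1" by (simp add: inv_Gam N_iff)
      then show "cm b0 a0 \<notin> N" using prime_gt_1_nat[OF p] by simp
      show "cm c0 b0 = \<one>" using zb by (simp add: zb_def)
      show "cm c0 a0 \<noteq> \<one>" using za by (simp add: za_def)
      show "?x [^]\<^bsub>Gam\<^esub> (int p ^ n) \<in> Lam0 p n m" "?y [^]\<^bsub>Gam\<^esub> (int p ^ m) \<in> Lam0 p n m"
        using \<open>n = m\<close> by (simp_all add: Gam_pow_special Lam0_def)
      show "int p ^ m dvd j \<and> int p ^ n dvd i"
        if "?y [^]\<^bsub>Gam\<^esub> j \<otimes>\<^bsub>Gam\<^esub> ?x [^]\<^bsub>Gam\<^esub> i \<otimes>\<^bsub>Gam\<^esub> (0, 0, k, l) \<in> Lam0 p n m" for j i k l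
        using that \<open>n = m\<close> by (simp add: Gam_pow_special Lam0_def)
    qed blast
  qed
qed

end

section \<open>The classification\<close>

lemma integer_mod_group_hom_pow:
  assumes "h \<in> hom G (integer_mod_group k)" "group G" "x \<in> carrier G"
  shows "h (x [^]\<^bsub>G\<^esub> (N::nat)) = (int N * h x) mod int k"
proof -
  interpret group_hom G "integer_mod_group k" h
    by (intro group_hom.intro group_hom_axioms.intro assms) simp
  show ?thesis using hom_nat_pow[OF assms(3)] by simp
qed

lemma DirProd_proj_hom:
  assumes "h \<in> hom G (H \<times>\<times> K)"
  shows "fst \<circ> h \<in> hom G H" "snd \<circ> h \<in> hom G K"
  using assms by (auto simp: hom_def Pi_iff mem_Times_iff mult_DirProd' DirProd_def split: prod.splits)

context group
begin

lemma derived_subset_if_cm: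
  assumes "subgroup H G" "\<And>x y. \<lbrakk>x \<in> carrier G; y \<in> carrier G\<rbrakk> \<Longrightarrow> cm x y \<in> H"
  shows "derived_subgroup G \<subseteq> H"
  unfolding derived_def
proof (rule generate_subgroup_incl[OF _ assms(1)])
  have "x \<otimes> y \<otimes> inv x \<otimes> inv y \<in> H" if "x \<in> carrier G" "y \<in> carrier G" for x y
    using assms(2)[of "inv x" "inv y"] that by (simp add: cm_def)
  then show "derived_set G (carrier G) \<subseteq> H" by blast
qed

text \<open>Such an M is a maximal subgroup of G', so it contains the Frattini subgroup of G' and,
  with G_3, the product of both.\<close>

lemma PhiG3_subset_if_maximal:
  assumes M: "subgroup M G" "M \<subset> derived_subgroup G" "G3 G \<subseteq> M"
    and max: "\<And>L. \<lbrakk>subgroup L G; M \<subseteq> L; L \<subseteq> derived_subgroup G\<rbrakk> \<Longrightarrow> L = M \<or> L = derived_subgroup G"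
  shows "PhiG3 G \<subseteq> M"
proof -
  let ?D = "derived_subgroup G"
  have D: "subgroup ?D G" using derived_normal by (rule normal_imp_subgroup)
  have "maximal_subgroup M (G\<lparr>carrier := ?D\<rparr>)"
    unfolding maximal_subgroup_def
  proof (intro conjI allI impI)
    show "subgroup M (G\<lparr>carrier := ?D\<rparr>)" using M D by (intro subgroup_incl) auto
    show "M \<noteq> carrier (G\<lparr>carrier := ?D\<rparr>)" using M by simp
    fix L assume L: "subgroup L (G\<lparr>carrier := ?D\<rparr>) \<and> M \<subseteq> L"
    then have "subgroup L G" using incl_subgroup[OF D] by blast
    moreover have "L \<subseteq> ?D" using L subgroup.subset[of L "G\<lparr>carrier := ?D\<rparr>"] by simp
    ultimately show "L = M \<or> L = carrier (G\<lparr>carrier := ?D\<rparr>)" using max L by simp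
  qed
  then have "frattini (G\<lparr>carrier := ?D\<rparr>) \<subseteq> M" by (auto simp: frattini_def)
  then show ?thesis
    unfolding PhiG3_def set_mult_def using M(3) subgroup.m_closed[OF M(1)] by blast
qed

lemma PhiG3_subset_derived: "PhiG3 G \<subseteq> derived_subgroup G"
proof -
  have D: "subgroup (derived_subgroup G) G" using derived_normal by (rule normal_imp_subgroup)
  have "frattini (G\<lparr>carrier := derived_subgroup G\<rparr>) \<subseteq> derived_subgroup G" by (auto simp: frattini_def)
  then show ?thesis
    unfolding PhiG3_def set_mult_def using G3_subset_derived subgroup.m_closed[OF D] by blast
qed

lemma centralizer_subgroup:
  assumes "H \<subseteq> carrier G"
  shows "subgroup (centralizer G H) G"
proof (rule subgroupI)
  show "centralizer G H \<subseteq> carrier G" by (auto simp: centralizer_def)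
  have "\<one> \<in> centralizer G H" using assms by (auto simp: centralizer_def subset_iff)
  then show "centralizer G H \<noteq> {}" by blast
next
  fix a assume a: "a \<in> centralizer G H"
  have "inv a \<otimes> h = h \<otimes> inv a" if h: "h \<in> H" for h
    using a h assms conj_int_pow[of a h a "- 1"] by (auto simp: centralizer_def int_pow_neg subset_iff)
  then show "inv a \<in> centralizer G H" using a by (simp add: centralizer_def)
next
  fix a b assume a: "a \<in> centralizer G H" and b: "b \<in> centralizer G H"
  have "a \<otimes> b \<otimes> h = h \<otimes> (a \<otimes> b)" if h: "h \<in> H" for h
  proof -
    have c: "a \<in> carrier G" "b \<in> carrier G" "h \<in> carrier G" and ah: "a \<otimes> h = h \<otimes> a" and bh: "b \<otimes> h = h \<otimes> b"
      using a b h assms by (auto simp: centralizer_def)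
    have "a \<otimes> b \<otimes> h = a \<otimes> h \<otimes> b" using c by (simp add: m_assoc bh)
    also have "\<dots> = h \<otimes> (a \<otimes> b)" unfolding ah using c by (simp add: m_assoc)
    finally show ?thesis .
  qed
  then show "a \<otimes> b \<in> centralizer G H" using a b by (simp add: centralizer_def)
qed

end

text \<open>A preimage of the generator of the first factor has order p^n modulo N.\<close>

lemma has_abelian_type3_ex_order:
  fixes G (structure)
  assumes G: "group G" and C: "subgroup C G" and N: "N \<lhd> G" "N \<subseteq> C" and p: "1 < (p::nat)" and n: "1 \<le> n"
    and type: "has_abelian_type3 (G\<lparr>carrier := C\<rparr> Mod N) (p ^ n) j k"
  shows "\<exists>g\<in>C. g [^]\<^bsub>G\<^esub> (p ^ (n - 1)) \<notin> N"
proof (rule ccontr)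
  interpret group G by (rule G)
  let ?C = "G\<lparr>carrier := C\<rparr>"
  have CG: "group ?C" using C by (rule subgroup.subgroup_is_group) (rule G)
  interpret N: normal N ?C by (rule normal_restrict_supergroup[OF C N])
  let ?Q = "?C Mod N"
  have Q: "group ?Q" by (rule N.factorgroup_is_group)
  assume *: "\<not> (\<exists>g\<in>C. g [^] (p ^ (n - 1)) \<notin> N)"
  obtain \<theta> where \<theta>: "\<theta> \<in> hom ?Q (integer_mod_group (p ^ n) \<times>\<times> (integer_mod_group j \<times>\<times> integer_mod_group k))"
    and bij: "bij_betw \<theta> (carrier ?Q) (carrier (integer_mod_group (p ^ n) \<times>\<times> (integer_mod_group j \<times>\<times> integer_mod_group k)))"
    using type unfolding has_abelian_type3_def is_iso_def iso_def by blast
  note h = DirProd_proj_hom(1)[OF \<theta>]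
  have "p ^ n \<noteq> 1" using p n by simp
  then have "(1, 0, 0) \<in> carrier (integer_mod_group (p ^ n) \<times>\<times> (integer_mod_group j \<times>\<times> integer_mod_group k))"
    by simp
  then obtain U where U: "U \<in> carrier ?Q" "\<theta> U = (1, 0, 0)"
    using bij unfolding bij_betw_def by (metis imageE)
  then obtain g where g: "g \<in> C" "U = N #>\<^bsub>?C\<^esub> g" by (auto simp: carrier_FactGroup)
  have "g [^] (p ^ (n - 1)) \<in> N" using * g by blast
  then have "g [^]\<^bsub>?C\<^esub> (p ^ (n - 1)) \<in> N" using nat_pow_consistent[of g _ C] by simp
  then have "N #>\<^bsub>?C\<^esub> (g [^]\<^bsub>?C\<^esub> (p ^ (n - 1))) = N"
    using N.rcos_const by blast
  then have "U [^]\<^bsub>?Q\<^esub> (p ^ (n - 1)) = \<one>\<^bsub>?Q\<^esub>"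
    unfolding g(2) using N.FactGroup_pow[of g "p ^ (n - 1)"] g(1) by simp
  then have "(fst \<circ> \<theta>) \<one>\<^bsub>?Q\<^esub> = (int (p ^ (n - 1)) * (fst \<circ> \<theta>) U) mod int (p ^ n)"
    using integer_mod_group_hom_pow[OF h Q U(1), of "p ^ (n - 1)"] by simp
  moreover have "(fst \<circ> \<theta>) \<one>\<^bsub>?Q\<^esub> = 0"
    using hom_one[OF h Q group_integer_mod_group] by simp
  ultimately have "int (p ^ (n - 1)) mod int (p ^ n) = 0" using U by simp
  moreover have "p ^ (n - 1) < p ^ n" using p n by (intro power_strict_increasing) auto
  then have "p ^ (n - 1) mod p ^ n = p ^ (n - 1)" by simp
  then have "int (p ^ (n - 1)) mod int (p ^ n) = int (p ^ (n - 1))" by (metis zmod_int)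
  ultimately show False using p by simp
qed

text \<open>Translation of the hypotheses into \<open>central_ext\<close>. Both G / N and
  \<open>Gam\<close> modulo \<open>Lam0\<close> are identified with M_p(n, m, 1), and E relates
  elements with the same image there.\<close>

lemma structure_model:
  fixes G (structure)
  assumes G: "group G" and p: "Factorial_Ring.prime p" and fin: "finite (carrier G)" and ord: "order G = p ^ e"
    and nm: "1 \<le> m" "m \<le> n" and p2: "p = 2 \<Longrightarrow> 1 < n"
    and Z: "G\<lparr>carrier := G3 G\<rparr> \<cong> integer_mod_group p"
    and N: "G\<lparr>carrier := PhiG3 G\<rparr> \<cong> integer_mod_group p \<times>\<times> integer_mod_group p"
    and Q: "G Mod PhiG3 G \<cong> M_p1 p n m"
    and type: "has_abelian_type3 (G\<lparr>carrier := centralizer G (derived_subgroup G)\<rparr> Mod PhiG3 G) (p ^ n) (p ^ (m - 1)) p"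
  shows "2 \<le> m \<and> (\<exists>q. model G p n m q)"
proof -
  interpret group G by (rule G)
  let ?D = "derived_subgroup G" and ?Z = "G3 G" and ?N = "PhiG3 G" and ?M = "M_p1 p n m"
  have p1: "1 < p" using p by (rule prime_gt_1_nat)
  have Ds: "subgroup ?D G" and Zs: "subgroup ?Z G" and Ns: "subgroup ?N G"
    using derived_normal G3_normal PhiG3_normal by (auto intro: normal_imp_subgroup)
  have cardZ: "card ?Z = p"
    using iso_same_card[OF Z] p1 by (simp add: carrier_integer_mod_group)
  have cardN: "card ?N = p ^ 2"
    using iso_same_card[OF N] p1 by (simp add: carrier_integer_mod_group card_cartesian_product power2_eq_square)
  have Np: "y [^] int p = \<one>" if y: "y \<in> ?N" for y
  proof -
    have NG: "group (G\<lparr>carrier := ?N\<rparr>)" using Ns by (rule subgroup.subgroup_is_group) (rule G)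
    obtain f where f: "f \<in> hom (G\<lparr>carrier := ?N\<rparr>) (integer_mod_group p \<times>\<times> integer_mod_group p)"
      and inj: "inj_on f ?N"
      using N unfolding is_iso_def iso_def bij_betw_def by auto
    have yp: "y [^] p \<in> ?N" using int_pow_mem[OF Ns y, of "int p"] by (simp add: int_pow_int)
    note f1 = DirProd_proj_hom[OF f]
    have 1: "(fst \<circ> f) (y [^] p) = 0" "(snd \<circ> f) (y [^] p) = 0"
      using integer_mod_group_hom_pow[OF f1(1) NG, of y p] integer_mod_group_hom_pow[OF f1(2) NG, of y p] y
        nat_pow_consistent[of y p ?N] by simp_all
    have 2: "(fst \<circ> f) \<one> = 0" "(snd \<circ> f) \<one> = 0"
      using hom_one[OF f1(1) NG group_integer_mod_group] hom_one[OF f1(2) NG group_integer_mod_group] by simp_all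
    have "f (y [^] p) = f \<one>" using 1 2 by (simp add: prod_eq_iff)
    then have "y [^] p = \<one>" using inj yp subgroup.one_closed[OF Ns] by (simp add: inj_on_eq_iff)
    then show ?thesis by (simp add: int_pow_int)
  qed
  obtain \<psi> where \<psi>: "\<psi> \<in> hom Gam ?M" "range \<psi> = carrier ?M" and ker: "\<And>x. \<psi> x = \<one>\<^bsub>?M\<^esub> \<longleftrightarrow> x \<in> Lam0 p n m"
    using M_p1_model[OF nm, of p] by blast
  obtain f where f: "f \<in> hom (G Mod ?N) ?M" and bij: "bij_betw f (carrier (G Mod ?N)) (carrier ?M)"
    using Q unfolding is_iso_def iso_def by blast
  have MG: "group ?M" unfolding M_p1_def by (rule group_presented_group)
  interpret N: normal ?N G by (rule PhiG3_normal)
  have QG: "group (G Mod ?N)" by (rule N.factorgroup_is_group)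
  define \<phi> where "\<phi> = (\<lambda>g. f (?N #> g))"
  have \<phi>: "\<phi> \<in> hom G ?M"
    using Group.hom_compose[OF N.r_coset_hom_Mod f] by (simp add: \<phi>_def comp_def)
  interpret \<phi>: group_hom G ?M \<phi> by (intro group_hom.intro group_hom_axioms.intro G MG \<phi>)
  interpret \<psi>: group_hom Gam ?M \<psi> by (intro group_hom.intro group_hom_axioms.intro group_Gam MG \<psi>)
  have ker\<phi>: "\<phi> g = \<one>\<^bsub>?M\<^esub> \<longleftrightarrow> g \<in> ?N" if g: "g \<in> carrier G" for g
  proof -
    have "f \<one>\<^bsub>G Mod ?N\<^esub> = \<one>\<^bsub>?M\<^esub>" by (rule hom_one[OF f QG MG])
    moreover have "?N #> g \<in> carrier (G Mod ?N)" using g by (auto simp: carrier_FactGroup)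
    moreover have "\<one>\<^bsub>G Mod ?N\<^esub> \<in> carrier (G Mod ?N)" using QG by (simp only: group.is_monoid monoid.one_closed)
    ultimately have "\<phi> g = \<one>\<^bsub>?M\<^esub> \<longleftrightarrow> ?N #> g = ?N"
      unfolding \<phi>_def using bij by (metis bij_betw_imp_inj_on inj_on_eq_iff one_FactGroup)
    then show ?thesis using N.mem_rcos_one_iff[OF g] by simp
  qed
  define E where "E = (\<lambda>g x. g \<in> carrier G \<and> \<phi> g = \<psi> x)"
  interpret central_ext G p n m ?D ?Z ?N E
  proof (intro central_ext.intro central_ext_axioms.intro)
    show "cm x y \<in> ?D" if "x \<in> carrier G" "y \<in> carrier G" for x y using that by (rule cm_derived)
    show "cm x y \<in> ?Z" if "x \<in> ?D" "y \<in> carrier G" for x y using that by (rule cm_G3)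
    show "?D \<subseteq> H" if "subgroup H G" "\<And>x y. \<lbrakk>x \<in> carrier G; y \<in> carrier G\<rbrakk> \<Longrightarrow> cm x y \<in> H" for H
      using that by (rule derived_subset_if_cm)
    show "?Z = {\<one>}" if "\<And>x y. \<lbrakk>x \<in> ?D; y \<in> carrier G\<rbrakk> \<Longrightarrow> cm x y = \<one>"
    proof
      show "?Z \<subseteq> {\<one>}"
        unfolding G3_eq using that by (intro generate_subgroup_incl triv_subgroup) blast
      show "{\<one>} \<subseteq> ?Z" using subgroup.one_closed[OF Zs] by simp
    qed
    show "z \<otimes> g = g \<otimes> z" if "z \<in> ?Z" "g \<in> carrier G" for z g
      by (rule prime_order_normal_central[OF p fin ord G3_normal cardZ that])
    show "?N \<subseteq> M" if "subgroup M G" "M \<subset> ?D" "?Z \<subseteq> M"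
      "\<And>L. \<lbrakk>subgroup L G; M \<subseteq> L; L \<subseteq> ?D\<rbrakk> \<Longrightarrow> L = M \<or> L = ?D" for M
      using that by (rule PhiG3_subset_if_maximal)
    show "\<exists>u. E g u" if "g \<in> carrier G" for g
      using that \<phi>.hom_closed[OF that] \<psi>(2) unfolding E_def by (metis rangeE)
    show "\<exists>g. E g u" for u
    proof -
      have "\<psi> u \<in> carrier ?M" by simp
      then obtain U where U: "U \<in> carrier (G Mod ?N)" "f U = \<psi> u"
        using bij unfolding bij_betw_def by (metis imageE)
      then obtain g where "g \<in> carrier G" "U = ?N #> g" by (auto simp: carrier_FactGroup)
      then show ?thesis using U unfolding E_def \<phi>_def by blast
    qed
    show "E (g \<otimes> h) (u \<otimes>\<^bsub>Gam\<^esub> v)" if "E g u" "E h v" for g h u v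
      using that by (simp add: E_def)
    show "E (inv g) (inv\<^bsub>Gam\<^esub> u)" if "E g u" for g u
      using that by (simp add: E_def)
    show "g \<in> ?N \<longleftrightarrow> u \<in> Lam0 p n m" if "E g u" for g u
      using that ker\<phi>[of g] ker[of u] by (auto simp: E_def)
  qed (use G fin p nm p2 Ds Zs Ns G3_subset_PhiG3 PhiG3_subset_derived cardZ cardN Np in \<open>auto simp: E_def\<close>)
  let ?C = "centralizer G ?D"
  have C: "subgroup ?C G" using subgroup.subset[OF Ds] by (rule centralizer_subgroup)
  have "?N \<subseteq> ?C" using N_central subgroup.subset[OF Ns] subgroup.subset[OF Ds] by (auto simp: centralizer_def)
  moreover have "1 \<le> n" using nm by simp
  \<comment> \<open>The first factor of the type of the centralizer provides the element that
    \<open>ex_model\<close> asks for.\<close>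
  ultimately obtain g where g: "g \<in> ?C" "g [^] (p ^ (n - 1)) \<notin> ?N"
    using has_abelian_type3_ex_order[OF G C PhiG3_normal _ p1 _ type] by blast
  show ?thesis
  proof (rule ex_model)
    show "g \<in> carrier G" "\<And>h. h \<in> ?D \<Longrightarrow> g \<otimes> h = h \<otimes> g" using g by (auto simp: centralizer_def)
    show "g [^] (int p ^ (n - 1)) \<notin> ?N" using g(2) by (metis int_pow_int of_nat_power)
  qed
qed

lemma group_listed_group: "group (listed_group p l)"
  by (cases l) (simp_all add: group_presented_group)

theorem theorem5p4:
  fixes p \<nu>\<^sub>0 :: nat
  assumes "Factorial_Ring.prime p"
    and "p \<noteq> 2 \<Longrightarrow> \<nu>\<^sub>0 < p \<and> \<not> QuadRes (int p) (int \<nu>\<^sub>0)"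
  shows "(\<forall>(G :: ('a, 'b) monoid_scheme) n m.
            group G \<and> finite (carrier G) \<and> (\<exists>k. order G = p ^ k) \<and>
            1 \<le> m \<and> m \<le> n \<and> (p = 2 \<longrightarrow> 1 < n) \<and>
            G\<lparr>carrier := G3 G\<rparr> \<cong> integer_mod_group p \<and>
            G\<lparr>carrier := PhiG3 G\<rparr> \<cong> integer_mod_group p \<times>\<times> integer_mod_group p \<and>
            G Mod PhiG3 G \<cong> M_p1 p n m \<and>
            has_abelian_type3 (G\<lparr>carrier := centralizer G (derived_subgroup G)\<rparr> Mod PhiG3 G)
              (p ^ n) (p ^ (m - 1)) p
          \<longrightarrow> (\<exists>l \<in> labels p \<nu>\<^sub>0 n m. G \<cong> listed_group p l))
       \<and> (\<forall>n m n' m'. \<forall>l \<in> labels p \<nu>\<^sub>0 n m. \<forall>l' \<in> labels p \<nu>\<^sub>0 n' m'.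
            l \<noteq> l' \<longrightarrow> \<not> listed_group p l \<cong> listed_group p l')"
proof -
  have lm: "model (listed_group p l) p (fst (dims l)) (snd (dims l)) (params p l)"
    "2 \<le> snd (dims l)" "snd (dims l) \<le> fst (dims l)" if "l \<in> labels p \<nu>\<^sub>0 n m" for l n m
    by (rule listed_model[OF assms(1) _ that]; use assms(2) in blast)+
  show ?thesis
  proof (intro conjI allI impI ballI)
    fix G :: "('a, 'b) monoid_scheme" and n m
    assume H: "group G \<and> finite (carrier G) \<and> (\<exists>k. order G = p ^ k) \<and>
              1 \<le> m \<and> m \<le> n \<and> (p = 2 \<longrightarrow> 1 < n) \<and>
              G\<lparr>carrier := G3 G\<rparr> \<cong> integer_mod_group p \<and>
              G\<lparr>carrier := PhiG3 G\<rparr> \<cong> integer_mod_group p \<times>\<times> integer_mod_group p \<and>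
              G Mod PhiG3 G \<cong> M_p1 p n m \<and>
              has_abelian_type3 (G\<lparr>carrier := centralizer G (derived_subgroup G)\<rparr> Mod PhiG3 G)
                (p ^ n) (p ^ (m - 1)) p"
    then obtain e where e: "order G = p ^ e" by blast
    have G: "group G" using H by blast
    obtain q where m: "2 \<le> m" and q: "model G p n m q"
      using structure_model[OF G assms(1) _ e] H by blast
    have mn: "m \<le> n" using H by blast
    \<comment> \<open>Besides equivalent parameters, l must have the exponents (n, m), so that only
      the parameters of the two quotients of \<open>Gam\<close> are left to match.\<close>
    have "\<exists>l \<in> labels p \<nu>\<^sub>0 n m. dims l = (n, m) \<and> param_equiv p n q (params p l)"
    proof (cases "p = 2 \<and> n = 2")
      case True
      then have "m = 2" using m mn by simp
      obtain l where l: "l \<in> K_labels 2" "param_equiv 2 2 q (params 2 l)" using K_complete by blast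
      then have "dims l = (2, 2)" by (auto simp: K_labels_def)
      then show ?thesis using l True \<open>m = 2\<close> by (auto simp: labels_def)
    next
      case False
      then have "p = 2 \<Longrightarrow> 3 \<le> n" using m mn by linarith
      then obtain l where l: "l \<in> L_labels p \<nu>\<^sub>0 n m" "param_equiv p n q (params p l)"
        using L_complete[OF assms(1) _ m mn, of \<nu>\<^sub>0 q] assms(2) by blast
      then have "dims l = (n, m)" by (auto simp: L_labels_def split: if_splits)
      then show ?thesis using l by (auto simp: labels_def)
    qed
    then obtain l where l: "l \<in> labels p \<nu>\<^sub>0 n m" "dims l = (n, m)" "param_equiv p n q (params p l)" by blast
    have "model G p n m (params p l)" by (rule model_change[OF G assms(1) m mn q l(3)])
    moreover have "model (listed_group p l) p n m (params p l)"
      using lm(1)[OF l(1)] l(2) by simp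
    ultimately have "G \<cong> listed_group p l" by (rule model_iso[OF _ _ G group_listed_group])
    then show "\<exists>l \<in> labels p \<nu>\<^sub>0 n m. G \<cong> listed_group p l" using l(1) by blast
  next
    fix n m n' m' l l'
    assume l: "l \<in> labels p \<nu>\<^sub>0 n m" and l': "l' \<in> labels p \<nu>\<^sub>0 n' m'" and ne: "l \<noteq> l'"
    show "\<not> listed_group p l \<cong> listed_group p l'"
    proof
      assume "listed_group p l \<cong> listed_group p l'"
      \<comment> \<open>The isomorphism transports the first model, so that both models are compared
        within a single group.\<close>
      then have 1: "model (listed_group p l') p (fst (dims l)) (snd (dims l)) (params p l)"
        by (rule model_cong[OF lm(1)[OF l] _ group_listed_group group_listed_group])
      note 2 = lm(1)[OF l']
      note d = lm(2,3)[OF l] and d' = lm(2,3)[OF l']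
      note E = model_param_equiv[OF group_listed_group assms(1) d d' 1 2] and E' = model_param_equiv[OF group_listed_group assms(1) d' d 2 1]
      \<comment> \<open>The inequalities from the two orders of comparison combine to
        equality.\<close>
      have dims: "dims l = dims l'" using E E' by (simp add: prod_eq_iff)
      then have param_equiv: "param_equiv p (fst (dims l)) (params p l) (params p l')" using E by simp
      have K: "p = 2 \<and> dims k = (2, 2)" if "k \<in> K_labels p" for k
        using that by (auto simp: K_labels_def split: if_splits)
      have L: "dims k = (N, M) \<and> \<not> (p = 2 \<and> N = 2)" if "k \<in> L_labels p \<nu>\<^sub>0 N M" for k N M
        using that by (auto simp: L_labels_def split: if_splits)
      have "l \<in> K_labels p \<or> l \<in> L_labels p \<nu>\<^sub>0 n m" "l' \<in> K_labels p \<or> l' \<in> L_labels p \<nu>\<^sub>0 n' m'"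
        using l l' by (simp_all add: labels_def)
      \<comment> \<open>A type (K) cannot meet a type (L): for p = 2 the exponents n = m = 2 occur
        among the types (K) only.\<close>
      then consider "l \<in> K_labels p" "l' \<in> K_labels p" | "l \<in> L_labels p \<nu>\<^sub>0 n m" "l' \<in> L_labels p \<nu>\<^sub>0 n' m'"
        using dims K L by (metis Pair_inject)
      then have "l = l'"
      proof cases
        case 1
        then show ?thesis using K_distinct[of l l'] K[OF 1(1)] param_equiv by auto
      next
        case 2
        then have "n = n'" "m = m'" using L[OF 2(1)] L[OF 2(2)] dims by auto
        then show ?thesis using L_distinct[OF assms(1), of \<nu>\<^sub>0 l n m l'] assms(2) 2 param_equiv L[OF 2(1)] by auto
      qed
      with ne show False by simp
    qed
  qed
qed

end
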